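(* Let $0<\alpha<\beta$ and $\nu\in ID$. Then $$\mathcal{J}^{\alpha}\bigl(\mathcal{J}^{\beta}(\nu^{\ast(\beta-\alpha)})\bigr)\ast\mathcal{J}^{\beta}(\nu^{\ast\alpha})=\mathcal{J}^{\alpha}(\nu^{\ast\beta}).$$ Equivalently, in terms of characteristic functions, for all $y\in\mathbb{R}^d$, $$(\beta-\alpha)\log\bigl(\mathcal{J}^{\alpha}(\mathcal{J}^{\beta}(\nu))\bigr)^{\wedge}(y)=\beta\log\bigl(\mathcal{J}^{\alpha}(\nu)\bigr)^{\wedge}(y)-\alpha\log\bigl(\mathcal{J}^{\beta}(\nu)\bigr)^{\wedge}(y).$$
   Context: $ID$ is the set of all infinitely divisible Borel probability measures on $\mathbb{R}^d$; $\ast$ denotes convolution. For $\mu\in ID$, $\hat\mu(y)=\mu^{\wedge}(y)=\int_{\mathbb{R}^d}e^{i\langle y,x\rangle}\mu(dx)$ is its characteristic function, and $\log\hat\mu$ is its Lévy exponent, i.e. the unique continuous function $\Phi$ on $\mathbb{R}^d$ with $\Phi(0)=0$ and $\hat\mu=e^{\Phi}$. For $c>0$, $\mu^{\ast c}\in ID$ is the convolution power, i.e. the measure with characteristic function $\exp(c\log\hat\mu)$. $\mathcal{L}(X)$ denotes the probability distribution of a random vector $X$. For $\nu\in ID$, $(Y_\nu(t))_{t\ge 0}$ denotes an $\mathbb{R}^d$-valued Lévy process (started at zero, stationary independent increments, right continuous paths with finite left limits) with $\mathcal{L}(Y_\nu(1))=\nu$. Random integrals are defined pathwise by formal integration by parts: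 for a continuous function $h$ of bounded variation on $[0,1]$ and a continuous nondecreasing $r:[0,1]\to[0,\infty)$, $$\int_0^1 h(t)\,dY(r(t)):=h(1)Y(r(1))-h(0)Y(r(0))-\int_{(0,1]}Y(r(t)-)\,dh(t).$$ For $\beta>0$ the mapping $\mathcal{J}^\beta: ID\to ID$ is defined by $$\mathcal{J}^\beta(\nu):=\mathcal{L}\Bigl(\int_0^1 t^{1/\beta}\,dY_\nu(t)\Bigr)=\mathcal{L}\Bigl(\int_0^1 t\,dY_\nu(t^\beta)\Bigr).$$ *)

theory Defs
  imports "HOL-Probability.Probability"
begin

section \<open>Infinitely divisible measures\<close>

definition borel_prob :: "'a::topological_space measure \<Rightarrow> bool" where
  "borel_prob \<mu> \<longleftrightarrow> prob_space \<mu> \<and> sets \<mu> = sets borel"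

primrec conv_pow :: "'a::ordered_euclidean_space measure \<Rightarrow> nat \<Rightarrow> 'a measure" where
  "conv_pow \<mu> 0 = return borel 0"
| "conv_pow \<mu> (Suc n) = (\<mu> \<star> conv_pow \<mu> n)"

definition ID :: "'a::ordered_euclidean_space measure set" where
  "ID = {\<mu>. borel_prob \<mu> \<and> (\<forall>n\<ge>1. \<exists>\<rho>. borel_prob \<rho> \<and> conv_pow \<rho> n = \<mu>)}"

definition charf :: "'a::euclidean_space measure \<Rightarrow> 'a \<Rightarrow> complex" where
  "charf \<mu> y = (CLINT x|\<mu>. iexp (y \<bullet> x))"

definition levy_exponent :: "'a::euclidean_space measure \<Rightarrow> 'a \<Rightarrow> complex" where
  "levy_exponent \<mu> =
     (THE \<Phi>. continuous_on UNIV \<Phi> \<and> \<Phi> 0 = 0 \<and> (\<forall>y. charf \<mu> y = exp (\<Phi> y)))"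

definition conv_powr :: "'a::euclidean_space measure \<Rightarrow> real \<Rightarrow> 'a measure" where
  "conv_powr \<mu> c =
     (THE \<rho>. borel_prob \<rho> \<and> (\<forall>y. charf \<rho> y = exp (of_real c * levy_exponent \<mu> y)))"


section \<open>Levy processes\<close>

text \<open>Processes are indexed by \<^typ>\<open>real\<close>, but only the times \<open>t \<ge> 0\<close> matter.\<close>

definition levy_process :: "'w measure \<Rightarrow> (real \<Rightarrow> 'w \<Rightarrow> 'a::euclidean_space) \<Rightarrow> bool" where
  "levy_process M Y \<longleftrightarrow>
     prob_space M \<and>
     (\<forall>t\<ge>0. Y t \<in> borel_measurable M) \<and>
     (\<forall>\<omega>\<in>space M. Y 0 \<omega> = 0) \<and>
     (\<forall>n. \<forall>t::nat \<Rightarrow> real. 0 \<le> t 0 \<and> (\<forall>i<n. t i \<le> t (Suc i)) \<longrightarrow>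
        prob_space.indep_vars M (\<lambda>_. borel) (\<lambda>i \<omega>. Y (t (Suc i)) \<omega> - Y (t i) \<omega>) {..<n}) \<and>
     (\<forall>s\<ge>0. \<forall>t\<ge>0. distr M borel (\<lambda>\<omega>. Y (s + t) \<omega> - Y s \<omega>) = distr M borel (Y t)) \<and>
     (\<forall>\<omega>\<in>space M. \<forall>t\<ge>0. ((\<lambda>s. Y s \<omega>) \<longlongrightarrow> Y t \<omega>) (at_right t)) \<and>
     (\<forall>\<omega>\<in>space M. \<forall>t>0. \<exists>l. ((\<lambda>s. Y s \<omega>) \<longlongrightarrow> l) (at_left t))"


section \<open>Random integrals\<close>

text \<open>The left limit \<open>f(s-)\<close> of a path on the half-line, with the usual convention
  \<open>f(0-) = f(0)\<close>.\<close>

definition left_lim :: "(real \<Rightarrow> 'a::euclidean_space) \<Rightarrow> real \<Rightarrow> 'a" where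
  "left_lim f s = (if s \<le> 0 then f 0 else Lim (at_left s) f)"

text \<open>The Lebesgue--Stieltjes integral of \<open>f\<close> over \<open>(0,1]\<close> with respect to \<open>dh\<close>, for \<open>h\<close>
  continuous and nondecreasing on \<open>[0,1]\<close>; these are the only integrators needed below.
  \<^const>\<open>interval_measure\<close> expects a monotone function on the whole line, so \<open>h\<close> is extended
  by constants outside \<open>[0,1]\<close>.\<close>

definition stieltjes_integral :: "(real \<Rightarrow> 'a::euclidean_space) \<Rightarrow> (real \<Rightarrow> real) \<Rightarrow> 'a" where
  "stieltjes_integral f h =
     (LINT t:{0<..1}|interval_measure (\<lambda>t. h (max 0 (min 1 t))). f t)"

text \<open>The pathwise integral of \<open>h\<close> over \<open>[0,1]\<close> with respect to \<open>dY(r(t))\<close>, by formal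
  integration by parts.\<close>

definition random_integral ::
    "(real \<Rightarrow> real) \<Rightarrow> (real \<Rightarrow> real) \<Rightarrow> (real \<Rightarrow> 'w \<Rightarrow> 'a::euclidean_space) \<Rightarrow> 'w \<Rightarrow> 'a" where
  "random_integral h r Y \<omega> =
     h 1 *\<^sub>R Y (r 1) \<omega> - h 0 *\<^sub>R Y (r 0) \<omega>
       - stieltjes_integral (\<lambda>t. left_lim (\<lambda>s. Y s \<omega>) (r t)) h"

text \<open>The law of \<open>\<integral> t\<^sup>1\<^sup>/\<^sup>\<beta> dY(t)\<close> over \<open>[0,1]\<close> for a Levy process \<open>Y\<close> with \<open>Y(1)\<close>
  distributed as \<open>\<nu>\<close>. It does not depend on the choice of \<open>Y\<close>, being determined by the
  finite-dimensional distributions. A definition cannot quantify over the type of the sample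
  space; taking the type of paths is no restriction, since a Levy process with a given law at
  time 1 can always be realised on it. The sigma-algebra and the probability on that type are
  arbitrary, and \<open>Y\<close> need not be the coordinate process.\<close>

definition J_map :: "real \<Rightarrow> 'a::euclidean_space measure \<Rightarrow> 'a measure" where
  "J_map \<beta> \<nu> =
     (THE \<rho>. \<exists>(M :: (real \<Rightarrow> 'a) measure) Y.
        levy_process M Y \<and> distr M borel (Y 1) = \<nu> \<and>
        \<rho> = distr M borel (random_integral (\<lambda>t. t powr (1 / \<beta>)) (\<lambda>t. t) Y))"

end

theory Submission
  imports Defs "HOL-Real_Asymp.Real_Asymp"
begin

text \<open>
  If \<open>\<Phi>\<close> is the Levy exponent of \<open>\<nu>\<close>, then Riemann sums identify the exponent of \<open>J\<^sup>\<beta>(\<nu>)\<close> as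
  \<open>y \<mapsto> \<integral> \<Phi>(t\<^sup>1\<^sup>/\<^sup>\<beta> y) dt\<close> over \<open>[0,1]\<close>, whatever Levy process realises \<open>\<nu>\<close>. Both claims reduce to
  \<open>(\<beta> - \<alpha>) \<integral>\<integral> f(s\<^sup>1\<^sup>/\<^sup>\<alpha> t\<^sup>1\<^sup>/\<^sup>\<beta>) dt ds = \<beta> \<integral> f(s\<^sup>1\<^sup>/\<^sup>\<alpha>) ds - \<alpha> \<integral> f(t\<^sup>1\<^sup>/\<^sup>\<beta>) dt\<close> for continuous
  \<open>f\<close>, which is a partial fraction identity on monomials and follows in general by Weierstrass.

  The mappings are only meaningful because every infinitely divisible \<open>\<nu>\<close> is the law at time 1 of a
  Levy process. The process is obtained at dyadic times by Kolmogorov extension from the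
  \<open>2\<^sup>n\<close>-th convolution roots of \<open>\<nu>\<close>. Ottaviani's inequality and
  \<open>P(|X\<^sub>t| > \<epsilon>) = O(t)\<close> show that the probability of two oscillations larger than \<open>\<epsilon>\<close>
  within one of the intervals of length \<open>2\<^sup>-\<^sup>m\<close> tends to 0, so almost every dyadic path extends to a
  right continuous one with left limits.
\<close>

section \<open>Measures and their characteristic functions\<close>

text \<open>The obstacle is that \<open>J_map\<close> and \<open>conv_powr\<close> are definite
  descriptions: nothing is known about \<open>J_map \<beta> \<nu>\<close> until some Levy process
  has law \<nu> at time 1 and all such processes give the same integral law. Uniqueness comes from
  the exponent formula; existence forces the whole path construction, on the sample space type that
  \<open>J_map\<close> fixes. Composing the two mappings adds a second demand, closure of
  \<open>ID\<close>. The same process meets it: its law at time c is the convolution power of order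
  c, and the n-th root of J(\<nu>) is J applied to the power of order 1/n. Limits of laws are taken
  only along almost surely convergent variables, so dominated convergence for characteristic
  functions takes the place of weak convergence and the continuity theorem. A value of a
  characteristic function fixes the exponent only up to multiples of 2 pi i. Continuity in y and the
  value 0 at the origin remove the ambiguity, so roots and logarithms are always treated as
  continuous functions and never point by point.\<close>

lemma borel_prob_distr:
  "prob_space M \<Longrightarrow> X \<in> borel_measurable M \<Longrightarrow> borel_prob (distr M borel X)"
  by (simp add: borel_prob_def prob_space.prob_space_distr)

lemma borel_probD:
  assumes "borel_prob \<mu>"
  shows "prob_space \<mu>" "sets \<mu> = sets borel" "space \<mu> = UNIV"
  using assms sets_eq_imp_space_eq[of \<mu> borel] by (auto simp: borel_prob_def)

lemma borel_prob_measurable: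
  "borel_prob \<mu> \<Longrightarrow> f \<in> borel_measurable borel \<Longrightarrow> f \<in> borel_measurable \<mu>"
  using measurable_cong_sets[OF borel_probD(2) refl] by blast

text \<open>Continuous approximation of the indicator of a nonempty closed set; the distance to the empty
  set is 0, so \<open>bump {} k\<close> is constantly 1.\<close>

definition bump :: "'a::metric_space set \<Rightarrow> nat \<Rightarrow> 'a \<Rightarrow> real" where
  "bump F k x = max 0 (1 - real k * infdist x F)"

lemma bump_continuous: "continuous_on UNIV (bump F k)"
  unfolding bump_def by (intro continuous_intros)

lemma bump_range: "bump F k x \<in> {0..1}"
  by (auto simp: bump_def infdist_nonneg)

lemma bump_tendsto:
  assumes "closed F" "F \<noteq> {}"
  shows "(\<lambda>k. bump F k x) \<longlonglongrightarrow> indicator F x"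
proof (cases "x \<in> F")
  case True
  then show ?thesis by (simp add: bump_def)
next
  case False
  then have d: "infdist x F > 0"
    using assms by (metis in_closed_iff_infdist_zero infdist_nonneg order_le_less)
  have "eventually (\<lambda>k. bump F k x = 0) sequentially"
  proof -
    obtain n :: nat where n: "1 / infdist x F < n" using reals_Archimedean2 by blast
    have "bump F k x = 0" if "k \<ge> n" for k
    proof -
      have "1 < real n * infdist x F" using n d by (simp add: field_simps)
      also have "\<dots> \<le> real k * infdist x F" using that d by (simp add: mult_right_mono)
      finally show ?thesis by (simp add: bump_def)
    qed
    then show ?thesis by (auto simp: eventually_sequentially)
  qed
  then show ?thesis using False by (simp add: tendsto_eventually)
qed

text \<open>Closed sets form an intersection-stable generator of the Borel sets, and the indicator
  of a nonempty closed set is a bounded pointwise limit of continuous functions with values in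
  [0,1].\<close>

lemma borel_prob_eqI_continuous:
  fixes \<mu> \<nu> :: "'a::euclidean_space measure"
  assumes \<mu>: "borel_prob \<mu>" and \<nu>: "borel_prob \<nu>"
    and eq: "\<And>f::'a \<Rightarrow> real. continuous_on UNIV f \<Longrightarrow> (\<And>x. f x \<in> {0..1}) \<Longrightarrow>
              (LINT x|\<mu>. f x) = (LINT x|\<nu>. f x)"
  shows "\<mu> = \<nu>"
proof -
  interpret \<mu>: prob_space \<mu> using \<mu> by (rule borel_probD)
  interpret \<nu>: prob_space \<nu> using \<nu> by (rule borel_probD)
  note S = borel_probD(2)[OF \<mu>] borel_probD(2)[OF \<nu>]
  have lim: "(\<lambda>k. LINT x|\<rho>. bump F k x) \<longlonglongrightarrow> measure \<rho> F"
    if \<rho>: "borel_prob \<rho>" and F: "closed F" "F \<noteq> {}" for \<rho> :: "'a measure" and F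
  proof -
    interpret \<rho>: prob_space \<rho> using \<rho> by (rule borel_probD)
    have [measurable]: "F \<in> sets \<rho>" using F borel_probD(2)[OF \<rho>] by auto
    have "(\<lambda>k. LINT x|\<rho>. bump F k x) \<longlonglongrightarrow> (LINT x|\<rho>. indicator F x)"
    proof (rule integral_dominated_convergence[where w="\<lambda>_. 1"])
      show "bump F k \<in> borel_measurable \<rho>" for k
        using bump_continuous by (intro borel_prob_measurable[OF \<rho>] borel_measurable_continuous_onI)
      show "AE x in \<rho>. (\<lambda>k. bump F k x) \<longlonglongrightarrow> indicator F x"
        using bump_tendsto[OF F] by simp
      show "AE x in \<rho>. norm (bump F k x) \<le> 1" for k
        using bump_range[of F k] by (auto simp: abs_le_iff intro!: AE_I2) 

    qed auto
    then show ?thesis using \<rho>.emeasure_eq_measure by (simp add: borel_probD(3)[OF \<rho>])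
  qed
  have main: "emeasure \<mu> F = emeasure \<nu> F" if F: "closed F" for F
  proof (cases "F = {}")
    case False
    have "(\<lambda>k. LINT x|\<mu>. bump F k x) = (\<lambda>k. LINT x|\<nu>. bump F k x)"
      using eq[OF bump_continuous bump_range] by auto
    then have "measure \<mu> F = measure \<nu> F"
      using lim[OF \<mu> F False] lim[OF \<nu> F False] LIMSEQ_unique by metis
    then show ?thesis by (simp add: \<mu>.emeasure_eq_measure \<nu>.emeasure_eq_measure)
  qed simp
  show ?thesis
  proof (rule measure_eqI_generator_eq[where \<Omega>=UNIV and E="Collect closed" and A="\<lambda>_::nat. UNIV"])
    show "Int_stable (Collect closed :: 'a set set)" by (auto simp: Int_stable_def)
    show "sets \<mu> = sigma_sets UNIV (Collect closed)" "sets \<nu> = sigma_sets UNIV (Collect closed)"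
      using S by (auto simp: borel_eq_closed)
  qed (use main in auto)
qed

section \<open>Elementary properties of characteristic functions\<close>

lemma iexp_inner_measurable [measurable]:
  "(\<lambda>x. iexp (y \<bullet> x)) \<in> borel_measurable (borel :: 'a::euclidean_space measure)"
  by (intro borel_measurable_continuous_onI continuous_intros)

lemma iexp_inner_integrable:
  fixes \<mu> :: "'a::euclidean_space measure"
  assumes "borel_prob \<mu>"
  shows "complex_integrable \<mu> (\<lambda>x. iexp (y \<bullet> x))"
proof -
  interpret prob_space \<mu> using assms by (rule borel_probD)
  show ?thesis
    by (rule integrable_const_bound[where B=1])
       (auto intro!: borel_prob_measurable[OF assms] iexp_inner_measurable simp: norm_exp_i_times)
qed

lemma charf_distr:
  fixes X :: "'w \<Rightarrow> 'a::euclidean_space"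
  assumes [measurable]: "X \<in> borel_measurable M"
  shows "charf (distr M borel X) y = (CLINT \<omega>|M. iexp (y \<bullet> X \<omega>))"
  unfolding charf_def by (subst integral_distr) auto

lemma charf_0: "borel_prob \<mu> \<Longrightarrow> charf \<mu> 0 = 1"
  using prob_space.prob_space[OF borel_probD(1), of \<mu>] by (simp add: charf_def scaleR_conv_of_real)

lemma norm_charf_le_1:
  assumes "borel_prob \<mu>" shows "norm (charf \<mu> y) \<le> 1"
proof -
  interpret prob_space \<mu> using assms by (rule borel_probD)
  have "norm (charf \<mu> y) \<le> (LINT x|\<mu>. norm (iexp (y \<bullet> x)))"
    unfolding charf_def by (rule integral_norm_bound)
  then show ?thesis by (simp add: norm_exp_i_times prob_space)
qed

lemma charf_continuous:
  fixes \<mu> :: "'a::euclidean_space measure"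
  assumes "borel_prob \<mu>" shows "continuous_on UNIV (charf \<mu>)"
proof -
  interpret prob_space \<mu> using assms by (rule borel_probD)
  have "isCont (charf \<mu>) y" for y
    unfolding continuous_at_sequentially
  proof safe
    fix u assume u: "u \<longlonglongrightarrow> y"
    show "(charf \<mu> \<circ> u) \<longlonglongrightarrow> charf \<mu> y"
      unfolding charf_def comp_def
    proof (rule integral_dominated_convergence[where w="\<lambda>_. 1"])
      show "AE x in \<mu>. (\<lambda>i. iexp (u i \<bullet> x)) \<longlonglongrightarrow> iexp (y \<bullet> x)"
        by (intro AE_I2 tendsto_intros u)
    qed (auto intro!: borel_prob_measurable[OF assms] simp: norm_exp_i_times)
  qed
  then show ?thesis by (simp add: continuous_on_eq_continuous_at)
qed

lemma charf_convolution:
  fixes \<mu> \<nu> :: "'a::ordered_euclidean_space measure"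
  assumes \<mu>: "borel_prob \<mu>" and \<nu>: "borel_prob \<nu>"
  shows "charf (\<mu> \<star> \<nu>) y = charf \<mu> y * charf \<nu> y"
proof -
  interpret \<mu>: prob_space \<mu> using \<mu> by (rule borel_probD)
  interpret \<nu>: prob_space \<nu> using \<nu> by (rule borel_probD)
  interpret P: pair_prob_space \<mu> \<nu> ..
  note [measurable_cong] = borel_probD(2)[OF \<mu>] borel_probD(2)[OF \<nu>]
  have "charf (\<mu> \<star> \<nu>) y = (CLINT z|\<mu> \<Otimes>\<^sub>M \<nu>. iexp (y \<bullet> (fst z + snd z)))"
    unfolding convolution_def by (subst charf_distr) (auto simp: split_beta')
  also have "\<dots> = (CLINT z|\<mu> \<Otimes>\<^sub>M \<nu>. iexp (y \<bullet> fst z) * iexp (y \<bullet> snd z))"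
    by (intro Bochner_Integration.integral_cong)
       (auto simp: inner_add_right exp_add[symmetric] ring_distribs)
  also have "\<dots> = (CLINT a|\<mu>. (CLINT b|\<nu>. iexp (y \<bullet> a) * iexp (y \<bullet> b)))"
    by (subst P.integral_fst'[symmetric])
       (auto intro!: P.integrable_const_bound[where B=1] simp: norm_mult norm_exp_i_times)
  also have "\<dots> = charf \<mu> y * charf \<nu> y"
    by (simp add: charf_def)
  finally show ?thesis .
qed

lemma borel_prob_convolution:
  fixes \<mu> \<nu> :: "'a::ordered_euclidean_space measure"
  assumes \<mu>: "borel_prob \<mu>" and \<nu>: "borel_prob \<nu>"
  shows "borel_prob (\<mu> \<star> \<nu>)"
proof -
  interpret \<mu>: prob_space \<mu> using \<mu> by (rule borel_probD)
  interpret \<nu>: prob_space \<nu> using \<nu> by (rule borel_probD)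
  interpret P: pair_prob_space \<mu> \<nu> ..
  note [measurable_cong] = borel_probD(2)[OF \<mu>] borel_probD(2)[OF \<nu>]
  show ?thesis unfolding convolution_def
    by (rule borel_prob_distr) (auto intro: P.prob_space_axioms)
qed

lemma charf_sum_indep:
  fixes \<xi> :: "'i \<Rightarrow> 'w \<Rightarrow> 'a::euclidean_space"
  assumes M: "prob_space M" and I: "finite I"
    and ind: "prob_space.indep_vars M (\<lambda>_. borel) \<xi> I"
  shows "charf (distr M borel (\<lambda>\<omega>. \<Sum>i\<in>I. \<xi> i \<omega>)) y = (\<Prod>i\<in>I. charf (distr M borel (\<xi> i)) y)"
proof -
  interpret prob_space M by (rule M)
  have [measurable]: "i \<in> I \<Longrightarrow> \<xi> i \<in> borel_measurable M" for i
    using ind by (auto simp: indep_vars_def)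
  have 1: "indep_vars (\<lambda>_. borel) (\<lambda>i \<omega>. iexp (y \<bullet> \<xi> i \<omega>)) I"
    by (rule indep_vars_compose2[OF ind]) measurable
  have "charf (distr M borel (\<lambda>\<omega>. \<Sum>i\<in>I. \<xi> i \<omega>)) y = (CLINT \<omega>|M. (\<Prod>i\<in>I. iexp (y \<bullet> \<xi> i \<omega>)))"
    using I by (subst charf_distr) (auto simp: inner_sum_right exp_sum sum_distrib_left)
  also have "\<dots> = (\<Prod>i\<in>I. CLINT \<omega>|M. iexp (y \<bullet> \<xi> i \<omega>))"
    by (rule indep_vars_lebesgue_integral[OF I 1])
       (auto intro!: integrable_const_bound[where B=1] simp: norm_exp_i_times)
  also have "\<dots> = (\<Prod>i\<in>I. charf (distr M borel (\<xi> i)) y)"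
    by (intro prod.cong refl) (subst charf_distr; simp)
  finally show ?thesis .
qed

section \<open>Uniqueness of characteristic functions in several dimensions\<close>

inductive trig_poly :: "('a::euclidean_space \<Rightarrow> complex) \<Rightarrow> bool" where
  monom: "trig_poly (\<lambda>x. c * iexp (y \<bullet> x))"
| add: "trig_poly f \<Longrightarrow> trig_poly g \<Longrightarrow> trig_poly (\<lambda>x. f x + g x)"

lemma trig_poly_const: "trig_poly (\<lambda>x. c)"
  using trig_poly.monom[of c 0] by simp

lemma trig_poly_mult:
  assumes "trig_poly f" "trig_poly g"
  shows "trig_poly (\<lambda>x. f x * g x)"
  using assms(1)
proof induction
  case (monom c y)
  show ?case using assms(2)
  proof induction
    case (monom d z)
    have "(\<lambda>x. c * iexp (y \<bullet> x) * (d * iexp (z \<bullet> x))) = (\<lambda>x. (c * d) * iexp ((y + z) \<bullet> x))"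
      by (auto simp: inner_add_left exp_add ring_distribs)
    then show ?case using trig_poly.monom[of "c*d" "y+z"] by simp
  next
    case (add f g)
    then show ?case by (simp add: trig_poly.add ring_distribs)
  qed
next
  case (add f g)
  then show ?case by (simp add: trig_poly.add ring_distribs)
qed

lemma trig_poly_sum:
  "finite I \<Longrightarrow> (\<And>i. i \<in> I \<Longrightarrow> trig_poly (f i)) \<Longrightarrow> trig_poly (\<lambda>x. \<Sum>i\<in>I. f i x)"
  by (induction rule: finite_induct) (auto intro: trig_poly_const trig_poly.add)

text \<open>The polynomials in \<open>sin_vec N x\<close> are trigonometric polynomials, they are dense in the continuous
  functions of the bounded vector \<open>sin_vec N x\<close>, and \<open>N *\<^sub>R sin_vec N x\<close> tends to \<open>x\<close>. So equality of
  characteristic functions carries over to integrals of bounded continuous functions.\<close>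

definition sin_vec :: "real \<Rightarrow> 'a::euclidean_space \<Rightarrow> 'a" where
  "sin_vec N x = (\<Sum>b\<in>Basis. sin ((x \<bullet> b) / N) *\<^sub>R b)"

lemma trig_poly_sin: "trig_poly (\<lambda>x. complex_of_real (sin ((x \<bullet> b) / N)))"
proof -
  have "complex_of_real (sin t) = (-\<i>/2) * iexp t + (\<i>/2) * iexp (- t)" for t
    by (simp add: sin_of_real[symmetric] sin_exp_eq field_simps)
  note sin_eq = this
  have "(b /\<^sub>R N) \<bullet> x = (x \<bullet> b) / N" for x
    by (simp add: inner_commute field_simps)
  then have "(\<lambda>x. complex_of_real (sin ((x \<bullet> b) / N))) =
      (\<lambda>x. (-\<i>/2) * iexp ((b /\<^sub>R N) \<bullet> x) + (\<i>/2) * iexp ((- (b /\<^sub>R N)) \<bullet> x))"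
    by (simp only: sin_eq inner_minus_left)
  then show ?thesis by (simp only: trig_poly.intros)
qed

text \<open>A linear form of \<open>sin_vec N x\<close> is a combination of sines of coordinates,
  each of which is a combination of two characters. Closure under products then covers all
  polynomials.\<close>

lemma trig_poly_real_polynomial:
  assumes "real_polynomial_function p"
  shows "trig_poly (\<lambda>x::'a::euclidean_space. complex_of_real (p (sin_vec N x)))"
  using assms
proof induction
  case (linear f)
  interpret bounded_linear f by fact
  have "(\<lambda>x. complex_of_real (f (sin_vec N x))) =
      (\<lambda>x. \<Sum>b\<in>Basis. complex_of_real (sin ((x \<bullet> b) / N)) * complex_of_real (f b))"
    by (simp add: sin_vec_def sum scaleR)
  then show ?case
    by (auto intro!: trig_poly_sum trig_poly_mult trig_poly_sin trig_poly_const)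
qed (auto intro: trig_poly.add trig_poly_mult trig_poly_const)

lemma trig_poly_integral_eq:
  assumes \<mu>: "borel_prob \<mu>" and \<nu>: "borel_prob \<nu>" and eq: "\<And>y. charf \<mu> y = charf \<nu> y"
    and f: "trig_poly f"
  shows "complex_integrable \<mu> f \<and> complex_integrable \<nu> f \<and> (CLINT x|\<mu>. f x) = (CLINT x|\<nu>. f x)"
  using f
proof induction
  case (monom c y)
  then show ?case
    using eq[of y] iexp_inner_integrable[OF \<mu>, of y] iexp_inner_integrable[OF \<nu>, of y]
    by (simp add: charf_def)
next
  case (add f g)
  then show ?case by simp
qed

lemma sin_vec_mem: "sin_vec N x \<in> cbox (-One) One"
  by (simp add: mem_box sin_vec_def inner_sum_left_Basis)

lemma sin_vec_continuous [continuous_intros]: "continuous_on UNIV (\<lambda>x. sin_vec N (x::'a::euclidean_space))"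
  unfolding sin_vec_def by (cases "N = 0") (auto intro!: continuous_intros)

lemma sin_vec_tendsto: "(\<lambda>n. real n *\<^sub>R sin_vec (real n) x) \<longlonglongrightarrow> (x::'a::euclidean_space)"
proof -
  have "(\<lambda>n. real n * sin (t / real n)) \<longlonglongrightarrow> t" for t :: real
    by real_asymp
  then have "(\<lambda>n. \<Sum>b\<in>Basis. (real n * sin ((x \<bullet> b) / real n)) *\<^sub>R b) \<longlonglongrightarrow> (\<Sum>b\<in>Basis. (x \<bullet> b) *\<^sub>R b)"
    by (intro tendsto_intros)
  then show ?thesis by (simp add: sin_vec_def scaleR_sum_right euclidean_representation)
qed


text \<open>There are two limits. For fixed n, Stone-Weierstrass on the cube replaces
  \<open>f (n *\<^sub>R s)\<close> by a polynomial up to e, so the integrals of \<open>g n\<close>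
  agree up to 2e for every e. Then n tends to infinity by dominated convergence, \<open>f\<close>
  being bounded.\<close>

lemma charf_unique:
  fixes \<mu> \<nu> :: "'a::euclidean_space measure"
  assumes \<mu>: "borel_prob \<mu>" and \<nu>: "borel_prob \<nu>" and eq: "\<And>y. charf \<mu> y = charf \<nu> y"
  shows "\<mu> = \<nu>"
proof (rule borel_prob_eqI_continuous[OF \<mu> \<nu>])
  fix f :: "'a \<Rightarrow> real"
  assume f: "continuous_on UNIV f" and f01: "\<And>x. f x \<in> {0..1}"
  interpret \<mu>: prob_space \<mu> using \<mu> by (rule borel_probD)
  interpret \<nu>: prob_space \<nu> using \<nu> by (rule borel_probD)
  define g where "g n x = f (real n *\<^sub>R sin_vec (real n) x)" for n x
  have gcont: "continuous_on UNIV (g n)" for n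
    unfolding g_def
    by (rule continuous_on_compose2[OF f]) (auto intro!: continuous_intros)
  have gint: "integrable \<rho> (g n)" if "borel_prob \<rho>" for \<rho> n
  proof -
    interpret prob_space \<rho> using that by (rule borel_probD)
    show ?thesis
      using f01 by (intro integrable_const_bound[where B=1] borel_prob_measurable[OF that]
        borel_measurable_continuous_onI gcont) (auto simp: g_def abs_le_iff intro: order_trans[of _ 0])
  qed
  have glim: "(\<lambda>n. LINT x|\<rho>. g n x) \<longlonglongrightarrow> (LINT x|\<rho>. f x)" if \<rho>: "borel_prob \<rho>" for \<rho>
  proof (rule integral_dominated_convergence[where w="\<lambda>_. 1"])
    interpret prob_space \<rho> using \<rho> by (rule borel_probD)
    show "integrable \<rho> (\<lambda>_. 1::real)" by simp
    show "f \<in> borel_measurable \<rho>" "g n \<in> borel_measurable \<rho>" for n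
      using f gcont by (auto intro!: borel_prob_measurable[OF \<rho>] borel_measurable_continuous_onI)
    have "isCont f x" for x using f by (simp add: continuous_on_eq_continuous_at)
    then show "AE x in \<rho>. (\<lambda>n. g n x) \<longlonglongrightarrow> f x"
      unfolding g_def by (intro AE_I2 isCont_tendsto_compose[OF _ sin_vec_tendsto])
    show "AE x in \<rho>. norm (g n x) \<le> 1" for n
      using f01 by (auto simp: g_def abs_le_iff intro: order_trans[of _ 0])
  qed
  have "(LINT x|\<mu>. g n x) = (LINT x|\<nu>. g n x)" for n
  proof -
    have "\<bar>(LINT x|\<mu>. g n x) - (LINT x|\<nu>. g n x)\<bar> \<le> 2 * e" if e: "e > 0" for e
    proof -
      have "continuous_on (cbox (-One) One) (\<lambda>s. f (real n *\<^sub>R s))"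
        by (rule continuous_on_compose2[OF f]) (auto intro!: continuous_intros)
      then obtain p where p: "real_polynomial_function p"
        and pe: "\<And>s. s \<in> cbox (-One) One \<Longrightarrow> \<bar>f (real n *\<^sub>R s) - p s\<bar> < e"
        using Stone_Weierstrass_real_polynomial_function[OF compact_cbox _ e] by metis
      define q where "q x = p (sin_vec (real n) x)" for x
      have qg: "\<bar>g n x - q x\<bar> \<le> e" for x
        using pe[OF sin_vec_mem[of n x]] by (simp add: g_def q_def)
      have q: "complex_integrable \<mu> q" "complex_integrable \<nu> q" "(CLINT x|\<mu>. q x) = (CLINT x|\<nu>. q x)"
        using trig_poly_integral_eq[OF \<mu> \<nu> eq trig_poly_real_polynomial[OF p, of n]]
        by (auto simp: q_def)
      then have q': "integrable \<mu> q" "integrable \<nu> q" "(LINT x|\<mu>. q x) = (LINT x|\<nu>. q x)"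
        by (auto simp: complex_of_real_integrable_eq)
      have close: "\<bar>(LINT x|\<rho>. g n x) - (LINT x|\<rho>. q x)\<bar> \<le> e" if \<rho>: "borel_prob \<rho>" "integrable \<rho> q" for \<rho>
      proof -
        interpret prob_space \<rho> using \<rho> by (intro borel_probD)
        have "norm (LINT x|\<rho>. g n x - q x) \<le> (LINT x|\<rho>. norm (g n x - q x))"
          by (rule integral_norm_bound)
        also have "\<dots> \<le> (LINT x|\<rho>. e)"
          using \<rho> gint[OF \<rho>(1)] qg by (intro integral_mono) auto
        finally show ?thesis using \<rho> gint[OF \<rho>(1)] by (simp add: prob_space)
      qed
      show ?thesis using close[OF \<mu> q'(1)] close[OF \<nu> q'(2)] q'(3) by linarith
    qed
    then show ?thesis
      by (metis abs_ge_zero abs_le_zero_iff dense_ge eq_iff_diff_eq_0 field_sum_of_halves half_gt_zero mult_2 mult_2_right)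
  qed
  then show "(LINT x|\<mu>. f x) = (LINT x|\<nu>. f x)"
    using glim[OF \<mu>] glim[OF \<nu>] LIMSEQ_unique by simp
qed

section \<open>Tail bounds from the characteristic function near the origin\<close>

lemma integral_one_minus_cos:
  fixes u :: real
  assumes "u \<noteq> 0"
  shows "(LINT t|restrict_space lborel {0..1}. 1 - cos (t * u)) = 1 - sin u / u"
proof -
  have "(LINT t|restrict_space lborel {0..1}. 1 - cos (t * u)) =
      (LINT t|lborel. (1 - cos (t * u)) * indicator {0..1} t)"
    by (subst integral_restrict_space) (simp_all add: mult.commute)
  also have "\<dots> = (1 - sin (1 * u) / u) - (0 - sin (0 * u) / u)"
    using assms by (intro integral_FTC_Icc_real) (auto intro!: derivative_eq_intros continuous_intros simp: field_simps)
  finally show ?thesis by simp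
qed

text \<open>Averaging 1 - cos(t u) over t in [0,1] gives 1 - sin u / u, which is nonnegative and at
  least 1/2 once |u| \<ge> 2. By Fubini the mean of this over \<mu>, with u = r (x . b), is the
  average over t of the real part of 1 - \<open>charf \<mu>\<close>, hence at most \<delta>.\<close>

lemma tail_bound_component:
  fixes \<mu> :: "'a::euclidean_space measure"
  assumes \<mu>: "borel_prob \<mu>" and r: "r \<ge> 0"
    and \<delta>: "\<And>t. t \<in> {0..1} \<Longrightarrow> norm (1 - charf \<mu> (t *\<^sub>R r *\<^sub>R b)) \<le> \<delta>"
  shows "measure \<mu> {x. \<bar>r * (x \<bullet> b)\<bar> \<ge> 2} \<le> 2 * \<delta>"
proof -
  interpret \<mu>: prob_space \<mu> using \<mu> by (rule borel_probD)
  define L where "L = restrict_space lborel {0..1::real}"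
  interpret L: prob_space L
    by (rule prob_spaceI) (simp add: L_def emeasure_restrict_space space_restrict_space)
  interpret P: pair_prob_space \<mu> L ..
  note [measurable_cong] = borel_probD(2)[OF \<mu>]
  have [measurable]: "(\<lambda>t. t) \<in> borel_measurable L"
    unfolding L_def by (rule measurable_restrict_space1) simp
  define h where "h x t = 1 - cos (t * (r * (x \<bullet> b)))" for x t
  have h: "0 \<le> h x t" "h x t \<le> 2" for x t
    using cos_ge_minus_one[of "t * (r * (x \<bullet> b))"] by (auto simp: h_def)
  have hm [measurable]: "(\<lambda>(x, t). h x t) \<in> borel_measurable (\<mu> \<Otimes>\<^sub>M L)"
    unfolding h_def by measurable
  have hint: "integrable (\<mu> \<Otimes>\<^sub>M L) (\<lambda>(x, t). h x t)"
    using h by (intro P.integrable_const_bound[where B=2]) auto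
  have inner: "(LINT x|\<mu>. h x t) = Re (1 - charf \<mu> (t *\<^sub>R r *\<^sub>R b))" for t
  proof -
    have int: "complex_integrable \<mu> (\<lambda>x. iexp ((t *\<^sub>R r *\<^sub>R b) \<bullet> x))"
      by (rule iexp_inner_integrable[OF \<mu>])
    have "Re (charf \<mu> (t *\<^sub>R r *\<^sub>R b)) = (LINT x|\<mu>. Re (iexp ((t *\<^sub>R r *\<^sub>R b) \<bullet> x)))"
      unfolding charf_def using int by (simp add: integral_Re)
    also have "\<dots> = (LINT x|\<mu>. cos (t * (r * (x \<bullet> b))))"
      by (simp add: Re_exp inner_commute mult.assoc)
    finally have "Re (charf \<mu> (t *\<^sub>R r *\<^sub>R b)) = (LINT x|\<mu>. cos (t * (r * (x \<bullet> b))))" .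
    moreover have "integrable \<mu> (\<lambda>x. cos (t * (r * (x \<bullet> b))))"
      by (rule \<mu>.integrable_const_bound[where B=1]) auto
    ultimately show ?thesis by (simp add: h_def \<mu>.prob_space)
  qed
  have "(LINT x|\<mu>. (LINT t|L. h x t)) = (LINT t|L. (LINT x|\<mu>. h x t))"
    using P.Fubini_integral[of h] hint by simp
  also have "\<dots> \<le> (LINT t|L. \<delta>)"
  proof (rule integral_mono)
    show "integrable L (\<lambda>t. LINT x|\<mu>. h x t)"
      using P.integrable_snd[OF hint] by simp
    show "(LINT x|\<mu>. h x t) \<le> \<delta>" if "t \<in> space L" for t
      using that \<delta>[of t] complex_Re_le_cmod[of "1 - charf \<mu> (t *\<^sub>R r *\<^sub>R b)"]
      by (simp add: inner L_def space_restrict_space)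
  qed simp
  also have "\<dots> = \<delta>" by (simp add: L.prob_space)
  finally have le: "(LINT x|\<mu>. (LINT t|L. h x t)) \<le> \<delta>" .
  let ?A = "{x. \<bar>r * (x \<bullet> b)\<bar> \<ge> 2}"
  have [measurable]: "?A \<in> sets \<mu>" using borel_probD(2)[OF \<mu>] by simp
  have "measure \<mu> ?A / 2 = (LINT x|\<mu>. indicator ?A x / 2)"
    using borel_probD(3)[OF \<mu>] by simp
  also have "\<dots> \<le> (LINT x|\<mu>. (LINT t|L. h x t))"
  proof (rule integral_mono)
    show "integrable \<mu> (\<lambda>x. LINT t|L. h x t)"
      using P.integrable_fst[OF hint] by simp
    fix x
    show "indicator ?A x / 2 \<le> (LINT t|L. h x t)"
    proof (cases "x \<in> ?A")
      case True
      define u where "u = r * (x \<bullet> b)"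
      have u: "\<bar>u\<bar> \<ge> 2" using True by (simp add: u_def)
      have "\<bar>sin u / u\<bar> \<le> 1 / 2"
      proof -
        have "\<bar>sin u\<bar> * 2 \<le> \<bar>u\<bar>" using u abs_sin_le_one[of u] by linarith
        then show ?thesis using u by (auto simp: abs_divide divide_simps)
      qed
      then have "sin u / u \<le> 1 / 2" by linarith
      moreover have "(LINT t|L. h x t) = 1 - sin u / u"
        using integral_one_minus_cos[of u] u unfolding L_def h_def u_def by fastforce
      ultimately show ?thesis using True by (simp only: indicator_simps)
    next
      case False
      then show ?thesis using h by (simp add: integral_nonneg_AE)
    qed
  qed (use borel_probD(3)[OF \<mu>] in \<open>auto simp: \<mu>.emeasure_eq_measure\<close>)
  finally show ?thesis using le by simp
qed

text \<open>R and C depend only on \<epsilon> and the dimension, and the bound is linear in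
  \<delta>. The linearity is what later yields tail probabilities of order t for increments over
  time t.\<close>

lemma tail_bound:
  fixes \<epsilon> :: real
  assumes "\<epsilon> > 0"
  shows "\<exists>R C. R \<ge> 0 \<and> C \<ge> 0 \<and> (\<forall>(\<mu>::'a::euclidean_space measure) \<delta>. borel_prob \<mu> \<longrightarrow>
     (\<forall>y. norm y \<le> R \<longrightarrow> norm (1 - charf \<mu> y) \<le> \<delta>) \<longrightarrow> measure \<mu> {x. norm x > \<epsilon>} \<le> C * \<delta>)"
proof (intro exI conjI allI impI)
  define d where "d = real DIM('a)"
  have d: "d > 0" by (simp add: d_def)
  \<comment> \<open>The witnesses are R = r and C = 2 d. If |x| > \<epsilon>, some coordinate
    exceeds \<epsilon>/d in modulus, which becomes 2 after scaling by r. The sum over the d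
    coordinates gives the factor d in C.\<close>
  define r where "r = 2 * d / \<epsilon>"
  have r: "r > 0" using assms d by (simp add: r_def)
  show "0 \<le> r" using r by simp
  show "0 \<le> 2 * d" using d by simp
  fix \<mu> :: "'a measure" and \<delta>
  assume \<mu>: "borel_prob \<mu>" and \<delta>: "\<forall>y. norm y \<le> r \<longrightarrow> norm (1 - charf \<mu> y) \<le> \<delta>"
  interpret \<mu>: prob_space \<mu> using \<mu> by (rule borel_probD)
  have [measurable]: "{x. \<bar>r * (x \<bullet> b)\<bar> \<ge> 2} \<in> sets \<mu>" for b using borel_probD(2)[OF \<mu>] by simp
  have "{x::'a. norm x > \<epsilon>} \<subseteq> (\<Union>b\<in>Basis. {x. \<bar>r * (x \<bullet> b)\<bar> \<ge> 2})"
  proof (rule subsetI, rule ccontr)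
    fix x :: 'a assume x: "x \<in> {x. norm x > \<epsilon>}" and "x \<notin> (\<Union>b\<in>Basis. {x. \<bar>r * (x \<bullet> b)\<bar> \<ge> 2})"
    then have "\<And>b. b \<in> Basis \<Longrightarrow> \<bar>x \<bullet> b\<bar> \<le> \<epsilon> / d"
      using r assms d by (force simp: abs_mult r_def field_simps)
    then have "(\<Sum>b\<in>Basis. \<bar>x \<bullet> b\<bar>) \<le> (\<Sum>b\<in>(Basis::'a set). \<epsilon> / d)" by (intro sum_mono)
    also have "\<dots> = \<epsilon>" using d by (simp add: d_def)
    finally show False using norm_le_l1[of x] x by simp
  qed
  then have "measure \<mu> {x. norm x > \<epsilon>} \<le> measure \<mu> (\<Union>b\<in>Basis. {x. \<bar>r * (x \<bullet> b)\<bar> \<ge> 2})"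
    by (intro \<mu>.finite_measure_mono) auto
  also have "\<dots> \<le> (\<Sum>b\<in>Basis. measure \<mu> {x. \<bar>r * (x \<bullet> b)\<bar> \<ge> 2})"
    by (intro \<mu>.finite_measure_subadditive_finite) auto
  also have "\<dots> \<le> (\<Sum>b\<in>(Basis::'a set). 2 * \<delta>)"
  proof (intro sum_mono tail_bound_component[OF \<mu>])
    fix b :: 'a and t :: real assume "b \<in> Basis" "t \<in> {0..1}"
    then show "norm (1 - charf \<mu> (t *\<^sub>R r *\<^sub>R b)) \<le> \<delta>"
      using r by (intro \<delta>[rule_format]) (auto simp: mult_left_le_one_le abs_mult)
  next
    show "0 \<le> r" using r by simp
  qed
  also have "\<dots> = 2 * d * \<delta>" by (simp add: d_def)
  finally show "measure \<mu> {x. norm x > \<epsilon>} \<le> 2 * d * \<delta>" .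
qed

section \<open>Exponents of infinitely divisible measures\<close>

text \<open>The quotient of \<open>f\<close> by exp(\<Phi>/n) is continuous with values in the
  finite set of n-th roots of unity, hence constant on a connected set, and it is 1 at the origin.
  The set S is a ball while zeros are still to be excluded, and the whole space afterwards.\<close>

lemma power_root_eq_exp:
  fixes f \<Phi> :: "'a::real_normed_vector \<Rightarrow> complex"
  assumes S: "connected S" "0 \<in> S" and f: "continuous_on S f" "f 0 = 1"
    and \<Phi>: "continuous_on S \<Phi>" "\<Phi> 0 = 0" and n: "n \<ge> 1"
    and eq: "\<And>y. y \<in> S \<Longrightarrow> f y ^ n = exp (\<Phi> y)" and y: "y \<in> S"
  shows "f y = exp (\<Phi> y / of_nat n)"
proof -
  define g where "g y = f y * exp (- (\<Phi> y / of_nat n))" for y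
  have root: "g y ^ n = 1" if "y \<in> S" for y
  proof -
    have "g y ^ n = exp (\<Phi> y) * exp (of_nat n * (- (\<Phi> y / of_nat n)))"
      unfolding g_def power_mult_distrib eq[OF that] by (simp only: exp_of_nat_mult)
    then show ?thesis using n by (simp add: exp_minus)
  qed
  have "g constant_on S"
  proof (rule continuous_finite_range_constant[OF S(1)])
    show "continuous_on S g" unfolding g_def using n by (intro continuous_intros f \<Phi>) auto
    have "g ` S \<subseteq> {z. z ^ n = 1}" using root by auto
    then show "finite (g ` S)" by (rule finite_subset) (rule finite_roots_unity[OF n])
  qed
  then have "g y = g 0" using S y by (auto simp: constant_on_def)
  also have "g 0 = 1" by (simp add: g_def f \<Phi>)
  finally have "f y = 1 / exp (- (\<Phi> y / of_nat n))"
    unfolding g_def by (simp add: divide_simps)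
  then show ?thesis by (simp add: exp_minus field_simps)
qed

text \<open>The difference of two logarithms takes values in the multiples of 2 pi i, which are at
  distance at least 2 pi from each other; continuity on a connected space makes it constant.\<close>

lemma continuous_log_unique:
  fixes \<Phi> \<Psi> :: "'a::real_normed_vector \<Rightarrow> complex"
  assumes \<Phi>: "continuous_on UNIV \<Phi>" "\<Phi> 0 = 0" and \<Psi>: "continuous_on UNIV \<Psi>" "\<Psi> 0 = 0"
    and eq: "\<And>y. exp (\<Phi> y) = exp (\<Psi> y)"
  shows "\<Phi> = \<Psi>"
proof -
  define D where "D y = \<Phi> y - \<Psi> y" for y
  have D1: "exp (D y) = 1" for y using eq by (simp add: D_def exp_diff)
  have gap: "2 * pi \<le> norm (D y - D x)" if "D y \<noteq> D x" for x y
  proof -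
    obtain m n :: int where mn: "Re (D x) = 0" "Im (D x) = of_int (2 * m) * pi"
        "Re (D y) = 0" "Im (D y) = of_int (2 * n) * pi"
      using D1[of x] D1[of y] unfolding exp_eq_1 by blast
    have "m \<noteq> n" using that mn by (auto simp: complex_eq_iff)
    then have "1 \<le> \<bar>real_of_int (n - m)\<bar>" by linarith
    then have "2 * pi * 1 \<le> 2 * pi * \<bar>real_of_int (n - m)\<bar>" by (intro mult_left_mono) auto
    also have "\<dots> = \<bar>2 * pi * real_of_int (n - m)\<bar>" by (simp add: abs_mult)
    also have "\<dots> = \<bar>Im (D y - D x)\<bar>" by (simp add: mn algebra_simps)
    also have "\<dots> \<le> norm (D y - D x)" by (rule abs_Im_le_cmod)
    finally show ?thesis by simp
  qed
  have "D constant_on UNIV"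
  proof (rule continuous_discrete_range_constant)
    show "continuous_on UNIV D" unfolding D_def by (intro continuous_intros \<Phi> \<Psi>)
    show "\<exists>e>0. \<forall>y. y \<in> UNIV \<and> D y \<noteq> D x \<longrightarrow> e \<le> norm (D y - D x)" for x
      using gap by (intro exI[of _ "2*pi"]) auto
  qed (rule convex_connected[OF convex_UNIV])
  then have "D y = D 0" for y by (auto simp: constant_on_def)
  then show ?thesis using \<Phi> \<Psi> by (auto simp: D_def)
qed

definition has_exponent :: "'a::euclidean_space measure \<Rightarrow> ('a \<Rightarrow> complex) \<Rightarrow> bool" where
  "has_exponent \<mu> \<Phi> \<longleftrightarrow> borel_prob \<mu> \<and> continuous_on UNIV \<Phi> \<and> \<Phi> 0 = 0 \<and> (\<forall>y. charf \<mu> y = exp (\<Phi> y))"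

lemma has_exponent_levy_exponent:
  assumes "has_exponent \<mu> \<Phi>" shows "levy_exponent \<mu> = \<Phi>"
  unfolding levy_exponent_def
proof (rule the_equality)
  show "continuous_on UNIV \<Phi> \<and> \<Phi> 0 = 0 \<and> (\<forall>y. charf \<mu> y = exp (\<Phi> y))"
    using assms by (simp add: has_exponent_def)
  fix \<Psi> assume "continuous_on UNIV \<Psi> \<and> \<Psi> 0 = 0 \<and> (\<forall>y. charf \<mu> y = exp (\<Psi> y))"
  then show "\<Psi> = \<Phi>" using assms by (intro continuous_log_unique) (auto simp: has_exponent_def)
qed

lemma has_exponent_unique:
  "has_exponent \<mu> \<Phi> \<Longrightarrow> has_exponent \<nu> \<Phi> \<Longrightarrow> \<mu> = \<nu>"
  by (rule charf_unique) (auto simp: has_exponent_def)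

lemma has_exponent_Re_le_0:
  assumes "has_exponent \<mu> \<Phi>" shows "Re (\<Phi> y) \<le> 0"
proof -
  have "norm (exp (\<Phi> y)) \<le> 1"
    using assms norm_charf_le_1[of \<mu> y] by (simp add: has_exponent_def)
  then show ?thesis by (simp add: norm_exp_eq_Re)
qed

lemma charf_return: "charf (return borel (0::'a::euclidean_space)) y = 1"
  unfolding charf_def by (subst integral_return) auto

lemma conv_pow_charf:
  fixes \<rho> :: "'a::ordered_euclidean_space measure"
  assumes "borel_prob \<rho>"
  shows "borel_prob (conv_pow \<rho> n) \<and> charf (conv_pow \<rho> n) y = charf \<rho> y ^ n"
proof (induction n)
  case 0
  show ?case by (simp add: borel_prob_def prob_space_return charf_return)
next
  case (Suc n)
  then show ?case using assms by (simp add: borel_prob_convolution charf_convolution)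
qed

text \<open>Integrates the pointwise inequality 1 - cos 2t \<le> 4 (1 - cos t), whose two sides
  differ by 2 (1 - cos t)^2.\<close>

lemma Re_charf_double:
  fixes \<mu> :: "'a::euclidean_space measure"
  assumes "borel_prob \<mu>"
  shows "1 - Re (charf \<mu> (2 *\<^sub>R y)) \<le> 4 * (1 - Re (charf \<mu> y))"
proof -
  interpret prob_space \<mu> using assms by (rule borel_probD)
  have Re: "Re (charf \<mu> z) = (LINT x|\<mu>. cos (z \<bullet> x))" for z
    unfolding charf_def using iexp_inner_integrable[OF assms, of z] by (simp add: integral_Re[symmetric] Re_exp)
  have int: "integrable \<mu> (\<lambda>x. cos (z \<bullet> x))" for z
    by (rule integrable_const_bound[where B=1])
       (auto intro!: borel_prob_measurable[OF assms] borel_measurable_continuous_onI continuous_intros)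
  have "1 - Re (charf \<mu> (2 *\<^sub>R y)) = (LINT x|\<mu>. 1 - cos ((2 *\<^sub>R y) \<bullet> x))"
    using int[of "2 *\<^sub>R y"] by (simp add: Re prob_space)
  also have "\<dots> \<le> (LINT x|\<mu>. 4 * (1 - cos (y \<bullet> x)))"
  proof (rule integral_mono)
    fix x
    have "1 - cos (2 * t) \<le> 4 * (1 - cos t)" for t :: real
    proof -
      have "4 * (1 - cos t) - (1 - cos (2 * t)) = 2 * (1 - cos t)\<^sup>2"
        unfolding cos_double_cos by (simp add: power2_eq_square algebra_simps)
      then show ?thesis by (smt (verit) zero_le_power2)
    qed
    from this[of "y \<bullet> x"] show "1 - cos ((2 *\<^sub>R y) \<bullet> x) \<le> 4 * (1 - cos (y \<bullet> x))" by simp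
  qed (use int[of y] int[of "2 *\<^sub>R y"] in auto)
  also have "\<dots> = 4 * (1 - Re (charf \<mu> y))"
    using int by (simp add: Re prob_space)
  finally show ?thesis .
qed

text \<open>On a ball without zeros the \<open>n\<close>-th root has the characteristic function \<open>exp (g / n)\<close>, which tends
  to 1; the doubling inequality then excludes zeros on the ball of twice the radius.\<close>

lemma ID_charf_nonzero:
  fixes \<mu> :: "'a::ordered_euclidean_space measure"
  assumes "\<mu> \<in> ID" shows "charf \<mu> y \<noteq> 0"
proof -
  have \<mu>: "borel_prob \<mu>" using assms by (simp add: ID_def)
  have "\<exists>\<rho>. borel_prob \<rho> \<and> (\<forall>y. charf \<rho> y ^ n = charf \<mu> y)" if "n \<ge> 1" for n
  proof -
    obtain \<rho> where \<rho>: "borel_prob \<rho>" "conv_pow \<rho> n = \<mu>"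
      using assms \<open>n \<ge> 1\<close> unfolding ID_def by blast
    have "charf \<rho> y ^ n = charf \<mu> y" for y
      using conv_pow_charf[OF \<rho>(1), of n y] \<rho>(2) by simp
    with \<rho> show ?thesis by blast
  qed
  then obtain \<rho> where \<rho>: "\<And>n. n \<ge> 1 \<Longrightarrow> borel_prob (\<rho> n)"
      "\<And>n y. n \<ge> 1 \<Longrightarrow> charf (\<rho> n) y ^ n = charf \<mu> y" by metis
  note cont = charf_continuous[OF \<mu>]
  have step: "charf \<mu> (2 *\<^sub>R y) \<noteq> 0" if r: "r > 0" "\<And>y. y \<in> cball 0 r \<Longrightarrow> charf \<mu> y \<noteq> 0" and y: "y \<in> cball 0 r" for r y
  proof -
    obtain g0 where g0: "continuous_on (cball 0 r) g0" "\<And>y. y \<in> cball 0 r \<Longrightarrow> charf \<mu> y = exp (g0 y)"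
      using continuous_logarithm_on_cball[of 0 r "charf \<mu>"] r cont continuous_on_subset by (metis subset_UNIV)
    define g where "g y = g0 y - g0 0" for y
    have 0: "0 \<in> cball (0::'a) r" using r by simp
    have g: "continuous_on (cball 0 r) g" "g 0 = 0" "\<And>y. y \<in> cball 0 r \<Longrightarrow> charf \<mu> y = exp (g y)"
      using g0 g0(2)[OF 0] charf_0[OF \<mu>] by (auto simp: g_def exp_diff intro!: continuous_intros)
    have rt: "charf (\<rho> n) y = exp (g y / of_nat n)" if "n \<ge> 1" for n
    proof (rule power_root_eq_exp[OF _ 0 _ _ g(1,2) that _ y])
      show "continuous_on (cball 0 r) (charf (\<rho> n))"
        using charf_continuous[OF \<rho>(1)[OF that]] continuous_on_subset by blast
      show "charf (\<rho> n) 0 = 1" using \<rho>(1)[OF that] by (rule charf_0)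
    qed (use \<rho>(2)[OF that] g(3) in auto)
    have "(\<lambda>n. exp (g y / of_nat n)) \<longlonglongrightarrow> exp 0"
      by (intro tendsto_exp tendsto_divide_0[OF tendsto_const tendsto_of_nat])
    then have "(\<lambda>n. Re (exp (g y / of_nat n))) \<longlonglongrightarrow> 1" using tendsto_Re by fastforce
    \<comment> \<open>From 1 - Re < 1/8 at y the doubling inequality gives 1 - Re < 1/2 at 2y, so
      the root cannot vanish there.\<close>
    then have "eventually (\<lambda>n. Re (exp (g y / of_nat n)) > 7/8) sequentially"
      by (rule order_tendstoD) simp
    then obtain n where n: "n \<ge> 1" "Re (exp (g y / of_nat n)) > 7/8"
      unfolding eventually_sequentially by (metis nat_le_linear)
    then have "Re (charf (\<rho> n) (2 *\<^sub>R y)) > 0"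
      using Re_charf_double[OF \<rho>(1)[OF n(1)], of y] rt[OF n(1)] by simp
    then have "charf (\<rho> n) (2 *\<^sub>R y) \<noteq> 0" by auto
    then show ?thesis using \<rho>(2)[OF n(1), of "2 *\<^sub>R y"] by auto
  qed
  have "isCont (charf \<mu>) 0" using cont by (simp add: continuous_on_eq_continuous_at)
  moreover have "charf \<mu> 0 \<noteq> 0" using charf_0[OF \<mu>] by simp
  ultimately have "\<forall>\<^sub>F x in at 0. charf \<mu> x \<noteq> 0"
    by (intro tendsto_imp_eventually_ne) (auto simp: isCont_def)
  then obtain r0 where r0: "r0 > 0" "\<And>x. x \<noteq> 0 \<Longrightarrow> dist x 0 < r0 \<Longrightarrow> charf \<mu> x \<noteq> 0"
    unfolding eventually_at by auto
  define r where "r = r0 / 2"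
  have r: "r > 0" "\<And>x. x \<in> cball 0 r \<Longrightarrow> charf \<mu> x \<noteq> 0"
  proof -
    show "r > 0" using r0 by (simp add: r_def)
    show "charf \<mu> x \<noteq> 0" if "x \<in> cball 0 r" for x
      using r0 charf_0[OF \<mu>] that by (cases "x = 0") (auto simp: r_def)
  qed
  have pow: "\<forall>x\<in>cball 0 (2 ^ k * r). charf \<mu> x \<noteq> 0" for k
  proof (induction k)
    case (Suc k)
    show ?case
    proof
      fix x :: 'a assume x: "x \<in> cball 0 (2 ^ Suc k * r)"
      have "charf \<mu> (2 *\<^sub>R (x /\<^sub>R 2)) \<noteq> 0"
        using Suc r x by (intro step[of "2 ^ k * r"]) auto
      then show "charf \<mu> x \<noteq> 0" by simp
    qed
  qed (use r in simp)
  obtain k where "norm y / r < 2 ^ k" using real_arch_pow[of 2 "norm y / r"] by auto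
  then have "y \<in> cball 0 (2 ^ k * r)" using r by (simp add: field_simps)
  then show ?thesis using pow by blast
qed

text \<open>A nowhere vanishing continuous function on a contractible space has a continuous
  logarithm. Subtracting its value at the origin does not change the exponential, because the
  characteristic function is 1 there. The roots then have the exponent \<Phi>/n by
  \<open>power_root_eq_exp\<close>.\<close>

lemma ID_has_exponent:
  fixes \<mu> :: "'a::ordered_euclidean_space measure"
  assumes "\<mu> \<in> ID"
  obtains \<Phi> where "has_exponent \<mu> \<Phi>" "\<And>n. n \<ge> 1 \<Longrightarrow> \<exists>\<rho>. has_exponent \<rho> (\<lambda>y. \<Phi> y / of_nat n)"
proof -
  have \<mu>: "borel_prob \<mu>" using assms by (simp add: ID_def)
  obtain g where g: "continuous_on UNIV g" "\<And>y. charf \<mu> y = exp (g y)"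
    using continuous_logarithm_on_contractible[of UNIV "charf \<mu>"] charf_continuous[OF \<mu>] ID_charf_nonzero[OF assms]
    by (metis UNIV_I contractible_UNIV)
  define \<Phi> where "\<Phi> y = g y - g 0" for y
  have \<Phi>: "has_exponent \<mu> \<Phi>"
    using \<mu> g(1) g(2)[symmetric] charf_0[OF \<mu>]
    by (auto simp: has_exponent_def \<Phi>_def exp_diff intro!: continuous_intros)
  have "\<exists>\<rho>. has_exponent \<rho> (\<lambda>y. \<Phi> y / of_nat n)" if n: "n \<ge> 1" for n
  proof -
    obtain \<rho> where \<rho>: "borel_prob \<rho>" "conv_pow \<rho> n = \<mu>"
      using assms n unfolding ID_def by blast
    have "charf \<rho> y = exp (\<Phi> y / of_nat n)" for y
      using \<Phi> conv_pow_charf[OF \<rho>(1), of n] \<rho>(2) charf_continuous[OF \<rho>(1)] charf_0[OF \<rho>(1)]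
      by (intro power_root_eq_exp[where S=UNIV] n convex_connected[OF convex_UNIV]) (auto simp: has_exponent_def)
    then show ?thesis
      using \<Phi> \<rho> n by (intro exI[of _ \<rho>]) (auto simp: has_exponent_def intro!: continuous_intros)
  qed
  with \<Phi> show ?thesis using that by blast
qed

text \<open>The converse, in the form used to show that convolution powers and images under
  \<open>J_map\<close> stay in \<open>ID\<close>: measures with exponents \<Phi>/n are convolution
  roots by uniqueness.\<close>

lemma IDI_has_exponent:
  fixes \<mu> :: "'a::ordered_euclidean_space measure"
  assumes \<mu>: "has_exponent \<mu> \<Phi>"
    and root: "\<And>n. n \<ge> 1 \<Longrightarrow> \<exists>\<rho>. has_exponent \<rho> (\<lambda>y. \<Phi> y / of_nat n)"
  shows "\<mu> \<in> ID"
  unfolding ID_def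
proof (intro CollectI conjI allI impI)
  show "borel_prob \<mu>" using \<mu> by (simp add: has_exponent_def)
  fix n :: nat assume n: "n \<ge> 1"
  obtain \<rho> where \<rho>: "has_exponent \<rho> (\<lambda>y. \<Phi> y / of_nat n)" using root[OF n] by blast
  then have \<rho>': "borel_prob \<rho>" by (simp add: has_exponent_def)
  have "exp (\<Phi> y / of_nat n) ^ n = exp (\<Phi> y)" for y
    using n by (simp flip: exp_of_nat_mult)
  then have "conv_pow \<rho> n = \<mu>"
    using conv_pow_charf[OF \<rho>', of n] \<rho> \<mu> by (intro charf_unique) (auto simp: has_exponent_def)
  with \<rho>' show "\<exists>\<rho>. borel_prob \<rho> \<and> conv_pow \<rho> n = \<mu>" by blast
qed

section \<open>Maximal inequalities\<close>

text \<open>Half-open index blocks: adjacent blocks concatenate without overlap, so sums over them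
  involve disjoint families of variables.\<close>

definition psum :: "(nat \<Rightarrow> 'a::comm_monoid_add) \<Rightarrow> nat \<Rightarrow> nat \<Rightarrow> 'a" where
  "psum x i j = sum x {i..<j}"

lemma psum_restrict: "a \<le> i \<Longrightarrow> j \<le> b \<Longrightarrow> psum (restrict x {a..<b}) i j = psum x i j"
  unfolding psum_def by (intro sum.cong) auto

lemma psum_add: "i \<le> j \<Longrightarrow> j \<le> k \<Longrightarrow> psum x i j + psum x j k = psum x i k"
  unfolding psum_def by (rule sum.atLeastLessThan_concat)

lemma psum_measurable [measurable]:
  "(\<lambda>x. psum x i j) \<in> borel_measurable (PiM I (\<lambda>_. borel :: 'a::euclidean_space measure))"
proof -
  have "(\<lambda>x. x l) \<in> borel_measurable (PiM I (\<lambda>_. borel :: 'a measure))" for l :: nat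
  proof (cases "l \<in> I")
    \<comment> \<open>Points of the product are extensional, so a coordinate outside I is constant
      and the sum stays measurable for every I.\<close>
    case False
    then have "x l = undefined" if "x \<in> space (PiM I (\<lambda>_. borel :: 'a measure))" for x :: "nat \<Rightarrow> 'a"
      using that by (auto simp: space_PiM PiE_def extensional_def)
    then have "(\<lambda>x. x l) \<in> borel_measurable (PiM I (\<lambda>_. borel :: 'a measure)) \<longleftrightarrow>
        (\<lambda>_. undefined :: 'a) \<in> borel_measurable (PiM I (\<lambda>_. borel :: 'a measure))"
      by (intro measurable_cong) auto
    then show ?thesis by simp
  qed (rule measurable_component_singleton)
  then show ?thesis unfolding psum_def by (intro borel_measurable_sum)
qed

context prob_space
begin

text \<open>Invariance under \<open>restrict\<close> expresses that P and Q look only at the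
  variables of two adjacent blocks. The events are then preimages under the restricted families,
  which are independent.\<close>

lemma indep_blocks:
  fixes \<xi> :: "nat \<Rightarrow> 'a \<Rightarrow> 'b::euclidean_space"
  assumes ind: "indep_vars (\<lambda>_. borel) \<xi> {..<n}" and b: "b \<le> n"
    and P: "Measurable.pred (PiM {a..<k} (\<lambda>_. borel)) P" "\<And>x. P (restrict x {a..<k}) = P x"
    and Q: "Measurable.pred (PiM {k..<b} (\<lambda>_. borel)) Q" "\<And>x. Q (restrict x {k..<b}) = Q x"
    and k: "k \<le> b"
  shows "prob {\<omega>\<in>space M. P (\<lambda>i. \<xi> i \<omega>) \<and> Q (\<lambda>i. \<xi> i \<omega>)} =
    prob {\<omega>\<in>space M. P (\<lambda>i. \<xi> i \<omega>)} * prob {\<omega>\<in>space M. Q (\<lambda>i. \<xi> i \<omega>)}"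
proof -
  let ?A = "\<lambda>\<omega>. restrict (\<lambda>i. \<xi> i \<omega>) {a..<k}" and ?B = "\<lambda>\<omega>. restrict (\<lambda>i. \<xi> i \<omega>) {k..<b}"
  let ?MA = "PiM {a..<k} (\<lambda>_. borel :: 'b measure)" and ?MB = "PiM {k..<b} (\<lambda>_. borel :: 'b measure)"
  have iv: "indep_var ?MA ?A ?MB ?B"
    using b k by (intro indep_var_restrict[OF ind]) auto
  have sp: "\<omega> \<in> space M \<Longrightarrow> ?A \<omega> \<in> space ?MA \<and> ?B \<omega> \<in> space ?MB" for \<omega>
    by (auto simp: space_PiM)
  have "prob ((\<lambda>x. (?A x, ?B x)) -` ({x\<in>space ?MA. P x} \<times> {x\<in>space ?MB. Q x}) \<inter> space M) =
      prob (?A -` {x\<in>space ?MA. P x} \<inter> space M) * prob (?B -` {x\<in>space ?MB. Q x} \<inter> space M)"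
    using P Q by (intro indep_varD[OF iv]) (auto simp: pred_def)
  also have "(\<lambda>x. (?A x, ?B x)) -` ({x\<in>space ?MA. P x} \<times> {x\<in>space ?MB. Q x}) \<inter> space M =
      {\<omega>\<in>space M. P (\<lambda>i. \<xi> i \<omega>) \<and> Q (\<lambda>i. \<xi> i \<omega>)}"
    using sp P(2) Q(2) by auto
  also have "?A -` {x\<in>space ?MA. P x} \<inter> space M = {\<omega>\<in>space M. P (\<lambda>i. \<xi> i \<omega>)}"
    using sp P(2) by auto
  also have "?B -` {x\<in>space ?MB. Q x} \<inter> space M = {\<omega>\<in>space M. Q (\<lambda>i. \<xi> i \<omega>)}"
    using sp Q(2) by auto
  finally show ?thesis .
qed

lemma psum_rv:
  fixes \<xi> :: "nat \<Rightarrow> 'a \<Rightarrow> 'b::euclidean_space"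
  assumes "\<And>l. \<xi> l \<in> borel_measurable M"
  shows "(\<lambda>\<omega>. psum (\<lambda>i. \<xi> i \<omega>) i j) \<in> borel_measurable M"
  using assms unfolding psum_def by (intro borel_measurable_sum)

text \<open>Decompose by the first index k at which the partial sum exceeds 2e (\<open>P k\<close>).
  Independently of this, the remaining sum from k to b is at most e with probability at least 1/2
  (\<open>Q k\<close>), and then the total sum still exceeds e. Hence half of the probability in
  question is at most p.\<close>

lemma ottaviani:
  fixes \<xi> :: "nat \<Rightarrow> 'a \<Rightarrow> 'b::euclidean_space"
  assumes rv: "\<And>l. \<xi> l \<in> borel_measurable M"
    and ind: "indep_vars (\<lambda>_. borel) \<xi> {..<n}" and b: "a \<le> b" "b \<le> n"
    and p: "\<And>i j. a \<le> i \<Longrightarrow> i \<le> j \<Longrightarrow> j \<le> b \<Longrightarrow> prob {\<omega>\<in>space M. norm (psum (\<lambda>l. \<xi> l \<omega>) i j) > e} \<le> p"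
    and p2: "p \<le> 1/2"
  shows "prob {\<omega>\<in>space M. \<exists>j\<in>{a..b}. norm (psum (\<lambda>l. \<xi> l \<omega>) a j) > 2 * e} \<le> 2 * p"
proof -
  note [measurable] = psum_rv[OF rv]
  define P where "P k x \<longleftrightarrow> norm (psum x a k) > 2 * e \<and> (\<forall>j\<in>{a..<k}. \<not> norm (psum x a j) > 2 * e)"
    for k and x :: "nat \<Rightarrow> 'b"
  define Q where "Q k x \<longleftrightarrow> \<not> norm (psum x k b) > e" for k and x :: "nat \<Rightarrow> 'b"
  let ?E = "\<lambda>P. {\<omega>\<in>space M. P (\<lambda>l. \<xi> l \<omega>)}"
  have PM: "?E (P k) \<in> events" for k unfolding P_def by measurable
  have QM: "?E (Q k) \<in> events" for k unfolding Q_def by measurable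
  have PQ: "prob (?E (\<lambda>x. P k x \<and> Q k x)) = prob (?E (P k)) * prob (?E (Q k))" if k: "k \<in> {a..b}" for k
  proof (rule indep_blocks[OF ind b(2)])
    show "Measurable.pred (PiM {a..<k} (\<lambda>_. borel)) (P k)" unfolding P_def by measurable
    show "Measurable.pred (PiM {k..<b} (\<lambda>_. borel)) (Q k)" unfolding Q_def by measurable
    show "P k (restrict x {a..<k}) = P k x" "Q k (restrict x {k..<b}) = Q k x" for x
      unfolding P_def Q_def by (auto simp: psum_restrict)
  qed (use k in auto)
  have half: "prob (?E (P k)) \<le> 2 * prob (?E (\<lambda>x. P k x \<and> Q k x))" if k: "k \<in> {a..b}" for k
  proof -
    have "?E (Q k) = space M - {\<omega>\<in>space M. norm (psum (\<lambda>l. \<xi> l \<omega>) k b) > e}"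
      by (auto simp: Q_def)
    then have "prob (?E (Q k)) = 1 - prob {\<omega>\<in>space M. norm (psum (\<lambda>l. \<xi> l \<omega>) k b) > e}"
      by (simp add: prob_compl)
    then have "prob (?E (Q k)) \<ge> 1/2" using p[of k b] k p2 by auto
    then have "prob (?E (P k)) * (1/2) \<le> prob (?E (P k)) * prob (?E (Q k))"
      by (intro mult_left_mono) auto
    then show ?thesis using PQ[OF k] by simp
  qed
  have "{\<omega>\<in>space M. \<exists>j\<in>{a..b}. norm (psum (\<lambda>l. \<xi> l \<omega>) a j) > 2 * e} \<subseteq> (\<Union>k\<in>{a..b}. ?E (P k))"
  proof safe
    fix \<omega> j assume \<omega>: "\<omega> \<in> space M" and j: "j \<in> {a..b}" "norm (psum (\<lambda>l. \<xi> l \<omega>) a j) > 2 * e"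
    define k where "k = (LEAST j. a \<le> j \<and> norm (psum (\<lambda>l. \<xi> l \<omega>) a j) > 2 * e)"
    have 1: "a \<le> k \<and> norm (psum (\<lambda>l. \<xi> l \<omega>) a k) > 2 * e"
      unfolding k_def by (rule LeastI[of _ j]) (use j in auto)
    have 2: "k \<le> j" unfolding k_def by (rule Least_le) (use j in auto)
    have 3: "\<not> norm (psum (\<lambda>l. \<xi> l \<omega>) a i) > 2 * e" if "a \<le> i" "i < k" for i
      using not_less_Least[of i "\<lambda>j. a \<le> j \<and> norm (psum (\<lambda>l. \<xi> l \<omega>) a j) > 2 * e"] that by (auto simp: k_def)
    show "\<omega> \<in> (\<Union>k\<in>{a..b}. ?E (P k))"
      using 1 2 3 j \<omega> by (auto simp: P_def intro!: bexI[of _ k])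
  qed
  then have "prob {\<omega>\<in>space M. \<exists>j\<in>{a..b}. norm (psum (\<lambda>l. \<xi> l \<omega>) a j) > 2 * e} \<le> prob (\<Union>k\<in>{a..b}. ?E (P k))"
    using PM by (intro finite_measure_mono) auto
  also have "\<dots> \<le> (\<Sum>k\<in>{a..b}. prob (?E (P k)))"
    using PM by (intro finite_measure_subadditive_finite) auto
  also have "\<dots> \<le> (\<Sum>k\<in>{a..b}. 2 * prob (?E (\<lambda>x. P k x \<and> Q k x)))"
    by (intro sum_mono half)
  also have "\<dots> = 2 * prob (\<Union>k\<in>{a..b}. ?E (\<lambda>x. P k x \<and> Q k x))"
  proof -
    have ev: "?E (\<lambda>x. P k x \<and> Q k x) \<in> events" if "k \<in> {a..b}" for k
    proof -
      have "?E (\<lambda>x. P k x \<and> Q k x) = ?E (P k) \<inter> ?E (Q k)" by auto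
      then show ?thesis using PM[of k] QM[of k] by auto
    qed
    have "disjoint_family_on (\<lambda>k. ?E (\<lambda>x. P k x \<and> Q k x)) {a..b}"
      unfolding disjoint_family_on_def P_def
      by safe (metis atLeastAtMost_iff atLeastLessThan_iff linorder_neqE_nat)
    then show ?thesis using ev
      by (subst finite_measure_finite_Union) (auto simp: sum_distrib_left)
  qed
  also have "\<dots> \<le> 2 * prob {\<omega>\<in>space M. norm (psum (\<lambda>l. \<xi> l \<omega>) a b) > e}"
  proof (intro mult_left_mono finite_measure_mono)
    show "{\<omega>\<in>space M. norm (psum (\<lambda>l. \<xi> l \<omega>) a b) > e} \<in> events"
      by measurable
    show "(\<Union>k\<in>{a..b}. ?E (\<lambda>x. P k x \<and> Q k x)) \<subseteq> {\<omega>\<in>space M. norm (psum (\<lambda>l. \<xi> l \<omega>) a b) > e}"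
    proof safe
      fix \<omega> k assume \<omega>: "\<omega> \<in> space M" and k: "k \<in> {a..b}" and "P k (\<lambda>l. \<xi> l \<omega>)" "Q k (\<lambda>l. \<xi> l \<omega>)"
      then have "norm (psum (\<lambda>l. \<xi> l \<omega>) a k) > 2 * e" "norm (psum (\<lambda>l. \<xi> l \<omega>) k b) \<le> e"
        by (auto simp: P_def Q_def)
      moreover have "psum (\<lambda>l. \<xi> l \<omega>) a b = psum (\<lambda>l. \<xi> l \<omega>) a k + psum (\<lambda>l. \<xi> l \<omega>) k b"
        using k by (simp add: psum_add)
      ultimately show "norm (psum (\<lambda>l. \<xi> l \<omega>) a b) > e"
        using norm_diff_ineq[of "psum (\<lambda>l. \<xi> l \<omega>) a k" "psum (\<lambda>l. \<xi> l \<omega>) k b"] by simp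
    qed
  qed simp
  also have "\<dots> \<le> 2 * p" using p[of a b] b by simp
  finally show ?thesis .
qed

text \<open>Let k be the first index at which an oscillation larger than 4e is completed
  (\<open>C k\<close>). A second one forces a deviation larger than 2e from position k afterwards
  (\<open>D k\<close>), which is independent of \<open>C k\<close> and has probability at most 2p by
  Ottaviani. The events \<open>C k\<close> are disjoint with total probability again at most 2p,
  which produces the square.\<close>

lemma double_oscillation:
  fixes \<xi> :: "nat \<Rightarrow> 'a \<Rightarrow> 'b::euclidean_space"
  assumes rv: "\<And>l. \<xi> l \<in> borel_measurable M"
    and ind: "indep_vars (\<lambda>_. borel) \<xi> {..<n}" and b: "a \<le> b" "b \<le> n"
    and p: "\<And>i j. a \<le> i \<Longrightarrow> i \<le> j \<Longrightarrow> j \<le> b \<Longrightarrow> prob {\<omega>\<in>space M. norm (psum (\<lambda>l. \<xi> l \<omega>) i j) > e} \<le> p"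
    and p2: "p \<le> 1/2"
  shows "prob {\<omega>\<in>space M. \<exists>s\<in>{a..b}. \<exists>t\<in>{s..b}. \<exists>u\<in>{t..b}.
      norm (psum (\<lambda>l. \<xi> l \<omega>) s t) > 4 * e \<and> norm (psum (\<lambda>l. \<xi> l \<omega>) t u) > 4 * e} \<le> 4 * p\<^sup>2"
proof -
  define Osc where "Osc k x \<longleftrightarrow> (\<exists>s\<in>{a..k}. norm (psum x s k) > 4 * e)" for k and x :: "nat \<Rightarrow> 'b"
  define C where "C k x \<longleftrightarrow> Osc k x \<and> (\<forall>j\<in>{a..<k}. \<not> Osc j x)" for k and x :: "nat \<Rightarrow> 'b"
  define D where "D k x \<longleftrightarrow> (\<exists>u\<in>{k..b}. norm (psum x k u) > 2 * e)" for k and x :: "nat \<Rightarrow> 'b"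
  let ?E = "\<lambda>P. {\<omega>\<in>space M. P (\<lambda>l. \<xi> l \<omega>)}"
  have p0: "0 \<le> p" using order_trans[OF measure_nonneg p[of a a]] b by simp
  note [measurable] = psum_rv[OF rv]
  have CM: "?E (C k) \<in> events" for k unfolding C_def Osc_def by measurable
  have DM: "?E (D k) \<in> events" for k unfolding D_def by measurable
  have CD: "prob (?E (\<lambda>x. C k x \<and> D k x)) = prob (?E (C k)) * prob (?E (D k))" if k: "k \<in> {a..b}" for k
  proof (rule indep_blocks[OF ind b(2)])
    show "Measurable.pred (PiM {a..<k} (\<lambda>_. borel)) (C k)" unfolding C_def Osc_def by measurable
    show "Measurable.pred (PiM {k..<b} (\<lambda>_. borel)) (D k)" unfolding D_def by measurable
    show "C k (restrict x {a..<k}) = C k x" "D k (restrict x {k..<b}) = D k x" for x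
      unfolding C_def Osc_def D_def by (auto simp: psum_restrict)
  qed (use k in auto)
  have Dp: "prob (?E (D k)) \<le> 2 * p" if "k \<in> {a..b}" for k
    unfolding D_def using that b by (intro ottaviani[OF rv ind _ _ _ p2] p) auto
  have "?E (\<lambda>x. \<exists>s\<in>{a..b}. \<exists>t\<in>{s..b}. \<exists>u\<in>{t..b}. norm (psum x s t) > 4 * e \<and> norm (psum x t u) > 4 * e)
      \<subseteq> (\<Union>k\<in>{a..b}. ?E (\<lambda>x. C k x \<and> D k x))"
  proof safe
    fix \<omega> s t u assume \<omega>: "\<omega> \<in> space M" and stu: "s \<in> {a..b}" "t \<in> {s..b}" "u \<in> {t..b}"
    let ?x = "\<lambda>l. \<xi> l \<omega>"
    assume g: "norm (psum ?x s t) > 4 * e" "norm (psum ?x t u) > 4 * e"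
    define k where "k = (LEAST j. a \<le> j \<and> Osc j ?x)"
    have Ot: "a \<le> t \<and> Osc t ?x" using stu g by (auto simp: Osc_def)
    have 1: "a \<le> k \<and> Osc k ?x" unfolding k_def by (rule LeastI[of _ t]) (rule Ot)
    have 2: "k \<le> t" unfolding k_def by (rule Least_le) (rule Ot)
    have 3: "\<not> Osc i ?x" if "a \<le> i" "i < k" for i
      using not_less_Least[of i "\<lambda>j. a \<le> j \<and> Osc j ?x"] that by (auto simp: k_def)
    \<comment> \<open>The first oscillation ends at some k \<le> t. Since positions t and u differ
      by more than 4e, one of them is farther than 2e from position k.\<close>
    have "psum ?x k t + psum ?x t u = psum ?x k u" using 2 stu by (simp add: psum_add)
    then have "4 * e < norm (psum ?x k u - psum ?x k t)" using g by (metis add_diff_cancel_left')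
    also have "\<dots> \<le> norm (psum ?x k u) + norm (psum ?x k t)" by (rule norm_triangle_ineq4)
    finally have "norm (psum ?x k u) > 2 * e \<or> norm (psum ?x k t) > 2 * e" by linarith
    then have "D k ?x" unfolding D_def using 2 stu by (elim disjE) (auto intro: bexI[of _ u] bexI[of _ t])
    then show "\<omega> \<in> (\<Union>k\<in>{a..b}. ?E (\<lambda>x. C k x \<and> D k x))"
      using 1 2 3 stu \<omega> by (auto simp: C_def intro!: bexI[of _ k])
  qed
  then have "prob (?E (\<lambda>x. \<exists>s\<in>{a..b}. \<exists>t\<in>{s..b}. \<exists>u\<in>{t..b}. norm (psum x s t) > 4 * e \<and> norm (psum x t u) > 4 * e))
      \<le> prob (\<Union>k\<in>{a..b}. ?E (\<lambda>x. C k x \<and> D k x))"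
  proof (rule finite_measure_mono)
    have "?E (\<lambda>x. C k x \<and> D k x) = ?E (C k) \<inter> ?E (D k)" for k by auto
    then show "(\<Union>k\<in>{a..b}. ?E (\<lambda>x. C k x \<and> D k x)) \<in> events" using CM DM by auto
  qed
  also have "\<dots> \<le> (\<Sum>k\<in>{a..b}. prob (?E (\<lambda>x. C k x \<and> D k x)))"
  proof (intro finite_measure_subadditive_finite)
    have "?E (\<lambda>x. C k x \<and> D k x) = ?E (C k) \<inter> ?E (D k)" for k by auto
    then show "(\<lambda>k. ?E (\<lambda>x. C k x \<and> D k x)) ` {a..b} \<subseteq> events" using CM DM by auto
  qed auto
  also have "\<dots> \<le> (\<Sum>k\<in>{a..b}. prob (?E (C k)) * (2 * p))"
    using CD Dp by (intro sum_mono) (auto intro!: mult_left_mono)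
  also have "\<dots> = 2 * p * (\<Sum>k\<in>{a..b}. prob (?E (C k)))"
    by (simp add: sum_distrib_left mult.commute)
  also have "(\<Sum>k\<in>{a..b}. prob (?E (C k))) = prob (\<Union>k\<in>{a..b}. ?E (C k))"
  proof -
    have "disjoint_family_on (\<lambda>k. ?E (C k)) {a..b}"
      unfolding disjoint_family_on_def C_def
      by safe (metis atLeastAtMost_iff atLeastLessThan_iff linorder_neqE_nat)
    then show ?thesis using CM
      by (subst finite_measure_finite_Union) auto
  qed
  also have "2 * p * prob (\<Union>k\<in>{a..b}. ?E (C k)) \<le> 2 * p * (2 * p)"
  proof (rule mult_left_mono)
    \<comment> \<open>The same halving, seen from the starting point a: one of the two ends of an
      oscillation larger than 4e is farther than 2e from position a.\<close>
    have "prob (\<Union>k\<in>{a..b}. ?E (C k)) \<le> prob (?E (D a))"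
    proof (rule finite_measure_mono)
      show "?E (D a) \<in> events" using DM b by auto
      show "(\<Union>k\<in>{a..b}. ?E (C k)) \<subseteq> ?E (D a)"
      proof safe
        fix \<omega> k assume k: "k \<in> {a..b}" and "C k (\<lambda>l. \<xi> l \<omega>)"
        let ?x = "\<lambda>l. \<xi> l \<omega>"
        obtain s where s: "s \<in> {a..k}" "norm (psum ?x s k) > 4 * e"
          using \<open>C k ?x\<close> by (auto simp: C_def Osc_def)
        have "psum ?x a s + psum ?x s k = psum ?x a k" using s by (simp add: psum_add)
        then have "4 * e < norm (psum ?x a k - psum ?x a s)" using s by (metis add_diff_cancel_left')
        also have "\<dots> \<le> norm (psum ?x a k) + norm (psum ?x a s)" by (rule norm_triangle_ineq4)
        finally have "norm (psum ?x a k) > 2 * e \<or> norm (psum ?x a s) > 2 * e" by linarith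
        then show "D a ?x" unfolding D_def using k s by (elim disjE) (auto intro: bexI[of _ k] bexI[of _ s])
      qed
    qed
    also have "\<dots> \<le> 2 * p" using b by (intro Dp) auto
    finally show "prob (\<Union>k\<in>{a..b}. ?E (C k)) \<le> 2 * p" .
  qed (use p0 in simp)
  finally show ?thesis by (simp add: power2_eq_square)
qed

end

section \<open>Dyadic times\<close>

definition dyadic :: "nat \<Rightarrow> real set" where
  "dyadic n = range (\<lambda>k::nat. real k / 2 ^ n)"

definition dyadics :: "real set" where
  "dyadics = (\<Union>n. dyadic n)"

lemma dyadicI: "real k / 2 ^ n \<in> dyadic n" by (simp add: dyadic_def)

lemma dyadicsI: "real k / 2 ^ n \<in> dyadics" by (auto simp: dyadics_def intro: dyadicI)

lemma dyadic_Suc: "dyadic n \<subseteq> dyadic (Suc n)"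
proof
  fix t assume "t \<in> dyadic n"
  then obtain k where "t = real k / 2 ^ n" by (auto simp: dyadic_def)
  then have "t = real (2 * k) / 2 ^ Suc n" by simp
  then show "t \<in> dyadic (Suc n)" by (simp only: dyadicI)
qed

lemma dyadic_mono: "n \<le> m \<Longrightarrow> dyadic n \<subseteq> dyadic m"
  by (rule lift_Suc_mono_le[of dyadic]) (rule dyadic_Suc)

text \<open>The successor makes the approximation strictly larger than t even when t is itself
  dyadic, so that it converges to t along the right-hand filter that excludes t.\<close>

definition next_dyadic :: "nat \<Rightarrow> real \<Rightarrow> nat" where
  "next_dyadic n t = Suc (nat \<lfloor>t * 2 ^ n\<rfloor>)"

lemma next_dyadic_bounds:
  assumes "0 \<le> t"
  shows "t < real (next_dyadic n t) / 2 ^ n" "real (next_dyadic n t) / 2 ^ n \<le> t + 1 / 2 ^ n"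
proof -
  have "real (next_dyadic n t) = of_int \<lfloor>t * 2 ^ n\<rfloor> + 1"
    using assms by (simp add: next_dyadic_def)
  moreover have "of_int \<lfloor>t * 2 ^ n\<rfloor> \<le> t * 2 ^ n" "t * 2 ^ n < of_int \<lfloor>t * 2 ^ n\<rfloor> + 1" by linarith+
  ultimately show "t < real (next_dyadic n t) / 2 ^ n" "real (next_dyadic n t) / 2 ^ n \<le> t + 1 / 2 ^ n"
    by (auto simp: field_simps)
qed

lemma next_dyadic_mono: "0 \<le> s \<Longrightarrow> s \<le> t \<Longrightarrow> next_dyadic n s \<le> next_dyadic n t"
  unfolding next_dyadic_def by (intro Suc_mono nat_mono floor_mono mult_right_mono Suc_le_mono[THEN iffD2]) auto

lemma next_dyadic_tendsto:
  assumes "0 \<le> t"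
  shows "(\<lambda>n. real (next_dyadic n t) / 2 ^ n) \<longlonglongrightarrow> t"
proof (rule tendsto_sandwich)
  show "(\<lambda>n. t) \<longlonglongrightarrow> t" by simp
  have "(\<lambda>n. t + 1 / 2 ^ n :: real) \<longlonglongrightarrow> t + 0"
    by (intro tendsto_intros) real_asymp
  then show "(\<lambda>n. t + 1 / 2 ^ n :: real) \<longlonglongrightarrow> t" by simp
qed (use next_dyadic_bounds[OF assms] in \<open>auto intro!: always_eventually less_imp_le\<close>)

lemma dyadics_dense:
  assumes "0 \<le> t" "0 < d"
  shows "\<exists>q\<in>dyadics. t < q \<and> q < t + d"
proof -
  have "eventually (\<lambda>n. real (next_dyadic n t) / 2 ^ n < t + d) sequentially"
    using next_dyadic_tendsto[OF assms(1)] assms(2) by (intro order_tendstoD) auto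
  then obtain n where "real (next_dyadic n t) / 2 ^ n < t + d"
    by (auto simp: eventually_sequentially)
  then show ?thesis using next_dyadic_bounds[OF assms(1), of n] dyadicsI by blast
qed

section \<open>Kolmogorov extension on the dyadic times\<close>

lemma (in product_prob_space) indep_vars_coordinates:
  assumes "I \<noteq> {}"
  shows "indep_vars M (\<lambda>i \<omega>. \<omega> i) I"
proof -
  have "distr (PiM I M) (PiM I M) (\<lambda>x. \<lambda>i\<in>I. x i) = PiM I M"
    by (subst distr_cong[OF refl refl, of _ _ "\<lambda>x. x"]) (auto simp: space_PiM distr_id)
  moreover have "(\<Pi>\<^sub>M i\<in>I. distr (PiM I M) (M i) (\<lambda>\<omega>. \<omega> i)) = PiM I M"
    by (intro PiM_cong refl PiM_component)
  ultimately show ?thesis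
    by (subst indep_vars_iff_distr_eq_PiM'[OF assms]) auto
qed

lemma distr_PiM_component_const:
  assumes "prob_space N" and i: "i \<in> I"
  shows "distr (PiM I (\<lambda>_. N)) N (\<lambda>x. x i) = N"
proof -
  interpret N: prob_space N by fact
  interpret product_prob_space "\<lambda>_. N" I ..
  show ?thesis using i by (rule PiM_component)
qed

text \<open>The halving relation says that two independent steps of level n + 1 add up to one step
  of level n. This is the consistency of the random walks on successive dyadic grids.\<close>

locale dyadic_roots =
  fixes \<rho> :: "nat \<Rightarrow> 'a::euclidean_space measure"
  assumes borel_prob: "borel_prob (\<rho> n)"
    and half: "charf (\<rho> (Suc n)) y ^ 2 = charf (\<rho> n) y"
begin

definition W :: "nat \<Rightarrow> (nat \<Rightarrow> 'a) measure" where
  "W n = PiM UNIV (\<lambda>_. \<rho> n)"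

lemma sets_W [measurable_cong]: "sets (W n) = sets (PiM UNIV (\<lambda>_. borel))"
  unfolding W_def by (intro sets_PiM_cong refl borel_probD borel_prob)

lemma prob_space_W: "prob_space (W n)"
  unfolding W_def using borel_probD(1)[OF borel_prob] by (intro prob_space_PiM) auto

lemma W_coordinates:
  shows "prob_space.indep_vars (W n) (\<lambda>_. borel) (\<lambda>i \<omega>. \<omega> i) UNIV"
    and "distr (W n) borel (\<lambda>\<omega>. \<omega> i) = \<rho> n"
proof -
  interpret \<rho>: prob_space "\<rho> n" using borel_prob by (rule borel_probD)
  interpret product_prob_space "\<lambda>_. \<rho> n" UNIV ..
  have "prob_space.indep_vars (W n) (\<lambda>_. \<rho> n) (\<lambda>i \<omega>. \<omega> i) UNIV"
    unfolding W_def by (rule indep_vars_coordinates) simp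
  then have "prob_space.indep_vars (W n) (\<lambda>_. borel) (\<lambda>i x. (\<lambda>z. z) (x i)) UNIV"
    by (rule prob_space.indep_vars_compose2[OF prob_space_W]) (auto intro: borel_prob_measurable[OF borel_prob])
  then show "prob_space.indep_vars (W n) (\<lambda>_. borel) (\<lambda>i \<omega>. \<omega> i) UNIV" by simp
  have "distr (W n) borel (\<lambda>\<omega>. \<omega> i) = distr (W n) (\<rho> n) (\<lambda>\<omega>. \<omega> i)"
    by (intro distr_cong refl) (simp add: borel_probD(2)[OF borel_prob])
  also have "\<dots> = \<rho> n" unfolding W_def by (rule PiM_component) simp
  finally show "distr (W n) borel (\<lambda>\<omega>. \<omega> i) = \<rho> n" .
qed

definition pair_sum :: "(nat \<Rightarrow> 'a) \<Rightarrow> nat \<Rightarrow> 'a" where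
  "pair_sum \<omega> i = \<omega> (2 * i) + \<omega> (2 * i + 1)"

lemma psum_pair_sum: "psum (pair_sum \<omega>) 0 k = psum \<omega> 0 (2 * k)"
  unfolding psum_def by (induction k) (auto simp: pair_sum_def add.assoc)

lemma pair_sum_measurable [measurable]:
  "pair_sum \<in> measurable (PiM UNIV (\<lambda>_. borel)) (PiM UNIV (\<lambda>_. borel))"
  by (rule measurable_PiM_single') (auto simp: pair_sum_def space_PiM intro!: borel_measurable_add measurable_component_singleton)

text \<open>The blocks {2j, 2j+1} are disjoint, so the pair sums are independent; each has law
  \<open>\<rho> n\<close> by the halving relation and uniqueness of characteristic
  functions.\<close>

lemma W_pair_sum: "distr (W (Suc n)) (PiM UNIV (\<lambda>_. borel)) pair_sum = W n"
proof -
  interpret prob_space "W (Suc n)" by (rule prob_space_W)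
  note ind = W_coordinates(1)[of "Suc n"]
  have "disjoint_family (\<lambda>j::nat. {2*j, 2*j+1})"
    unfolding disjoint_family_on_def by (auto; presburger)
  then have "indep_vars (\<lambda>j. PiM {2*j, 2*j+1} (\<lambda>_. borel)) (\<lambda>j \<omega>. restrict (\<lambda>i. \<omega> i) {2*j, 2*j+1}) UNIV"
    by (intro indep_vars_restrict[OF ind]) auto
  then have "indep_vars (\<lambda>_. borel) (\<lambda>j \<omega>. (\<lambda>x. x (2*j) + x (2*j+1)) (restrict (\<lambda>i. \<omega> i) {2*j, 2*j+1})) UNIV"
    by (rule indep_vars_compose2) measurable
  then have ind2: "indep_vars (\<lambda>_. borel) (\<lambda>j \<omega>. pair_sum \<omega> j) UNIV"
    by (simp add: pair_sum_def)
  have rv: "(\<lambda>\<omega>. pair_sum \<omega> j) \<in> borel_measurable (W (Suc n))" for j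
    using ind2 by (auto simp: indep_vars_def)
  have law: "distr (W (Suc n)) borel (\<lambda>\<omega>. pair_sum \<omega> j) = \<rho> n" for j
  proof (rule charf_unique[OF borel_prob_distr[OF prob_space_W rv] borel_prob])
    fix y
    have "charf (distr (W (Suc n)) borel (\<lambda>\<omega>. \<Sum>i\<in>{2*j, 2*j+1}. \<omega> i)) y =
        (\<Prod>i\<in>{2*j, 2*j+1}. charf (distr (W (Suc n)) borel (\<lambda>\<omega>. \<omega> i)) y)"
      using indep_vars_subset[OF ind, of "{2*j, 2*j+1}"] by (intro charf_sum_indep prob_space_W) auto
    then show "charf (distr (W (Suc n)) borel (\<lambda>\<omega>. pair_sum \<omega> j)) y = charf (\<rho> n) y"
      using half[of n y] by (simp add: pair_sum_def W_coordinates(2) power2_eq_square)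
  qed
  have "distr (W (Suc n)) (PiM UNIV (\<lambda>_. borel)) (\<lambda>\<omega>. \<lambda>j\<in>UNIV. pair_sum \<omega> j) =
      PiM UNIV (\<lambda>j. distr (W (Suc n)) borel (\<lambda>\<omega>. pair_sum \<omega> j))"
    using indep_vars_iff_distr_eq_PiM'[of UNIV "\<lambda>j \<omega>. pair_sum \<omega> j" "\<lambda>_. borel"] ind2 rv by blast
  then show ?thesis by (simp add: law restrict_def) (simp add: W_def)
qed

definition idx :: "nat \<Rightarrow> real \<Rightarrow> nat" where "idx n t = nat \<lfloor>t * 2 ^ n\<rfloor>"

lemma idx_dyadic [simp]: "idx n (real k / 2 ^ n) = k" by (simp add: idx_def)

lemma idx_Suc: "t \<in> dyadic n \<Longrightarrow> idx (Suc n) t = 2 * idx n t"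
proof -
  assume "t \<in> dyadic n"
  then obtain k where k: "t = real k / 2 ^ n" by (auto simp: dyadic_def)
  then have k': "t = real (2 * k) / 2 ^ Suc n" by simp
  have "idx (Suc n) t = 2 * k" unfolding k' by (rule idx_dyadic)
  then show ?thesis using k by simp
qed

definition walk :: "nat \<Rightarrow> real set \<Rightarrow> (nat \<Rightarrow> 'a) \<Rightarrow> real \<Rightarrow> 'a" where
  "walk n J \<omega> = (\<lambda>t\<in>J. psum \<omega> 0 (idx n t))"

lemma walk_measurable [measurable]:
  "walk n J \<in> measurable (PiM UNIV (\<lambda>_. borel)) (PiM J (\<lambda>_. borel))"
  unfolding walk_def by (intro measurable_restrict psum_measurable)

definition walk_law :: "nat \<Rightarrow> real set \<Rightarrow> (real \<Rightarrow> 'a) measure" where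
  "walk_law n J = distr (W n) (PiM J (\<lambda>_. borel)) (walk n J)"

lemma walk_law_Suc:
  assumes "J \<subseteq> dyadic n" shows "walk_law (Suc n) J = walk_law n J"
proof -
  have "walk (Suc n) J = walk n J \<circ> pair_sum"
    using assms idx_Suc by (auto simp: walk_def psum_pair_sum fun_eq_iff restrict_def)
  then show ?thesis
    unfolding walk_law_def W_pair_sum[symmetric, of n]
    by (subst distr_distr) auto
qed

lemma walk_law_mono:
  assumes "J \<subseteq> dyadic n" "n \<le> m" shows "walk_law m J = walk_law n J"
  using assms(2)
proof (induction m rule: dec_induct)
  case (step m)
  then show ?case using walk_law_Suc[of J m] dyadic_mono[of n m] assms(1) by auto
qed simp

lemma walk_law_restrict:
  assumes "J \<subseteq> H" shows "walk_law n J = distr (walk_law n H) (PiM J (\<lambda>_. borel)) (\<lambda>f. restrict f J)"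
proof -
  have "walk n J = (\<lambda>f. restrict f J) \<circ> walk n H"
    using assms by (auto simp: walk_def fun_eq_iff restrict_def)
  then show ?thesis
    unfolding walk_law_def using assms by (subst distr_distr) (auto intro: measurable_restrict_subset)
qed

lemma finite_dyadic_level:
  assumes "finite J" "J \<subseteq> dyadics" shows "\<exists>n. J \<subseteq> dyadic n"
  using assms
proof (induction rule: finite_induct)
  case (insert t J)
  then obtain n m where "J \<subseteq> dyadic n" "t \<in> dyadic m" by (auto simp: dyadics_def)
  then have "insert t J \<subseteq> dyadic (max n m)"
    using dyadic_mono[of n "max n m"] dyadic_mono[of m "max n m"] by auto
  then show ?case ..
qed simp

text \<open>The least level is only a canonical choice: by \<open>walk_law_mono\<close> every level
  containing J gives the same law. Finite sets of dyadic times always lie in some level.\<close>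

definition fdd :: "real set \<Rightarrow> (real \<Rightarrow> 'a) measure" where
  "fdd J = walk_law (LEAST n. J \<subseteq> dyadic n) J"

lemma fdd_eq: "J \<subseteq> dyadic n \<Longrightarrow> fdd J = walk_law n J"
  unfolding fdd_def
  by (rule walk_law_mono[symmetric, OF LeastI[of "\<lambda>n. J \<subseteq> dyadic n"] Least_le])

lemma prob_space_walk_law: "prob_space (walk_law n J)"
  unfolding walk_law_def by (intro prob_space.prob_space_distr prob_space_W) measurable

sublocale polish_projective dyadics fdd
  unfolding polish_projective_def
proof (rule projective_family.intro)
  fix J H assume JH: "J \<subseteq> H" "finite H" "H \<subseteq> dyadics"
  then obtain n where n: "H \<subseteq> dyadic n" using finite_dyadic_level by blast
  show "fdd J = distr (fdd H) (PiM J (\<lambda>_. borel)) (\<lambda>f. restrict f J)"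
    using n JH fdd_eq[of J n] fdd_eq[of H n] walk_law_restrict[OF JH(1), of n] by auto
next
  fix J :: "real set" assume "finite J" "J \<subseteq> dyadics"
  then obtain n where "J \<subseteq> dyadic n" using finite_dyadic_level by blast
  then show "prob_space (fdd J)" using fdd_eq prob_space_walk_law by simp
qed

lemma distr_lim_restrict:
  assumes "finite J" "J \<subseteq> dyadics"
  shows "distr lim (PiM J (\<lambda>_. borel)) (\<lambda>f. restrict f J) = fdd J"
proof (rule measure_eqI)
  show "sets (distr lim (PiM J (\<lambda>_. borel)) (\<lambda>f. restrict f J)) = sets (fdd J)"
    using assms by (simp add: sets_P)
  fix A assume A: "A \<in> sets (distr lim (PiM J (\<lambda>_. borel)) (\<lambda>f. restrict f J))"
  have m: "(\<lambda>f. restrict f J) \<in> measurable lim (PiM J (\<lambda>_. borel))"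
    using assms measurable_restrict_subset[of J dyadics] by (simp add: measurable_cong_sets[OF sets_lim refl])
  have "emeasure lim (emb dyadics J A) = fdd J A"
    using A assms by (intro emeasure_lim_emb) auto
  then show "emeasure (distr lim (PiM J (\<lambda>_. borel)) (\<lambda>f. restrict f J)) A = emeasure (fdd J) A"
    using A m by (subst emeasure_distr) (auto simp: prod_emb_def space_PiM)
qed

text \<open>Subtracting the value at 0 makes every path start at 0, not only almost every one. The
  value 0 off the dyadics makes \<open>X t\<close> measurable for all real t.\<close>

definition X :: "real \<Rightarrow> (real \<Rightarrow> 'a) \<Rightarrow> 'a" where
  "X t \<omega> = (if t \<in> dyadics then \<omega> t - \<omega> 0 else 0)"

lemma X_measurable: "X t \<in> borel_measurable lim"
proof -
  have "0 \<in> dyadics" using dyadicsI[of 0 0] by simp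
  then show ?thesis unfolding X_def measurable_cong_sets[OF sets_lim refl]
    by (cases "t \<in> dyadics") (auto intro!: borel_measurable_diff measurable_component_singleton)
qed

text \<open>On the finite grid of multiples of 2^-n the projective limit has the law of a walk, and
  the differences of a walk are the coordinates of \<open>W n\<close>. So the increments are jointly
  distributed as a product of copies of \<open>\<rho> n\<close>, which contains both claims.\<close>

lemma X_increments:
  shows "P.indep_vars (\<lambda>_. borel) (\<lambda>i \<omega>. X (real (Suc i) / 2 ^ n) \<omega> - X (real i / 2 ^ n) \<omega>) {..<K}"
    and "distr lim borel (\<lambda>\<omega>. X (real (Suc i) / 2 ^ n) \<omega> - X (real i / 2 ^ n) \<omega>) = \<rho> n"
proof -
  let ?Z = "\<lambda>i \<omega>. X (real (Suc i) / 2 ^ n) \<omega> - X (real i / 2 ^ n) \<omega>"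
  have Zm: "?Z i \<in> borel_measurable lim" for i by (intro borel_measurable_diff X_measurable)
  have joint: "distr lim (PiM {..<L} (\<lambda>_. borel)) (\<lambda>\<omega>. \<lambda>i\<in>{..<L}. ?Z i \<omega>) = PiM {..<L} (\<lambda>_. \<rho> n)"
    if L: "L > 0" for L
  proof -
    define J where "J = (\<lambda>i. real i / 2 ^ n) ` {..L}"
    have J: "finite J" "J \<subseteq> dyadic n" "J \<subseteq> dyadics" by (auto simp: J_def intro: dyadicI dyadicsI)
    define G :: "(real \<Rightarrow> 'a) \<Rightarrow> nat \<Rightarrow> 'a" where
      "G x = (\<lambda>i\<in>{..<L}. x (real (Suc i) / 2 ^ n) - x (real i / 2 ^ n))" for x
    have mem: "i \<le> L \<Longrightarrow> real i / 2 ^ n \<in> J" for i by (auto simp: J_def)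
    have Gm: "G \<in> measurable (PiM J (\<lambda>_. borel)) (PiM {..<L} (\<lambda>_. borel))"
      unfolding G_def by (intro measurable_restrict borel_measurable_diff measurable_component_singleton mem) auto
    have rm: "(\<lambda>f. restrict f J) \<in> measurable lim (PiM J (\<lambda>_. borel))"
      using J measurable_restrict_subset[of J dyadics] by (simp add: measurable_cong_sets[OF sets_lim refl])
    have "(\<lambda>\<omega>. \<lambda>i\<in>{..<L}. ?Z i \<omega>) = G \<circ> (\<lambda>f. restrict f J)"
      using mem[of "Suc i" for i] mem[of i for i] dyadicsI[of "Suc i" n for i] dyadicsI[of i n for i]
      by (auto simp: fun_eq_iff G_def X_def restrict_def simp del: of_nat_Suc)
    then have "distr lim (PiM {..<L} (\<lambda>_. borel)) (\<lambda>\<omega>. \<lambda>i\<in>{..<L}. ?Z i \<omega>) = distr (fdd J) (PiM {..<L} (\<lambda>_. borel)) G"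
      using distr_distr[OF Gm rm] distr_lim_restrict[OF J(1,3)] by simp
    also have "\<dots> = distr (W n) (PiM {..<L} (\<lambda>_. borel)) (G \<circ> walk n J)"
      unfolding fdd_eq[OF J(2)] walk_law_def by (rule distr_distr[OF Gm]) measurable
    also have "G \<circ> walk n J = (\<lambda>\<omega>. \<lambda>i\<in>{..<L}. \<omega> i)"
    proof (intro ext)
      fix \<omega> i
      have "walk n J \<omega> (real i / 2 ^ n) = psum \<omega> 0 i" if "i \<le> L" for i
        using mem[OF that] by (simp add: walk_def)
      from this[of i] this[of "Suc i"]
      show "(G \<circ> walk n J) \<omega> i = (\<lambda>i\<in>{..<L}. \<omega> i) i"
        by (simp add: G_def psum_def)
    qed
    also have "distr (W n) (PiM {..<L} (\<lambda>_. borel)) (\<lambda>\<omega>. \<lambda>i\<in>{..<L}. \<omega> i) = PiM {..<L} (\<lambda>i. distr (W n) borel (\<lambda>\<omega>. \<omega> i))"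
    proof -
      interpret W: prob_space "W n" by (rule prob_space_W)
      have "W.indep_vars (\<lambda>_. borel) (\<lambda>i \<omega>. \<omega> i) {..<L}"
        using W.indep_vars_subset[OF W_coordinates(1)] by simp
      then show ?thesis
        using L W.indep_vars_iff_distr_eq_PiM'[of "{..<L}" "\<lambda>i \<omega>. \<omega> i" "\<lambda>_. borel"]
        by (auto simp: W.indep_vars_def)
    qed
    finally show ?thesis unfolding W_coordinates(2) .
  qed
  have law: "distr lim borel (?Z i) = \<rho> n" for i
  proof -
    have "distr lim borel (?Z i) = distr lim borel ((\<lambda>x. x i) \<circ> (\<lambda>\<omega>. \<lambda>i\<in>{..<Suc i}. ?Z i \<omega>))"
      by (simp add: comp_def)
    also have "\<dots> = distr (distr lim (PiM {..<Suc i} (\<lambda>_. borel)) (\<lambda>\<omega>. \<lambda>i\<in>{..<Suc i}. ?Z i \<omega>)) borel (\<lambda>x. x i)"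
      using Zm by (intro distr_distr[symmetric] measurable_restrict measurable_component_singleton) auto
    also have "\<dots> = distr (PiM {..<Suc i} (\<lambda>_. \<rho> n)) (\<rho> n) (\<lambda>x. x i)"
      unfolding joint[OF zero_less_Suc] by (intro distr_cong refl) (simp add: borel_probD(2)[OF borel_prob])
    also have "\<dots> = \<rho> n"
      by (rule distr_PiM_component_const[OF borel_probD(1)[OF borel_prob]]) simp
    finally show ?thesis .
  qed
  show "distr lim borel (?Z i) = \<rho> n" by (rule law)
  \<comment> \<open>One index more than required, because the characterisation of independence by
    the product law is for nonempty index sets.\<close>
  have "P.indep_vars (\<lambda>_. borel) ?Z {..<Suc K}"
    using joint[of "Suc K"] Zm law
    by (subst P.indep_vars_iff_distr_eq_PiM') auto
  then show "P.indep_vars (\<lambda>_. borel) ?Z {..<K}"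
    by (rule P.indep_vars_subset) auto
qed

end

section \<open>Right-continuous extension of paths\<close>

text \<open>At every level \<open>e\<close>, some dyadic mesh separates the oscillations larger than \<open>e\<close>.\<close>

definition regular_path :: "(real \<Rightarrow> 'a::metric_space) \<Rightarrow> bool" where
  "regular_path x \<longleftrightarrow> (\<forall>e>0. \<forall>T::nat. \<exists>m. \<forall>i<T * 2 ^ m.
     \<forall>s\<in>dyadics. \<forall>t\<in>dyadics. \<forall>u\<in>dyadics. real i / 2 ^ m \<le> s \<longrightarrow> s \<le> t \<longrightarrow> t \<le> u \<longrightarrow>
        u \<le> (real i + 1) / 2 ^ m \<longrightarrow> \<not> (dist (x s) (x t) > e \<and> dist (x t) (x u) > e))"

text \<open>The value at t itself is left out of the limit, so at a dyadic t the extension may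
  differ from \<open>x t\<close>. That it does not matter is a statement about laws, settled in the
  construction of the process.\<close>

definition right_ext :: "(real \<Rightarrow> 'a::metric_space) \<Rightarrow> real \<Rightarrow> 'a" where
  "right_ext x t = Lim (at t within (dyadics \<inter> {t<..})) x"

lemma Cauchy_filter_limit:
  fixes f :: "'b \<Rightarrow> 'a::complete_space"
  assumes F: "F \<noteq> bot"
    and C: "\<And>e. e > 0 \<Longrightarrow> \<exists>P. eventually P F \<and> (\<forall>x y. P x \<longrightarrow> P y \<longrightarrow> dist (f x) (f y) \<le> e)"
  shows "\<exists>l. (f \<longlongrightarrow> l) F"
proof -
  have "cauchy_filter (filtermap f F)"
    unfolding cauchy_filter_metric
  proof (intro allI impI)
    fix e :: real assume "e > 0"
    then obtain P where P: "eventually P F" "\<And>x y. P x \<Longrightarrow> P y \<Longrightarrow> dist (f x) (f y) \<le> e/2"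
      using C[of "e/2"] by auto
    have "dist a b < e" if "\<exists>x. P x \<and> a = f x" "\<exists>x. P x \<and> b = f x" for a b
      using that P(2) \<open>e > 0\<close> by (metis field_less_half_sum half_gt_zero le_less_trans less_add_same_cancel1 field_sum_of_halves)
    moreover have "eventually (\<lambda>z. \<exists>x. P x \<and> z = f x) (filtermap f F)"
      unfolding eventually_filtermap using P(1) by (rule eventually_mono) blast
    ultimately show "\<exists>P. eventually P (filtermap f F) \<and> (\<forall>x y. P x \<and> P y \<longrightarrow> dist x y < e)" by blast
  qed
  moreover have "filtermap f F \<noteq> bot" using F by (simp add: filtermap_bot_iff)
  ultimately obtain l where "filtermap f F \<le> nhds l"
    using complete_UNIV unfolding complete_uniform by force
  then show ?thesis unfolding filterlim_def by blast
qed

lemma dist_gt_half: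
  fixes a b c :: "'a::metric_space"
  assumes "dist a b > e" shows "dist c a > e / 2 \<or> dist c b > e / 2"
  using dist_triangle[of a b c] assms by (simp add: dist_commute) linarith

text \<open>If oscillations larger than e occurred arbitrarily close to the right of t, take one
  pair and a second pair still closer to t. The later point v of the closer pair is farther than e/2
  from one point of the other pair, so a single mesh cell holds two consecutive oscillations larger
  than e/2.\<close>

lemma regular_path_right_Cauchy:
  assumes x: "regular_path x" and t: "0 \<le> t" and e: "e > 0"
  shows "\<exists>d>0. \<forall>a\<in>dyadics \<inter> {t<..<t+d}. \<forall>b\<in>dyadics \<inter> {t<..<t+d}. dist (x a) (x b) \<le> e"
proof (rule ccontr)
  assume "\<not> ?thesis"
  then have neg: "\<exists>a\<in>dyadics. \<exists>b\<in>dyadics. t < a \<and> a < t + d \<and> t < b \<and> b < t + d \<and> dist (x a) (x b) > e"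
    if "d > 0" for d using that by (fastforce simp: not_le)
  obtain T :: nat where T: "t + 1 < T" using reals_Archimedean2 by blast
  obtain m where m: "\<And>i s t u. i < T * 2 ^ m \<Longrightarrow> s \<in> dyadics \<Longrightarrow> t \<in> dyadics \<Longrightarrow> u \<in> dyadics \<Longrightarrow>
      real i / 2 ^ m \<le> s \<Longrightarrow> s \<le> t \<Longrightarrow> t \<le> u \<Longrightarrow> u \<le> (real i + 1) / 2 ^ m \<Longrightarrow>
      \<not> (dist (x s) (x t) > e/2 \<and> dist (x t) (x u) > e/2)"
    using x e unfolding regular_path_def by (metis half_gt_zero)
  \<comment> \<open>The floor selects the cell that contains t and a right neighbourhood of it, also
    when t is a mesh point.\<close>
  define i where "i = nat \<lfloor>t * 2 ^ m\<rfloor>"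
  have "real i = of_int \<lfloor>t * 2 ^ m\<rfloor>" using t by (simp add: i_def)
  then have i: "real i \<le> t * 2 ^ m" "t * 2 ^ m < real i + 1" by linarith+
  then have i': "real i / 2 ^ m \<le> t" "t < (real i + 1) / 2 ^ m" by (auto simp: field_simps)
  have iT: "i < T * 2 ^ m"
  proof -
    have "t * 2 ^ m < real T * 2 ^ m" using T by simp
    moreover have "real (T * 2 ^ m) = real T * 2 ^ m" by simp
    ultimately have "real i < real (T * 2 ^ m)" using i by linarith
    then show ?thesis by (simp only: of_nat_less_iff)
  qed
  obtain a1 b1 where 1: "a1 \<in> dyadics" "b1 \<in> dyadics" "t < a1" "t < b1" "a1 < (real i + 1) / 2 ^ m"
      "b1 < (real i + 1) / 2 ^ m" "dist (x a1) (x b1) > e"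
    using neg[of "(real i + 1) / 2 ^ m - t"] i' by auto
  have "min a1 b1 - t > 0" using 1 by auto
  from neg[OF this] obtain a2 b2 where 2: "a2 \<in> dyadics" "b2 \<in> dyadics" "t < a2" "t < b2"
      "a2 < min a1 b1" "b2 < min a1 b1" "dist (x a2) (x b2) > e" by auto
  define s v where "s = min a2 b2" and "v = max a2 b2"
  have sv: "s \<in> dyadics" "v \<in> dyadics" "s \<le> v" "t < s" "v < a1" "v < b1" "dist (x s) (x v) > e"
    using 2 by (auto simp: s_def v_def min_def max_def dist_commute split: if_splits)
  from dist_gt_half[OF 1(7), of "x v"] show False
  proof
    assume "dist (x v) (x a1) > e / 2"
    then show False using m[OF iT sv(1,2) 1(1)] sv 1 i' e by simp
  next
    assume "dist (x v) (x b1) > e / 2"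
    then show False using m[OF iT sv(1,2) 1(2)] sv 1 i' e by simp
  qed
qed

lemma regular_path_left_Cauchy:
  assumes x: "regular_path x" and t: "0 < t" and e: "e > 0"
  shows "\<exists>d>0. \<forall>a\<in>dyadics \<inter> {t-d<..<t}. \<forall>b\<in>dyadics \<inter> {t-d<..<t}. dist (x a) (x b) \<le> e"
proof (rule ccontr)
  assume "\<not> ?thesis"
  then have neg: "\<exists>a\<in>dyadics. \<exists>b\<in>dyadics. t - d < a \<and> a < t \<and> t - d < b \<and> b < t \<and> dist (x a) (x b) > e"
    if "d > 0" for d using that by (fastforce simp: not_le)
  obtain T :: nat where T: "t + 1 < T" using reals_Archimedean2 by blast
  obtain m where m: "\<And>i s t u. i < T * 2 ^ m \<Longrightarrow> s \<in> dyadics \<Longrightarrow> t \<in> dyadics \<Longrightarrow> u \<in> dyadics \<Longrightarrow>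
      real i / 2 ^ m \<le> s \<Longrightarrow> s \<le> t \<Longrightarrow> t \<le> u \<Longrightarrow> u \<le> (real i + 1) / 2 ^ m \<Longrightarrow>
      \<not> (dist (x s) (x t) > e/2 \<and> dist (x t) (x u) > e/2)"
    using x e unfolding regular_path_def by (metis half_gt_zero)
  \<comment> \<open>The ceiling minus 1 selects the cell whose left end lies strictly before t, so
    that it contains a left neighbourhood also when t is a mesh point.\<close>
  define i where "i = nat (\<lceil>t * 2 ^ m\<rceil> - 1)"
  have "0 < t * 2 ^ m" using t by simp
  then have "real i = of_int \<lceil>t * 2 ^ m\<rceil> - 1" by (simp add: i_def)
  then have i: "real i < t * 2 ^ m" "t * 2 ^ m \<le> real i + 1" by linarith+
  then have i': "real i / 2 ^ m < t" "t \<le> (real i + 1) / 2 ^ m" by (auto simp: field_simps)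
  have iT: "i < T * 2 ^ m"
  proof -
    have "t * 2 ^ m < real T * 2 ^ m" using T by simp
    moreover have "real (T * 2 ^ m) = real T * 2 ^ m" by simp
    ultimately have "real i < real (T * 2 ^ m)" using i by linarith
    then show ?thesis by (simp only: of_nat_less_iff)
  qed
  obtain a1 b1 where 1: "a1 \<in> dyadics" "b1 \<in> dyadics" "a1 < t" "b1 < t" "real i / 2 ^ m < a1"
      "real i / 2 ^ m < b1" "dist (x a1) (x b1) > e"
    using neg[of "t - real i / 2 ^ m"] i' by auto
  have "t - max a1 b1 > 0" using 1 by auto
  from neg[OF this] obtain a2 b2 where 2: "a2 \<in> dyadics" "b2 \<in> dyadics" "a2 < t" "b2 < t"
      "max a1 b1 < a2" "max a1 b1 < b2" "dist (x a2) (x b2) > e" by auto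
  define s v where "s = min a2 b2" and "v = max a2 b2"
  have sv: "s \<in> dyadics" "v \<in> dyadics" "s \<le> v" "v < t" "a1 < s" "b1 < s" "dist (x s) (x v) > e"
    using 2 by (auto simp: s_def v_def min_def max_def dist_commute split: if_splits)
  from dist_gt_half[OF 1(7), of "x s"] show False
  proof
    assume "dist (x s) (x a1) > e / 2"
    then show False using m[OF iT 1(1) sv(1,2)] sv 1 i' e by (simp add: dist_commute)
  next
    assume "dist (x s) (x b1) > e / 2"
    then show False using m[OF iT 1(2) sv(1,2)] sv 1 i' e by (simp add: dist_commute)
  qed
qed

lemma right_ext_filter_nontrivial:
  assumes "0 \<le> t" shows "at t within (dyadics \<inter> {t<..}) \<noteq> bot"
proof -
  have "t islimpt (dyadics \<inter> {t<..})"
    unfolding islimpt_approachable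
  proof (intro allI impI)
    fix e :: real assume "0 < e"
    then obtain q where "q \<in> dyadics" "t < q" "q < t + e" using dyadics_dense[OF assms] by blast
    then show "\<exists>q\<in>dyadics \<inter> {t<..}. q \<noteq> t \<and> dist q t < e"
      by (intro bexI[of _ q]) (auto simp: dist_real_def)
  qed
  then show ?thesis by (simp add: trivial_limit_within)
qed

lemma eventually_right_dyadic:
  assumes "d > 0" shows "eventually (\<lambda>q. q \<in> dyadics \<inter> {t<..<t+d}) (at t within (dyadics \<inter> {t<..}))"
  unfolding eventually_at using assms by (intro exI[of _ d]) (auto simp: dist_real_def)

lemma right_ext_tendsto:
  fixes x :: "real \<Rightarrow> 'a::complete_space"
  assumes x: "regular_path x" and t: "0 \<le> t"
  shows "(x \<longlongrightarrow> right_ext x t) (at t within (dyadics \<inter> {t<..}))"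
proof -
  have "\<exists>l. (x \<longlongrightarrow> l) (at t within (dyadics \<inter> {t<..}))"
  proof (rule Cauchy_filter_limit[OF right_ext_filter_nontrivial[OF t]])
    fix e :: real assume "e > 0"
    then obtain d where "d > 0" "\<forall>a\<in>dyadics \<inter> {t<..<t+d}. \<forall>b\<in>dyadics \<inter> {t<..<t+d}. dist (x a) (x b) \<le> e"
      using regular_path_right_Cauchy[OF x t] by blast
    then show "\<exists>P. eventually P (at t within (dyadics \<inter> {t<..})) \<and> (\<forall>a b. P a \<longrightarrow> P b \<longrightarrow> dist (x a) (x b) \<le> e)"
      using eventually_right_dyadic by blast
  qed
  then show ?thesis unfolding right_ext_def
    using tendsto_Lim[OF right_ext_filter_nontrivial[OF t]] by metis
qed

lemma right_ext_tendsto_seq: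
  fixes x :: "real \<Rightarrow> 'a::complete_space"
  assumes x: "regular_path x" and t: "0 \<le> t"
  shows "(\<lambda>n. x (real (next_dyadic n t) / 2 ^ n)) \<longlonglongrightarrow> right_ext x t"
proof (rule filterlim_compose[OF right_ext_tendsto[OF x t]])
  show "filterlim (\<lambda>n. real (next_dyadic n t) / 2 ^ n) (at t within (dyadics \<inter> {t<..})) sequentially"
    unfolding filterlim_at using next_dyadic_tendsto[OF t] next_dyadic_bounds(1)[OF t]
    by (auto intro!: always_eventually dyadicsI simp: order_less_imp_not_eq2)
qed

lemma right_ext_dist_le:
  fixes x :: "real \<Rightarrow> 'a::complete_space"
  assumes x: "regular_path x" and t: "0 \<le> t" and d: "d > 0"
    and le: "\<And>a. a \<in> dyadics \<Longrightarrow> t < a \<Longrightarrow> a < t + d \<Longrightarrow> dist (x a) z \<le> e"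
  shows "dist (right_ext x t) z \<le> e"
proof (rule tendsto_upperbound[OF _ _ right_ext_filter_nontrivial[OF t]])
  show "((\<lambda>q. dist (x q) z) \<longlongrightarrow> dist (right_ext x t) z) (at t within (dyadics \<inter> {t<..}))"
    by (intro tendsto_intros right_ext_tendsto[OF x t])
  show "\<forall>\<^sub>F q in at t within (dyadics \<inter> {t<..}). dist (x q) z \<le> e"
    by (rule eventually_mono[OF eventually_right_dyadic[OF d]]) (use le in auto)
qed

text \<open>For s shortly after t, the dyadics just to the right of s still lie in the Cauchy window
  of t; both extended values are therefore e/4-close to one common dyadic value.\<close>

lemma right_ext_right_continuous:
  fixes x :: "real \<Rightarrow> 'a::complete_space"
  assumes x: "regular_path x" and t: "0 \<le> t"
  shows "(right_ext x \<longlongrightarrow> right_ext x t) (at_right t)"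
proof (rule tendstoI)
  fix e :: real assume e: "e > 0"
  then obtain d where d: "d > 0" "\<And>a b. a \<in> dyadics \<Longrightarrow> b \<in> dyadics \<Longrightarrow> t < a \<Longrightarrow> a < t + d \<Longrightarrow>
      t < b \<Longrightarrow> b < t + d \<Longrightarrow> dist (x a) (x b) \<le> e/4"
    using regular_path_right_Cauchy[OF x t, of "e/4"] by auto
  obtain b where b: "b \<in> dyadics" "t < b" "b < t + d" using dyadics_dense[OF t d(1)] by blast
  have 1: "dist (right_ext x t) (x b) \<le> e/4"
    using d b by (intro right_ext_dist_le[OF x t d(1)]) auto
  have "dist (right_ext x s) (right_ext x t) < e" if s: "t < s" "s < t + d" for s
  proof -
    have "dist (right_ext x s) (x b) \<le> e/4"
      using d b s t by (intro right_ext_dist_le[OF x _ , of s "t + d - s"]) auto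
    then show ?thesis using 1 dist_triangle2[of "right_ext x s" "right_ext x t" "x b"] e by linarith
  qed
  then show "\<forall>\<^sub>F s in at_right t. dist (right_ext x s) (right_ext x t) < e"
    unfolding eventually_at_right_field using d(1) by (intro exI[of _ "t + d"]) auto
qed

lemma right_ext_left_limit:
  fixes x :: "real \<Rightarrow> 'a::complete_space"
  assumes x: "regular_path x" and t: "0 < t"
  shows "\<exists>l. (right_ext x \<longlongrightarrow> l) (at_left t)"
proof (rule Cauchy_filter_limit)
  show "at_left t \<noteq> bot" by (rule trivial_limit_at_left_real)
  fix e :: real assume e: "e > 0"
  then obtain d0 where d0: "d0 > 0" "\<And>a b. a \<in> dyadics \<Longrightarrow> b \<in> dyadics \<Longrightarrow> t - d0 < a \<Longrightarrow> a < t \<Longrightarrow>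
      t - d0 < b \<Longrightarrow> b < t \<Longrightarrow> dist (x a) (x b) \<le> e/4"
    using regular_path_left_Cauchy[OF x t, of "e/4"] by auto
  define d where "d = min d0 t"
  have d: "d > 0" "d \<le> t" "\<And>a b. a \<in> dyadics \<Longrightarrow> b \<in> dyadics \<Longrightarrow> t - d < a \<Longrightarrow> a < t \<Longrightarrow>
      t - d < b \<Longrightarrow> b < t \<Longrightarrow> dist (x a) (x b) \<le> e/4"
    using d0 t by (auto simp: d_def)
  obtain b where b: "b \<in> dyadics" "t - d < b" "b < t" using dyadics_dense[of "t - d" d] d by auto
  have 1: "dist (right_ext x s) (x b) \<le> e/4" if s: "t - d < s" "s < t" for s
    using d b s by (intro right_ext_dist_le[OF x _ , of s "t - s"]) auto
  have "dist (right_ext x s) (right_ext x s') \<le> e" if s: "t - d < s" "s < t" "t - d < s'" "s' < t" for s s'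
    using 1[of s] 1[of s'] s dist_triangle2[of "right_ext x s" "right_ext x s'" "x b"] e by linarith
  moreover have "eventually (\<lambda>s. t - d < s \<and> s < t) (at_left t)"
    unfolding eventually_at_left_field using d(1) by (intro exI[of _ "t - d"]) auto
  ultimately show "\<exists>P. eventually P (at_left t) \<and> (\<forall>a b. P a \<longrightarrow> P b \<longrightarrow> dist (right_ext x a) (right_ext x b) \<le> e)"
    by (intro exI[of _ "\<lambda>s. t - d < s \<and> s < t"]) auto
qed

section \<open>Limits of independent variables\<close>

text \<open>Mean value inequality on the left half-plane, where the derivative of exp has modulus at
  most 1.\<close>

lemma norm_one_minus_exp_le:
  assumes "Re z \<le> 0" shows "norm (1 - exp z) \<le> norm z"
proof -
  have "norm (exp 0 - exp z) \<le> 1 * norm (0 - z)"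
  proof (rule field_differentiable_bound)
    show "convex {z. Re z \<le> 0}" by (rule convex_halfspace_Re_le)
    show "(exp has_field_derivative exp w) (at w within {z. Re z \<le> 0})" for w :: complex
      by (auto intro!: derivative_eq_intros)
    show "norm (exp w) \<le> 1" if "w \<in> {z. Re z \<le> 0}" for w using that by (simp add: norm_exp_eq_Re)
  qed (use assms in auto)
  then show ?thesis by simp
qed

text \<open>On a ball, 1 - exp(s \<Phi>) is bounded by s times the maximum of |\<Phi>|, so
  \<open>tail_bound\<close> gives a constant that serves all s at once. In the application s is the
  length of a time interval.\<close>

lemma exponent_tail_bound:
  fixes \<Phi> :: "'a::euclidean_space \<Rightarrow> complex"
  assumes \<Phi>: "continuous_on UNIV \<Phi>" "\<And>y. Re (\<Phi> y) \<le> 0" and e: "e > 0"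
  shows "\<exists>C\<ge>0. \<forall>(\<mu>::'a measure) s. borel_prob \<mu> \<longrightarrow> s \<ge> 0 \<longrightarrow> (\<forall>y. charf \<mu> y = exp (of_real s * \<Phi> y)) \<longrightarrow>
     measure \<mu> {x. norm x > e} \<le> C * s"
proof -
  obtain R C where RC: "R \<ge> 0" "C \<ge> 0" "\<And>(\<mu>::'a measure) \<delta>. borel_prob \<mu> \<Longrightarrow>
     (\<forall>y. norm y \<le> R \<longrightarrow> norm (1 - charf \<mu> y) \<le> \<delta>) \<Longrightarrow> measure \<mu> {x. norm x > e} \<le> C * \<delta>"
    using tail_bound[OF e, where 'a='a] by blast
  have "compact (\<Phi> ` cball 0 R)"
    by (intro compact_continuous_image continuous_on_subset[OF \<Phi>(1)]) auto
  then obtain K where K: "K > 0" "\<And>y. norm y \<le> R \<Longrightarrow> norm (\<Phi> y) \<le> K"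
    by (auto dest!: compact_imp_bounded simp: bounded_pos)
  show ?thesis
  proof (intro exI[of _ "C * K"] conjI allI impI)
    show "0 \<le> C * K" using RC K by simp
    fix \<mu> :: "'a measure" and s :: real
    assume \<mu>: "borel_prob \<mu>" and s: "s \<ge> 0" and ch: "\<forall>y. charf \<mu> y = exp (of_real s * \<Phi> y)"
    have "norm (1 - charf \<mu> y) \<le> K * s" if "norm y \<le> R" for y
    proof -
      have "norm (1 - charf \<mu> y) \<le> norm (of_real s * \<Phi> y)"
        using \<Phi>(2)[of y] s unfolding ch[rule_format]
        by (intro norm_one_minus_exp_le) (simp add: mult_nonneg_nonpos)
      also have "\<dots> \<le> s * K" using s K(2)[OF that] by (auto simp: norm_mult intro: mult_left_mono)
      finally show ?thesis by (simp add: mult.commute)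
    qed
    then show "measure \<mu> {x. norm x > e} \<le> C * K * s" using RC(3)[OF \<mu>] by (simp add: mult.assoc)
  qed
qed

lemma charf_tendsto:
  fixes Z :: "nat \<Rightarrow> 'w \<Rightarrow> 'a::euclidean_space"
  assumes M: "prob_space M" and Z [measurable]: "\<And>k. Z k \<in> borel_measurable M" "Z' \<in> borel_measurable M"
    and lim: "AE \<omega> in M. (\<lambda>k. Z k \<omega>) \<longlonglongrightarrow> Z' \<omega>"
  shows "(\<lambda>k. charf (distr M borel (Z k)) y) \<longlonglongrightarrow> charf (distr M borel Z') y"
proof -
  interpret prob_space M by fact
  show ?thesis
    unfolding charf_distr[OF Z(1)] charf_distr[OF Z(2)]
  proof (rule integral_dominated_convergence[where w="\<lambda>_. 1"])
    show "AE \<omega> in M. (\<lambda>k. iexp (y \<bullet> Z k \<omega>)) \<longlonglongrightarrow> iexp (y \<bullet> Z' \<omega>)"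
      using lim by eventually_elim (intro tendsto_intros)
  qed (auto simp: norm_exp_i_times)
qed

text \<open>Indicators do not pass to the limit of the variables, but continuous functions do. So k
  tends to infinity first, inside products of bump functions, and only then do the bumps shrink to
  closed sets, which generate the Borel sets.\<close>

lemma (in prob_space) indep_vars_limit:
  fixes Z :: "nat \<Rightarrow> 'i \<Rightarrow> 'a \<Rightarrow> 'b::euclidean_space"
  assumes I: "finite I" "I \<noteq> {}"
    and ind: "\<And>k. indep_vars (\<lambda>_. borel) (Z k) I"
    and Z'm: "\<And>i. i \<in> I \<Longrightarrow> Z' i \<in> borel_measurable M"
    and lim: "\<And>i. i \<in> I \<Longrightarrow> AE \<omega> in M. (\<lambda>k. Z k i \<omega>) \<longlonglongrightarrow> Z' i \<omega>"
  shows "indep_vars (\<lambda>_. borel) Z' I"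
proof -
  have Zm: "i \<in> I \<Longrightarrow> Z k i \<in> borel_measurable M" for i k
    using ind by (auto simp: indep_vars_def)
  have bm [measurable]: "bump F r \<in> borel_measurable borel" for F :: "'b set" and r
    by (intro borel_measurable_continuous_onI bump_continuous)
  have bi: "integrable M (\<lambda>\<omega>. bump F r (V \<omega>))" if "V \<in> borel_measurable M" for F :: "'b set" and r V
    using that bump_range[of F r] by (intro integrable_const_bound[where B=1]) (auto simp: abs_le_iff intro: order_trans[of _ 0])
  have prod_bump: "\<bar>\<Prod>i\<in>I. bump (A i) r (x i)\<bar> \<le> 1" for A :: "'i \<Rightarrow> 'b set" and r x
    unfolding abs_prod using bump_range by (intro prod_le_1) (auto simp: abs_le_iff intro: order_trans[of _ 0])
  have bump_prod: "expectation (\<lambda>\<omega>. \<Prod>i\<in>I. bump (A i) r (Z' i \<omega>)) = (\<Prod>i\<in>I. expectation (\<lambda>\<omega>. bump (A i) r (Z' i \<omega>)))"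
    for A :: "'i \<Rightarrow> 'b set" and r
  proof (rule LIMSEQ_unique)
    have conv: "AE \<omega> in M. \<forall>i\<in>I. (\<lambda>k. bump (A i) r (Z k i \<omega>)) \<longlonglongrightarrow> bump (A i) r (Z' i \<omega>)"
    proof (rule AE_finite_allI[OF I(1)])
      fix i assume "i \<in> I"
      have "isCont (bump (A i) r) x" for x using bump_continuous[of "A i" r] by (simp add: continuous_on_eq_continuous_at)
      then show "AE \<omega> in M. (\<lambda>k. bump (A i) r (Z k i \<omega>)) \<longlonglongrightarrow> bump (A i) r (Z' i \<omega>)"
        using lim[OF \<open>i \<in> I\<close>] by (auto elim!: eventually_mono intro: isCont_tendsto_compose)
    qed
    show "(\<lambda>k. expectation (\<lambda>\<omega>. \<Prod>i\<in>I. bump (A i) r (Z k i \<omega>))) \<longlonglongrightarrow> expectation (\<lambda>\<omega>. \<Prod>i\<in>I. bump (A i) r (Z' i \<omega>))"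
    proof (rule integral_dominated_convergence[where w="\<lambda>_. 1"])
      show "AE \<omega> in M. (\<lambda>k. \<Prod>i\<in>I. bump (A i) r (Z k i \<omega>)) \<longlonglongrightarrow> (\<Prod>i\<in>I. bump (A i) r (Z' i \<omega>))"
        using conv by eventually_elim (auto intro!: tendsto_prod)
    qed (use Zm Z'm prod_bump in \<open>auto intro!: borel_measurable_prod measurable_compose[OF _ bm]\<close>)
    have "(\<lambda>k. \<Prod>i\<in>I. expectation (\<lambda>\<omega>. bump (A i) r (Z k i \<omega>))) \<longlonglongrightarrow> (\<Prod>i\<in>I. expectation (\<lambda>\<omega>. bump (A i) r (Z' i \<omega>)))"
    proof (rule tendsto_prod)
      fix i assume i: "i \<in> I"
      show "(\<lambda>k. expectation (\<lambda>\<omega>. bump (A i) r (Z k i \<omega>))) \<longlonglongrightarrow> expectation (\<lambda>\<omega>. bump (A i) r (Z' i \<omega>))"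
      proof (rule integral_dominated_convergence[where w="\<lambda>_. 1"])
        show "AE \<omega> in M. (\<lambda>k. bump (A i) r (Z k i \<omega>)) \<longlonglongrightarrow> bump (A i) r (Z' i \<omega>)"
          using conv by eventually_elim (use i in auto)
        show "AE \<omega> in M. norm (bump (A i) r (Z k i \<omega>)) \<le> 1" for k
          using bump_range[of "A i" r] by (auto simp: abs_le_iff intro: order_trans[of _ 0])
      qed (use Zm Z'm i in \<open>auto intro!: measurable_compose[OF _ bm]\<close>)
    qed
    moreover have "expectation (\<lambda>\<omega>. \<Prod>i\<in>I. bump (A i) r (Z k i \<omega>)) = (\<Prod>i\<in>I. expectation (\<lambda>\<omega>. bump (A i) r (Z k i \<omega>)))" for k
    proof (rule indep_vars_lebesgue_integral[OF I(1)])
      show "indep_vars (\<lambda>_. borel) (\<lambda>i \<omega>. bump (A i) r (Z k i \<omega>)) I"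
        by (rule indep_vars_compose2[OF ind]) measurable
    qed (use Zm bi in auto)
    ultimately show "(\<lambda>k. expectation (\<lambda>\<omega>. \<Prod>i\<in>I. bump (A i) r (Z k i \<omega>))) \<longlonglongrightarrow> (\<Prod>i\<in>I. expectation (\<lambda>\<omega>. bump (A i) r (Z' i \<omega>)))"
      by simp
  qed
  have main: "prob (\<Inter>j\<in>I. Z' j -` A j \<inter> space M) = (\<Prod>j\<in>I. prob (Z' j -` A j \<inter> space M))"
    if A: "\<And>i. i \<in> I \<Longrightarrow> closed (A i)" for A
  proof (cases "\<exists>i\<in>I. A i = {}")
    \<comment> \<open>An empty set is treated apart, since its bump functions do not tend to its
      indicator.\<close>
    case True
    then obtain i where i: "i \<in> I" "A i = {}" by blast
    then have "prob (Z' i -` A i \<inter> space M) = 0" by simp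
    then have "(\<Prod>j\<in>I. prob (Z' j -` A j \<inter> space M)) = 0"
      using i I by (intro prod_zero) blast+
    moreover have "(\<Inter>j\<in>I. Z' j -` A j \<inter> space M) = {}" using i by auto
    ultimately show ?thesis by (simp only: measure_empty)
  next
    case False
    have lims: "(\<lambda>r. bump (A i) r x) \<longlonglongrightarrow> indicator (A i) x" if "i \<in> I" for i x
      using bump_tendsto[OF A[OF that]] False that by auto
    have Am: "i \<in> I \<Longrightarrow> A i \<in> sets borel" for i using A by auto
    have vm: "i \<in> I \<Longrightarrow> Z' i -` A i \<inter> space M \<in> events" for i using measurable_sets[OF Z'm Am] by auto
    have 1: "(\<lambda>r. expectation (\<lambda>\<omega>. \<Prod>i\<in>I. bump (A i) r (Z' i \<omega>))) \<longlonglongrightarrow> expectation (\<lambda>\<omega>. \<Prod>i\<in>I. indicat_real (A i) (Z' i \<omega>))"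
    proof (rule integral_dominated_convergence[where w="\<lambda>_. 1"])
      show "AE \<omega> in M. (\<lambda>r. \<Prod>i\<in>I. bump (A i) r (Z' i \<omega>)) \<longlonglongrightarrow> (\<Prod>i\<in>I. indicat_real (A i) (Z' i \<omega>))"
        by (intro AE_I2 tendsto_prod lims)
    qed (use Z'm prod_bump Am in \<open>auto intro!: borel_measurable_prod measurable_compose[OF _ bm] measurable_compose[OF _ borel_measurable_indicator]\<close>)
    have 2: "(\<lambda>r. \<Prod>i\<in>I. expectation (\<lambda>\<omega>. bump (A i) r (Z' i \<omega>))) \<longlonglongrightarrow> (\<Prod>i\<in>I. expectation (\<lambda>\<omega>. indicat_real (A i) (Z' i \<omega>)))"
    proof (rule tendsto_prod)
      fix i assume i: "i \<in> I"
      show "(\<lambda>r. expectation (\<lambda>\<omega>. bump (A i) r (Z' i \<omega>))) \<longlonglongrightarrow> expectation (\<lambda>\<omega>. indicat_real (A i) (Z' i \<omega>))"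
      proof (rule integral_dominated_convergence[where w="\<lambda>_. 1"])
        show "AE \<omega> in M. (\<lambda>r. bump (A i) r (Z' i \<omega>)) \<longlonglongrightarrow> indicat_real (A i) (Z' i \<omega>)"
          using lims[OF i] by auto
        show "AE \<omega> in M. norm (bump (A i) r (Z' i \<omega>)) \<le> 1" for r
          using bump_range[of "A i" r] by (auto simp: abs_le_iff intro: order_trans[of _ 0])
      qed (use Z'm i Am in \<open>auto intro!: measurable_compose[OF _ bm] measurable_compose[OF _ borel_measurable_indicator]\<close>)
    qed
    have "expectation (\<lambda>\<omega>. \<Prod>i\<in>I. indicat_real (A i) (Z' i \<omega>)) = (\<Prod>i\<in>I. expectation (\<lambda>\<omega>. indicat_real (A i) (Z' i \<omega>)))"
      using LIMSEQ_unique[OF 1 2[folded bump_prod]] .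
    moreover have "expectation (\<lambda>\<omega>. \<Prod>i\<in>I. indicat_real (A i) (Z' i \<omega>)) = prob (\<Inter>j\<in>I. Z' j -` A j \<inter> space M)"
    proof -
      have "expectation (\<lambda>\<omega>. \<Prod>i\<in>I. indicat_real (A i) (Z' i \<omega>)) = expectation (indicator (\<Inter>j\<in>I. Z' j -` A j \<inter> space M))"
      proof (rule Bochner_Integration.integral_cong[OF refl])
        fix \<omega> assume \<omega>: "\<omega> \<in> space M"
        show "(\<Prod>i\<in>I. indicat_real (A i) (Z' i \<omega>)) = (indicator (\<Inter>j\<in>I. Z' j -` A j \<inter> space M) \<omega> :: real)"
        proof (cases "\<forall>i\<in>I. Z' i \<omega> \<in> A i")
          case True
          then show ?thesis using \<omega> I by simp
        next
          case F: False
          then obtain i where "i \<in> I" "Z' i \<omega> \<notin> A i" by blast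
          then have "(\<Prod>i\<in>I. indicat_real (A i) (Z' i \<omega>)) = (0::real)"
            using I by (intro prod_zero bexI[of _ i]) auto
          then show ?thesis using F by (auto simp: indicator_def)
        qed
      qed
      then show ?thesis using vm I by (simp add: sets.finite_INT)
    qed
    moreover have "expectation (\<lambda>\<omega>. indicat_real (A i) (Z' i \<omega>)) = prob (Z' i -` A i \<inter> space M)" if i: "i \<in> I" for i
    proof -
      have "expectation (\<lambda>\<omega>. indicat_real (A i) (Z' i \<omega>)) = expectation (indicator (Z' i -` A i \<inter> space M))"
        by (intro Bochner_Integration.integral_cong refl) (auto simp: indicator_def)
      then show ?thesis using vm[OF i] by simp
    qed
    ultimately show ?thesis by simp
  qed
  show ?thesis
    by (subst indep_vars_finite[where E="\<lambda>_. Collect closed", OF I(2,1)])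
       (use Z'm main in \<open>auto simp: borel_eq_closed Int_stable_def Pi_iff\<close>)
qed

lemma (in prob_space) indep_vars_psum_blocks:
  fixes \<xi> :: "nat \<Rightarrow> 'a \<Rightarrow> 'b::euclidean_space"
  assumes ind: "indep_vars (\<lambda>_. borel) \<xi> {..<K}" and q: "\<And>i. i < n \<Longrightarrow> q i \<le> q (Suc i)" and K: "q n \<le> K"
  shows "indep_vars (\<lambda>_. borel) (\<lambda>i \<omega>. psum (\<lambda>l. \<xi> l \<omega>) (q i) (q (Suc i))) {..<n}"
proof -
  have mono: "q i \<le> q j" if "i \<le> j" "j \<le> n" for i j
    using that
  proof (induction j rule: dec_induct)
    case (step m)
    then show ?case using q[of m] by simp
  qed simp
  have "disjoint_family_on (\<lambda>i. {q i..<q (Suc i)}) {..<n}"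
    unfolding disjoint_family_on_def
  proof safe
    fix i j x assume ij: "i < n" "j < n" "i \<noteq> j" and x: "x \<in> {q i..<q (Suc i)}" "x \<in> {q j..<q (Suc j)}"
    then consider "Suc i \<le> j" | "Suc j \<le> i" by linarith
    then show "x \<in> {}" using mono[of "Suc i" j] mono[of "Suc j" i] ij x by cases auto
  qed
  then have "indep_vars (\<lambda>i. PiM {q i..<q (Suc i)} (\<lambda>_. borel)) (\<lambda>i \<omega>. restrict (\<lambda>l. \<xi> l \<omega>) {q i..<q (Suc i)}) {..<n}"
  proof (rule indep_vars_restrict[OF ind, rotated])
    fix i assume "i \<in> {..<n}"
    then have "q (Suc i) \<le> K" using mono[of "Suc i" n] K by auto
    then show "{q i..<q (Suc i)} \<subseteq> {..<K}" by auto
  qed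
  then have "indep_vars (\<lambda>_. borel) (\<lambda>i \<omega>. (\<lambda>x. psum x (q i) (q (Suc i))) (restrict (\<lambda>l. \<xi> l \<omega>) {q i..<q (Suc i)})) {..<n}"
    by (rule indep_vars_compose2) (rule psum_measurable)
  then show ?thesis by (simp add: psum_restrict)
qed

section \<open>Existence of Levy processes\<close>

locale dyadic_process =
  fixes M :: "'w measure" and X :: "real \<Rightarrow> 'w \<Rightarrow> 'a::euclidean_space" and \<Phi> :: "'a \<Rightarrow> complex"
  assumes prob_M: "prob_space M"
    and X_meas [measurable]: "\<And>t. X t \<in> borel_measurable M"
    and X_0: "\<And>\<omega>. X 0 \<omega> = 0"
    and X_ind: "\<And>n K. prob_space.indep_vars M (\<lambda>_. borel) (\<lambda>i \<omega>. X (real (Suc i) / 2 ^ n) \<omega> - X (real i / 2 ^ n) \<omega>) {..<K::nat}"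
    and X_law: "\<And>n i y. charf (distr M borel (\<lambda>\<omega>. X (real (Suc i) / 2 ^ n) \<omega> - X (real i / 2 ^ n) \<omega>)) y = exp (\<Phi> y / 2 ^ n)"
    and \<Phi>_cont: "continuous_on UNIV \<Phi>"
    and \<Phi>_Re: "\<And>y. Re (\<Phi> y) \<le> 0"
begin

sublocale prob_space M by (rule prob_M)

definition incr :: "nat \<Rightarrow> nat \<Rightarrow> 'w \<Rightarrow> 'a" where
  "incr n i \<omega> = X (real (Suc i) / 2 ^ n) \<omega> - X (real i / 2 ^ n) \<omega>"

lemma incr_measurable [measurable]: "incr n i \<in> borel_measurable M"
  unfolding incr_def by measurable

lemma incr_indep: "indep_vars (\<lambda>_. borel) (incr n) {..<K}"
  unfolding incr_def by (rule X_ind)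

lemma incr_law: "charf (distr M borel (incr n i)) y = exp (\<Phi> y / 2 ^ n)"
  unfolding incr_def by (rule X_law)

lemma psum_incr: "i \<le> j \<Longrightarrow> psum (\<lambda>l. incr n l \<omega>) i j = X (real j / 2 ^ n) \<omega> - X (real i / 2 ^ n) \<omega>"
  unfolding psum_def incr_def by (rule sum_Suc_diff')

lemma psum_incr_charf:
  assumes "i \<le> j"
  shows "charf (distr M borel (\<lambda>\<omega>. psum (\<lambda>l. incr n l \<omega>) i j)) y = exp (of_real (real (j - i) / 2 ^ n) * \<Phi> y)"
proof -
  have "indep_vars (\<lambda>_. borel) (incr n) {i..<j}"
    by (rule indep_vars_subset[OF incr_indep[of n j]]) auto
  then have "charf (distr M borel (\<lambda>\<omega>. psum (\<lambda>l. incr n l \<omega>) i j)) y = (\<Prod>l\<in>{i..<j}. charf (distr M borel (incr n l)) y)"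
    unfolding psum_def by (intro charf_sum_indep prob_M) auto
  also have "\<dots> = exp (\<Phi> y / 2 ^ n) ^ (j - i)" by (simp add: incr_law)
  also have "\<dots> = exp (of_real (real (j - i) / 2 ^ n) * \<Phi> y)"
    by (simp flip: exp_of_nat_mult)
  finally show ?thesis .
qed

text \<open>Failure of \<open>regular_path\<close> at mesh 2^-m, as seen by the dyadic times of
  level n only. The two levels are kept apart so that n can tend to infinity while the mesh stays
  fixed.\<close>

definition bad :: "nat \<Rightarrow> real \<Rightarrow> nat \<Rightarrow> nat \<Rightarrow> 'w set" where
  "bad T e m n = {\<omega>\<in>space M. \<exists>i<T * 2 ^ m. \<exists>j k l::nat. j \<le> k \<and> k \<le> l \<and> real i / 2 ^ m \<le> real j / 2 ^ n \<and>
     real l / 2 ^ n \<le> (real i + 1) / 2 ^ m \<and>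
     dist (X (real j / 2 ^ n) \<omega>) (X (real k / 2 ^ n) \<omega>) > e \<and> dist (X (real k / 2 ^ n) \<omega>) (X (real l / 2 ^ n) \<omega>) > e}"

lemma bad_measurable [measurable]: "bad T e m n \<in> events"
  unfolding bad_def by measurable

lemma bad_Suc: "bad T e m n \<subseteq> bad T e m (Suc n)"
proof
  fix \<omega> assume "\<omega> \<in> bad T e m n"
  then obtain i j k l :: nat where h: "\<omega> \<in> space M" "i < T * 2 ^ m" "j \<le> k" "k \<le> l" "real i / 2 ^ m \<le> real j / 2 ^ n"
     "real l / 2 ^ n \<le> (real i + 1) / 2 ^ m"
     "dist (X (real j / 2 ^ n) \<omega>) (X (real k / 2 ^ n) \<omega>) > e" "dist (X (real k / 2 ^ n) \<omega>) (X (real l / 2 ^ n) \<omega>) > e"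
    unfolding bad_def by blast
  have eq: "real r / 2 ^ n = real (2 * r) / 2 ^ Suc n" for r by simp
  show "\<omega> \<in> bad T e m (Suc n)"
    unfolding bad_def using h unfolding eq
    by (intro CollectI conjI exI[of _ i] exI[of _ "2*j"] exI[of _ "2*k"] exI[of _ "2*l"]) auto
qed

lemma psum_tail:
  assumes e: "e > 0"
  shows "\<exists>C\<ge>0. \<forall>n i j. i \<le> j \<longrightarrow> prob {\<omega>\<in>space M. norm (psum (\<lambda>l. incr n l \<omega>) i j) > e} \<le> C * (real (j - i) / 2 ^ n)"
proof -
  obtain C where C: "C \<ge> 0" "\<And>(\<mu>::'a measure) s. borel_prob \<mu> \<Longrightarrow> s \<ge> 0 \<Longrightarrow> (\<forall>y. charf \<mu> y = exp (of_real s * \<Phi> y)) \<Longrightarrow>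
     measure \<mu> {x. norm x > e} \<le> C * s"
    using exponent_tail_bound[OF \<Phi>_cont \<Phi>_Re e] by blast
  have "prob {\<omega>\<in>space M. norm (psum (\<lambda>l. incr n l \<omega>) i j) > e} \<le> C * (real (j - i) / 2 ^ n)" if "i \<le> j" for n i j
  proof -
    have pm [measurable]: "(\<lambda>\<omega>. psum (\<lambda>l. incr n l \<omega>) i j) \<in> borel_measurable M"
      by (rule psum_rv) measurable
    have "measure (distr M borel (\<lambda>\<omega>. psum (\<lambda>l. incr n l \<omega>) i j)) {x. norm x > e} \<le> C * (real (j - i) / 2 ^ n)"
      by (intro C(2) borel_prob_distr prob_M allI psum_incr_charf[OF that] pm) simp
    then show ?thesis by (subst (asm) measure_distr) (auto simp: vimage_def Int_def conj_commute)
  qed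
  with C(1) show ?thesis by blast
qed

text \<open>Increments within a cell of length 2^-m exceed e with probability at most C / 2^m, so
  two oscillations in that cell have probability of order 4^-m. The square outweighs the T 2^m cells
  and leaves a factor 2^-m, uniformly in n.\<close>

lemma bad_prob:
  assumes e: "e > 0"
  shows "\<exists>C\<ge>0. \<forall>T m n. m \<le> n \<longrightarrow> C / 2 ^ m \<le> 1/2 \<longrightarrow> prob (bad T (4 * e) m n) \<le> 4 * real T * C\<^sup>2 / 2 ^ m"
proof -
  obtain C where C: "C \<ge> 0" "\<And>n i j. i \<le> j \<Longrightarrow> prob {\<omega>\<in>space M. norm (psum (\<lambda>l. incr n l \<omega>) i j) > e} \<le> C * (real (j - i) / 2 ^ n)"
    using psum_tail[OF e] by blast
  have "prob (bad T (4 * e) m n) \<le> 4 * real T * C\<^sup>2 / 2 ^ m" if mn: "m \<le> n" and half: "C / 2 ^ m \<le> 1/2" for T m n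
  proof -
    \<comment> \<open>The number of steps of level n in one cell of length 2^-m.\<close>
    define r :: nat where "r = 2 ^ (n - m)"
    have "real r = 2 ^ (n - m)" by (simp add: r_def)
    also have "\<dots> = 2 ^ n / 2 ^ m" by (rule power_diff) (use mn in auto)
    finally have r: "real r / 2 ^ n = 1 / 2 ^ m" by simp
    define E where "E i = {\<omega>\<in>space M. \<exists>s\<in>{i*r..(i+1)*r}. \<exists>t\<in>{s..(i+1)*r}. \<exists>u\<in>{t..(i+1)*r}.
      norm (psum (\<lambda>l. incr n l \<omega>) s t) > 4 * e \<and> norm (psum (\<lambda>l. incr n l \<omega>) t u) > 4 * e}" for i
    have [measurable]: "(\<lambda>\<omega>. psum (\<lambda>l. incr n l \<omega>) i j) \<in> borel_measurable M" for i j
      by (rule psum_rv) measurable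
    have Em: "E i \<in> events" for i unfolding E_def by measurable
    have Ep: "prob (E i) \<le> 4 * (C / 2 ^ m)\<^sup>2" for i
      unfolding E_def
    proof (rule double_oscillation[OF _ incr_indep _ order_refl _ half])
      fix s t assume st: "i * r \<le> s" "s \<le> t" "t \<le> (i + 1) * r"
      have "real (t - s) / 2 ^ n \<le> real r / 2 ^ n"
        using st by (intro divide_right_mono) (auto simp: algebra_simps)
      then have "C * (real (t - s) / 2 ^ n) \<le> C * (1 / 2 ^ m)"
        unfolding r using C(1) by (rule mult_left_mono)
      then show "prob {\<omega>\<in>space M. norm (psum (\<lambda>l. incr n l \<omega>) s t) > e} \<le> C / 2 ^ m"
        using C(2)[OF st(2), of n] by simp
    qed auto
    have "bad T (4 * e) m n \<subseteq> (\<Union>i<T * 2 ^ m. E i)"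
    proof
      fix \<omega> assume "\<omega> \<in> bad T (4 * e) m n"
      then obtain i j k l :: nat where h: "\<omega> \<in> space M" "i < T * 2 ^ m" "j \<le> k" "k \<le> l" "real i / 2 ^ m \<le> real j / 2 ^ n"
         "real l / 2 ^ n \<le> (real i + 1) / 2 ^ m"
         "dist (X (real j / 2 ^ n) \<omega>) (X (real k / 2 ^ n) \<omega>) > 4 * e" "dist (X (real k / 2 ^ n) \<omega>) (X (real l / 2 ^ n) \<omega>) > 4 * e"
        unfolding bad_def by blast
      have scale: "a / 2 ^ m = a * real r / 2 ^ n" for a :: real
        using r by (metis mult.right_neutral times_divide_eq_right)
      have "real (i * r) \<le> real j" using h(5) unfolding scale by (simp add: divide_le_cancel)
      then have 1: "i * r \<le> j" by (simp only: of_nat_le_iff)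
      have "real l \<le> real ((i + 1) * r)" using h(6) unfolding scale by (simp add: divide_le_cancel algebra_simps)
      then have 2: "l \<le> (i + 1) * r" by (simp only: of_nat_le_iff)
      have "\<omega> \<in> E i"
      proof -
        have "norm (psum (\<lambda>l. incr n l \<omega>) j k) > 4 * e" "norm (psum (\<lambda>l. incr n l \<omega>) k l) > 4 * e"
          using h(3,4,7,8) by (simp_all add: psum_incr dist_norm norm_minus_commute)
        moreover have "j \<in> {i*r..(i+1)*r}" "k \<in> {j..(i+1)*r}" "l \<in> {k..(i+1)*r}" using h(3,4) 1 2 by auto
        ultimately show ?thesis unfolding E_def using h(1) by blast
      qed
      then show "\<omega> \<in> (\<Union>i<T * 2 ^ m. E i)" using h by auto
    qed
    then have "prob (bad T (4 * e) m n) \<le> prob (\<Union>i<T * 2 ^ m. E i)"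
      using Em by (intro finite_measure_mono) auto
    also have "\<dots> \<le> (\<Sum>i<T * 2 ^ m. prob (E i))"
      using Em by (intro finite_measure_subadditive_finite) auto
    also have "\<dots> \<le> (\<Sum>i<T * 2 ^ m. 4 * (C / 2 ^ m)\<^sup>2)" by (intro sum_mono Ep)
    also have "\<dots> = 4 * real T * C\<^sup>2 / 2 ^ m" by (simp add: power2_eq_square field_simps)
    finally show ?thesis .
  qed
  with C(1) show ?thesis by blast
qed

text \<open>The bound is uniform in n and the bad events increase with n, so it holds for their
  union; it then tends to 0 as the mesh is refined.\<close>

lemma AE_not_bad:
  assumes e: "e > 0"
  shows "AE \<omega> in M. \<exists>m. \<forall>n. \<omega> \<notin> bad T (4 * e) m n"
proof -
  obtain C where C: "C \<ge> 0" "\<And>T m n. m \<le> n \<Longrightarrow> C / 2 ^ m \<le> 1/2 \<Longrightarrow> prob (bad T (4 * e) m n) \<le> 4 * real T * C\<^sup>2 / 2 ^ m"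
    using bad_prob[OF e] by blast
  have 1: "prob (\<Union>n. bad T (4 * e) m n) \<le> 4 * real T * C\<^sup>2 / 2 ^ m" if "C / 2 ^ m \<le> 1/2" for m
  proof (rule LIMSEQ_le_const2)
    show "(\<lambda>n. prob (bad T (4 * e) m n)) \<longlonglongrightarrow> prob (\<Union>n. bad T (4 * e) m n)"
      by (intro finite_Lim_measure_incseq incseq_SucI bad_Suc) auto
    show "\<exists>N. \<forall>n\<ge>N. prob (bad T (4 * e) m n) \<le> 4 * real T * C\<^sup>2 / 2 ^ m" using C(2)[OF _ that] by blast
  qed
  have "prob (\<Inter>m. \<Union>n. bad T (4 * e) m n) \<le> 0"
  proof (rule LIMSEQ_le_const)
    show "(\<lambda>m. 4 * real T * C\<^sup>2 / 2 ^ m) \<longlonglongrightarrow> 0" by real_asymp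
    have "(\<lambda>m. C / 2 ^ m) \<longlonglongrightarrow> 0" by real_asymp
    then have "eventually (\<lambda>m. C / 2 ^ m < 1/2) sequentially" by (rule order_tendstoD) simp
    then obtain N where N: "\<And>m. m \<ge> N \<Longrightarrow> C / 2 ^ m < 1/2" by (auto simp: eventually_sequentially)
    have "prob (\<Inter>m. \<Union>n. bad T (4 * e) m n) \<le> 4 * real T * C\<^sup>2 / 2 ^ m" if "m \<ge> N" for m
    proof -
      have "prob (\<Inter>m. \<Union>n. bad T (4 * e) m n) \<le> prob (\<Union>n. bad T (4 * e) m n)"
        by (intro finite_measure_mono) auto
      also have "\<dots> \<le> 4 * real T * C\<^sup>2 / 2 ^ m" using N[OF that] by (intro 1) simp
      finally show ?thesis .
    qed
    then show "\<exists>N. \<forall>m\<ge>N. prob (\<Inter>m. \<Union>n. bad T (4 * e) m n) \<le> 4 * real T * C\<^sup>2 / 2 ^ m" by blast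
  qed
  then have "prob (\<Inter>m. \<Union>n. bad T (4 * e) m n) = 0" using measure_nonneg antisym by blast
  then have "AE \<omega> in M. \<omega> \<notin> (\<Inter>m. \<Union>n. bad T (4 * e) m n)"
    by (intro AE_not_in) (auto simp: null_sets_def emeasure_eq_measure)
  then show ?thesis by (rule AE_mp) auto
qed

lemma AE_regular_path: "AE \<omega> in M. regular_path (\<lambda>t. X t \<omega>)"
proof -
  have "AE \<omega> in M. \<forall>T q. \<exists>m. \<forall>n. \<omega> \<notin> bad T (4 * inverse (real (Suc q))) m n"
    unfolding AE_all_countable by (intro allI AE_not_bad) simp
  with AE_space show ?thesis
  proof eventually_elim
    fix \<omega> assume \<omega>: "\<omega> \<in> space M" and nb: "\<forall>T q. \<exists>m. \<forall>n. \<omega> \<notin> bad T (4 * inverse (real (Suc q))) m n"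
    show "regular_path (\<lambda>t. X t \<omega>)"
      unfolding regular_path_def
    proof (intro allI impI)
      fix e :: real and T :: nat assume "e > 0"
      \<comment> \<open>Countably many thresholds 4/(q+1) suffice for all e > 0, which keeps the
        exceptional set null; the factor 4 stems from \<open>double_oscillation\<close>.\<close>
      then obtain q where q: "inverse (real (Suc q)) < e / 4" using reals_Archimedean[of "e/4"] by auto
      obtain m where m: "\<And>n. \<omega> \<notin> bad T (4 * inverse (real (Suc q))) m n" using nb by blast
      have "\<not> (dist (X s \<omega>) (X t \<omega>) > e \<and> dist (X t \<omega>) (X u \<omega>) > e)"
        if i: "i < T * 2 ^ m" and D: "s \<in> dyadics" "t \<in> dyadics" "u \<in> dyadics"
          and b: "real i / 2 ^ m \<le> s" "s \<le> t" "t \<le> u" "u \<le> (real i + 1) / 2 ^ m" for i s t u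
      proof
        assume far: "dist (X s \<omega>) (X t \<omega>) > e \<and> dist (X t \<omega>) (X u \<omega>) > e"
        obtain n1 n2 n3 where n: "s \<in> dyadic n1" "t \<in> dyadic n2" "u \<in> dyadic n3"
          using D by (auto simp: dyadics_def)
        define n where "n = max n1 (max n2 n3)"
        have "s \<in> dyadic n" "t \<in> dyadic n" "u \<in> dyadic n"
          using n dyadic_mono[of n1 n] dyadic_mono[of n2 n] dyadic_mono[of n3 n] by (auto simp: n_def le_max_iff_disj)
        then obtain j k l :: nat where jkl: "s = real j / 2 ^ n" "t = real k / 2 ^ n" "u = real l / 2 ^ n"
          by (auto simp: dyadic_def)
        have "j \<le> k" "k \<le> l" using b jkl by (auto simp: divide_le_cancel)
        then have "\<omega> \<in> bad T (4 * inverse (real (Suc q))) m n"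
          unfolding bad_def using \<omega> i b far q jkl
          by (intro CollectI conjI exI[of _ i] exI[of _ j] exI[of _ k] exI[of _ l]) auto
        then show False using m by blast
      qed
      then show "\<exists>m. \<forall>i<T * 2 ^ m. \<forall>s\<in>dyadics. \<forall>t\<in>dyadics. \<forall>u\<in>dyadics. real i / 2 ^ m \<le> s \<longrightarrow> s \<le> t \<longrightarrow> t \<le> u \<longrightarrow>
        u \<le> (real i + 1) / 2 ^ m \<longrightarrow> \<not> (dist (X s \<omega>) (X t \<omega>) > e \<and> dist (X t \<omega>) (X u \<omega>) > e)"
        by blast
    qed
  qed
qed

text \<open>\<open>levy_process\<close> asks for its path properties and for Y 0 = 0 at every sample
  point, so the right-continuous extension is replaced by the zero path on two null sets. Laws and
  independence come from the dyadic increments by almost sure limits from the right.\<close>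

lemma levy_process_exists:
  "\<exists>Y. levy_process M Y \<and> (\<forall>t\<ge>0. \<forall>y. charf (distr M borel (Y t)) y = exp (of_real t * \<Phi> y))"
proof -
  obtain N where N: "{\<omega>\<in>space M. \<not> regular_path (\<lambda>t. X t \<omega>)} \<subseteq> N" "emeasure M N = 0" "N \<in> events"
    using AE_regular_path by (rule AE_E)
  have reg: "regular_path (\<lambda>t. X t \<omega>)" if "\<omega> \<in> space M" "\<omega> \<notin> N" for \<omega> using N that by auto
  define Y0 where "Y0 t \<omega> = (if \<omega> \<in> N then 0 else right_ext (\<lambda>t. X t \<omega>) t)" for t \<omega>
  have Y0_lim: "(\<lambda>n. if \<omega> \<in> N then 0 else X (real (next_dyadic n t) / 2 ^ n) \<omega>) \<longlonglongrightarrow> Y0 t \<omega>"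
    if "\<omega> \<in> space M" "t \<ge> 0" for \<omega> t
    using right_ext_tendsto_seq[OF reg[OF that(1)] that(2)] by (simp add: Y0_def)
  have Y0_meas: "Y0 t \<in> borel_measurable M" if "t \<ge> 0" for t
  proof (rule borel_measurable_LIMSEQ_metric)
    have [measurable]: "N \<in> events" by fact
    show "(\<lambda>\<omega>. if \<omega> \<in> N then 0 else X (real (next_dyadic n t) / 2 ^ n) \<omega>) \<in> borel_measurable M" for n
      by measurable
  qed (rule Y0_lim[OF _ that])
  have notN: "AE \<omega> in M. \<omega> \<notin> N" using N by (intro AE_not_in) auto
  have X_diff_charf: "charf (distr M borel (\<lambda>\<omega>. X (real j / 2 ^ n) \<omega> - X (real i / 2 ^ n) \<omega>)) y =
      exp (of_real (real j / 2 ^ n - real i / 2 ^ n) * \<Phi> y)" if "i \<le> j" for i j n y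
    using psum_incr_charf[OF that, of n y] that by (simp add: psum_incr of_nat_diff diff_divide_distrib)
  have X_charf: "charf (distr M borel (X (real j / 2 ^ n))) y = exp (of_real (real j / 2 ^ n) * \<Phi> y)" for j n y
    using X_diff_charf[of 0 j n y] by (simp add: X_0)
  have exp_lim: "(\<lambda>n. exp (of_real (f n) * \<Phi> y)) \<longlonglongrightarrow> exp (of_real c * \<Phi> y)" if "f \<longlonglongrightarrow> c" for f c y
    by (intro tendsto_intros that)
  \<comment> \<open>\<open>Y0 0\<close> is off N a limit of values at strictly positive times, so
    \<open>X_0\<close> does not determine it. Its characteristic function is the limit 1, whence its
    law is the point mass at 0.\<close>
  have "AE \<omega> in M. Y0 0 \<omega> = 0"
  proof -
    have "AE \<omega> in M. (\<lambda>n. X (real (next_dyadic n 0) / 2 ^ n) \<omega>) \<longlonglongrightarrow> Y0 0 \<omega>"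
      using notN AE_space by eventually_elim (use Y0_lim[of _ 0] in fastforce)
    then have "(\<lambda>n. charf (distr M borel (X (real (next_dyadic n 0) / 2 ^ n))) y) \<longlonglongrightarrow> charf (distr M borel (Y0 0)) y" for y
      using Y0_meas[of 0] by (intro charf_tendsto prob_M) auto
    then have "charf (distr M borel (Y0 0)) y = exp (of_real 0 * \<Phi> y)" for y
      unfolding X_charf using exp_lim[OF next_dyadic_tendsto[of 0]] LIMSEQ_unique by blast
    then have "distr M borel (Y0 0) = return borel 0"
      using Y0_meas[of 0] by (intro charf_unique borel_prob_distr prob_M)
        (auto simp: charf_return borel_prob_def prob_space_return)
    moreover have "AE x in return borel 0. x = (0::'a)" by (subst AE_return) auto
    ultimately have "AE x in distr M borel (Y0 0). x = 0" by (simp only:)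
    then show ?thesis using Y0_meas[of 0] by (subst (asm) AE_distr_iff) auto
  qed
  note start = this
  define Y where "Y t \<omega> = (if Y0 0 \<omega> = 0 then Y0 t \<omega> else 0)" for t \<omega>
  have Y_meas: "Y t \<in> borel_measurable M" if "t \<ge> 0" for t
  proof -
    note [measurable] = Y0_meas[OF that] Y0_meas[OF order_refl]
    show ?thesis unfolding Y_def by measurable
  qed
  have Y_lim: "AE \<omega> in M. (\<lambda>n. X (real (next_dyadic n t) / 2 ^ n) \<omega>) \<longlonglongrightarrow> Y t \<omega>" if "t \<ge> 0" for t
    using notN AE_space start
    by eventually_elim (use Y0_lim[OF _ that] in \<open>fastforce simp: Y_def\<close>)
  have Y_charf: "charf (distr M borel (Y t)) y = exp (of_real t * \<Phi> y)" if t: "t \<ge> 0" for t y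
  proof (rule LIMSEQ_unique)
    show "(\<lambda>n. charf (distr M borel (X (real (next_dyadic n t) / 2 ^ n))) y) \<longlonglongrightarrow> charf (distr M borel (Y t)) y"
      by (intro charf_tendsto prob_M Y_meas Y_lim t) auto
    show "(\<lambda>n. charf (distr M borel (X (real (next_dyadic n t) / 2 ^ n))) y) \<longlonglongrightarrow> exp (of_real t * \<Phi> y)"
      unfolding X_charf by (intro exp_lim next_dyadic_tendsto t)
  qed
  have Y_diff_lim: "AE \<omega> in M. (\<lambda>n. X (real (next_dyadic n t) / 2 ^ n) \<omega> - X (real (next_dyadic n s) / 2 ^ n) \<omega>) \<longlonglongrightarrow> Y t \<omega> - Y s \<omega>"
    if "s \<ge> 0" "t \<ge> 0" for s t
    using Y_lim[OF that(1)] Y_lim[OF that(2)] by eventually_elim (intro tendsto_diff)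
  have Y_diff_charf: "charf (distr M borel (\<lambda>\<omega>. Y t \<omega> - Y s \<omega>)) y = exp (of_real (t - s) * \<Phi> y)"
    if st: "0 \<le> s" "s \<le> t" for s t y
  proof (rule LIMSEQ_unique)
    have t: "0 \<le> t" using st by simp
    let ?D = "\<lambda>n \<omega>. X (real (next_dyadic n t) / 2 ^ n) \<omega> - X (real (next_dyadic n s) / 2 ^ n) \<omega>"
    show "(\<lambda>n. charf (distr M borel (?D n)) y) \<longlonglongrightarrow> charf (distr M borel (\<lambda>\<omega>. Y t \<omega> - Y s \<omega>)) y"
      using Y_meas st t by (intro charf_tendsto prob_M Y_diff_lim) auto
    show "(\<lambda>n. charf (distr M borel (?D n)) y) \<longlonglongrightarrow> exp (of_real (t - s) * \<Phi> y)"
      unfolding X_diff_charf[OF next_dyadic_mono[OF st]]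
      by (intro exp_lim tendsto_diff next_dyadic_tendsto st t)
  qed
  have path: "((\<lambda>s. Y s \<omega>) \<longlongrightarrow> Y t \<omega>) (at_right t)" "t > 0 \<Longrightarrow> \<exists>l. ((\<lambda>s. Y s \<omega>) \<longlongrightarrow> l) (at_left t)"
    if \<omega>: "\<omega> \<in> space M" and t: "t \<ge> 0" for \<omega> t
  proof -
    show "((\<lambda>s. Y s \<omega>) \<longlongrightarrow> Y t \<omega>) (at_right t)"
      using right_ext_right_continuous[OF reg[OF \<omega>] t] by (auto simp: Y_def Y0_def)
    assume "t > 0"
    then show "\<exists>l. ((\<lambda>s. Y s \<omega>) \<longlongrightarrow> l) (at_left t)"
      using right_ext_left_limit[OF reg[OF \<omega>]] by (cases "Y0 0 \<omega> = 0"; cases "\<omega> \<in> N") (auto simp: Y_def Y0_def)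
  qed
  have ind: "indep_vars (\<lambda>_. borel) (\<lambda>i \<omega>. Y (t (Suc i)) \<omega> - Y (t i) \<omega>) {..<n}"
    if t: "0 \<le> t 0" "\<forall>i<n. t i \<le> t (Suc i)" for n and t :: "nat \<Rightarrow> real"
  \<comment> \<open>\<open>indep_vars_limit\<close> is stated for nonempty index sets.\<close>
  proof (cases "n = 0")
    case True
    then show ?thesis by (simp add: indep_vars_def indep_sets_def)
  next
    case False
    have tpos: "0 \<le> t i" if "i \<le> n" for i
      using that
    proof (induction i)
      case (Suc i)
      then have "0 \<le> t i" "t i \<le> t (Suc i)" using t(2) by auto
      then show ?case by linarith
    qed (use t in simp)
    show ?thesis
    proof (rule indep_vars_limit)
      fix N
      let ?q = "\<lambda>i. next_dyadic N (t i)"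
      have q: "?q i \<le> ?q (Suc i)" if "i < n" for i using tpos[of i] t(2) that by (intro next_dyadic_mono) auto
      have "indep_vars (\<lambda>_. borel) (\<lambda>i \<omega>. psum (\<lambda>l. incr N l \<omega>) (?q i) (?q (Suc i))) {..<n}"
        by (rule indep_vars_psum_blocks[where K="?q n", OF incr_indep q order_refl])
      then show "indep_vars (\<lambda>_. borel) (\<lambda>i \<omega>. X (real (?q (Suc i)) / 2 ^ N) \<omega> - X (real (?q i) / 2 ^ N) \<omega>) {..<n}"
        by (rule iffD1[OF indep_vars_cong, rotated -1]) (auto simp: fun_eq_iff psum_incr q)
    next
      fix i assume "i \<in> {..<n}"
      then have "0 \<le> t i" "0 \<le> t (Suc i)" using tpos by auto
      then show "AE \<omega> in M. (\<lambda>N. X (real (next_dyadic N (t (Suc i))) / 2 ^ N) \<omega> - X (real (next_dyadic N (t i)) / 2 ^ N) \<omega>) \<longlonglongrightarrow> Y (t (Suc i)) \<omega> - Y (t i) \<omega>"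
        and "(\<lambda>\<omega>. Y (t (Suc i)) \<omega> - Y (t i) \<omega>) \<in> borel_measurable M"
        using Y_meas by (auto intro!: Y_diff_lim)
    qed (use False in auto)
  qed
  have stat: "distr M borel (\<lambda>\<omega>. Y (s + t) \<omega> - Y s \<omega>) = distr M borel (Y t)" if "s \<ge> 0" "t \<ge> 0" for s t
  proof (rule charf_unique)
    show "charf (distr M borel (\<lambda>\<omega>. Y (s + t) \<omega> - Y s \<omega>)) y = charf (distr M borel (Y t)) y" for y
      using Y_diff_charf[of s "s + t"] Y_charf that by simp
  qed (use that Y_meas in \<open>auto intro!: borel_prob_distr prob_M\<close>)
  have "levy_process M Y"
    unfolding levy_process_def
    using prob_M Y_meas ind stat path by (auto simp: Y_def)
  then show ?thesis using Y_charf by blast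
qed

end

text \<open>The projective limit is a measure on functions from \<open>real\<close> to
  \<open>'a\<close>, which is exactly the sample space type over which \<open>J_map\<close>
  quantifies.\<close>

lemma levy_process_exponent_exists:
  fixes \<nu> :: "'a::euclidean_space measure"
  assumes \<nu>: "has_exponent \<nu> \<Phi>"
    and root: "\<And>n::nat. n \<ge> 1 \<Longrightarrow> \<exists>\<rho>. has_exponent \<rho> (\<lambda>y. \<Phi> y / of_nat n)"
  obtains M :: "(real \<Rightarrow> 'a) measure" and Y
  where "levy_process M Y" "\<And>t y. t \<ge> 0 \<Longrightarrow> charf (distr M borel (Y t)) y = exp (of_real t * \<Phi> y)"
proof -
  have "\<exists>\<rho>. has_exponent \<rho> (\<lambda>y. \<Phi> y / 2 ^ n)" for n
    using root[of "2 ^ n"] by simp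
  then obtain \<rho> where \<rho>: "\<And>n. has_exponent (\<rho> n) (\<lambda>y. \<Phi> y / 2 ^ n)" by metis
  interpret R: dyadic_roots \<rho>
  proof
    show "borel_prob (\<rho> n)" for n using \<rho> by (simp add: has_exponent_def)
    show "charf (\<rho> (Suc n)) y ^ 2 = charf (\<rho> n) y" for n y
      using \<rho>[of n] \<rho>[of "Suc n"] by (simp add: has_exponent_def flip: exp_double)
  qed
  interpret dyadic_process R.lim R.X \<Phi>
  proof (rule dyadic_process.intro)
    show "prob_space R.lim" by (rule R.P.prob_space_axioms)
    show "continuous_on UNIV \<Phi>" using \<nu> by (simp add: has_exponent_def)
    show "charf (distr R.lim borel (\<lambda>\<omega>. R.X (real (Suc i) / 2 ^ n) \<omega> - R.X (real i / 2 ^ n) \<omega>)) y = exp (\<Phi> y / 2 ^ n)" for n i y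
      unfolding R.X_increments(2) using \<rho> by (simp add: has_exponent_def)
    show "R.X 0 \<omega> = 0" for \<omega> by (simp add: R.X_def)
  qed (rule R.X_measurable R.X_increments(1) has_exponent_Re_le_0[OF \<nu>])+
  show ?thesis using levy_process_exists that by blast
qed

section \<open>The law of the random integral\<close>

lemma levy_processD:
  assumes "levy_process M Y"
  shows "prob_space M" "\<And>t. t \<ge> 0 \<Longrightarrow> Y t \<in> borel_measurable M" "\<And>\<omega>. \<omega> \<in> space M \<Longrightarrow> Y 0 \<omega> = 0"
    "\<And>n (t::nat \<Rightarrow> real). 0 \<le> t 0 \<Longrightarrow> (\<And>i. i < n \<Longrightarrow> t i \<le> t (Suc i)) \<Longrightarrow>
        prob_space.indep_vars M (\<lambda>_. borel) (\<lambda>i \<omega>. Y (t (Suc i)) \<omega> - Y (t i) \<omega>) {..<n}"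
    "\<And>s t. s \<ge> 0 \<Longrightarrow> t \<ge> 0 \<Longrightarrow> distr M borel (\<lambda>\<omega>. Y (s + t) \<omega> - Y s \<omega>) = distr M borel (Y t)"
    "\<And>\<omega> t. \<omega> \<in> space M \<Longrightarrow> t \<ge> 0 \<Longrightarrow> ((\<lambda>s. Y s \<omega>) \<longlongrightarrow> Y t \<omega>) (at_right t)"
    "\<And>\<omega> t. \<omega> \<in> space M \<Longrightarrow> t > 0 \<Longrightarrow> \<exists>l. ((\<lambda>s. Y s \<omega>) \<longlongrightarrow> l) (at_left t)"
  using assms unfolding levy_process_def by blast+

lemma levy_process_charf_add:
  assumes L: "levy_process M Y" and st: "s \<ge> 0" "t \<ge> 0"
  shows "charf (distr M borel (Y (s + t))) y = charf (distr M borel (Y s)) y * charf (distr M borel (Y t)) y"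
proof -
  note L' = levy_processD[OF L]
  define u :: "nat \<Rightarrow> real" where "u i = (if i = 0 then 0 else if i = 1 then s else s + t)" for i
  have ind: "prob_space.indep_vars M (\<lambda>_. borel) (\<lambda>i \<omega>. Y (u (Suc i)) \<omega> - Y (u i) \<omega>) {..<2}"
    using st by (intro L'(4)) (auto simp: u_def)
  have set2: "{..<2::nat} = {0, 1}" by auto
  have "charf (distr M borel (Y (s + t))) y = charf (distr M borel (\<lambda>\<omega>. \<Sum>i<2. Y (u (Suc i)) \<omega> - Y (u i) \<omega>)) y"
    using L'(3) by (intro arg_cong2[where f=charf] distr_cong refl) (simp add: set2 u_def)
  also have "\<dots> = (\<Prod>i<2. charf (distr M borel (\<lambda>\<omega>. Y (u (Suc i)) \<omega> - Y (u i) \<omega>)) y)"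
    by (intro charf_sum_indep L'(1) ind) auto
  also have "\<dots> = charf (distr M borel (\<lambda>\<omega>. Y (0 + s) \<omega> - Y 0 \<omega>)) y * charf (distr M borel (\<lambda>\<omega>. Y (s + t) \<omega> - Y s \<omega>)) y"
    by (simp add: set2 u_def)
  also have "\<dots> = charf (distr M borel (Y s)) y * charf (distr M borel (Y t)) y"
    using st by (simp only: L'(5))
  finally show ?thesis .
qed

text \<open>Here the process is arbitrary, so the branch of the root has to be found: at time 2^-n
  the characteristic function is a continuous 2^n-th root of exp \<Phi> with value 1 at the origin,
  hence exp(\<Phi>/2^n). Powers give all dyadic times and right continuity the remaining
  ones.\<close>

lemma levy_process_charf:
  assumes L: "levy_process M Y" and \<Phi>: "has_exponent (distr M borel (Y 1)) \<Phi>" and t: "t \<ge> 0"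
  shows "charf (distr M borel (Y t)) y = exp (of_real t * \<Phi> y)"
proof -
  note L' = levy_processD[OF L]
  have bp: "borel_prob (distr M borel (Y t))" if "t \<ge> 0" for t
    using that by (intro borel_prob_distr L')
  have Y0: "charf (distr M borel (Y 0)) y = 1" for y
  proof -
    interpret prob_space M by (rule L')
    have "charf (distr M borel (Y 0)) y = (CLINT \<omega>|M. 1)"
      unfolding charf_distr[OF L'(2)[OF order_refl]] using L'(3) by (intro Bochner_Integration.integral_cong) auto
    then show ?thesis by (simp add: prob_space)
  qed
  have pow: "charf (distr M borel (Y (real k * u))) y = charf (distr M borel (Y u)) y ^ k" if "u \<ge> 0" for k u y
  proof (induction k)
    case (Suc k)
    have "real (Suc k) * u = real k * u + u" by (simp add: algebra_simps)
    then show ?case using levy_process_charf_add[OF L, of "real k * u" u y] Suc that by simp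
  qed (use Y0 in simp)
  have dy: "charf (distr M borel (Y (real k / 2 ^ n))) y = exp (of_real (real k / 2 ^ n) * \<Phi> y)" for k n y
  proof -
    have "charf (distr M borel (Y (1 / 2 ^ n))) y = exp (\<Phi> y / of_nat (2 ^ n))" for y
    proof (rule power_root_eq_exp[where S=UNIV and f="charf (distr M borel (Y (1 / 2 ^ n)))" and \<Phi>=\<Phi> and n="2 ^ n" and y=y])
      show "charf (distr M borel (Y (1 / 2 ^ n))) y ^ 2 ^ n = exp (\<Phi> y)" for y
        using pow[of "1 / 2 ^ n" "2 ^ n" y] \<Phi> by (simp add: has_exponent_def)
    qed (use \<Phi> in \<open>auto simp: has_exponent_def intro!: charf_continuous charf_0 bp convex_connected[OF convex_UNIV]\<close>)
    then have "charf (distr M borel (Y (real k * (1 / 2 ^ n)))) y = exp (\<Phi> y / of_nat (2 ^ n)) ^ k"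
      using pow[of "1 / 2 ^ n" k y] by simp
    then show ?thesis by (simp flip: exp_of_nat_mult)
  qed
  show ?thesis
  proof (rule LIMSEQ_unique)
    show "(\<lambda>n. charf (distr M borel (Y (real (next_dyadic n t) / 2 ^ n))) y) \<longlonglongrightarrow> charf (distr M borel (Y t)) y"
    proof (intro charf_tendsto L' t AE_I2)
      fix \<omega> assume \<omega>: "\<omega> \<in> space M"
      have "filterlim (\<lambda>n. real (next_dyadic n t) / 2 ^ n) (at_right t) sequentially"
        unfolding filterlim_at using next_dyadic_tendsto[OF t] next_dyadic_bounds(1)[OF t]
        by (auto intro!: always_eventually simp: order_less_imp_not_eq2)
      then show "(\<lambda>n. Y (real (next_dyadic n t) / 2 ^ n) \<omega>) \<longlonglongrightarrow> Y t \<omega>"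
        by (rule filterlim_compose[OF L'(6)[OF \<omega> t]])
    qed simp
    show "(\<lambda>n. charf (distr M borel (Y (real (next_dyadic n t) / 2 ^ n))) y) \<longlonglongrightarrow> exp (of_real t * \<Phi> y)"
      unfolding dy by (intro tendsto_intros next_dyadic_tendsto t)
  qed
qed

text \<open>The index \<open>i\<close> with \<open>i / n < t \<le> (i + 1) / n\<close>.\<close>

definition cell :: "nat \<Rightarrow> real \<Rightarrow> nat" where
  "cell n t = nat \<lceil>real n * t\<rceil> - 1"

lemma cell_bounds:
  assumes "n \<ge> 1" "0 < t" "t \<le> 1"
  shows "cell n t < n" "real (cell n t) / real n < t" "t \<le> (real (cell n t) + 1) / real n"
proof -
  have "0 < real n * t" using assms by simp
  then have pos: "\<lceil>real n * t\<rceil> \<ge> 1" by linarith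
  then have "1 \<le> nat \<lceil>real n * t\<rceil>" "real (nat \<lceil>real n * t\<rceil>) = of_int \<lceil>real n * t\<rceil>" by linarith+
  then have c: "real (cell n t) = of_int \<lceil>real n * t\<rceil> - 1" unfolding cell_def by (subst of_nat_diff) auto
  have "real n * t \<le> real n" using assms by (simp add: mult_left_le)
  then have "\<lceil>real n * t\<rceil> \<le> int n" by (simp add: ceiling_le_iff)
  then show "cell n t < n" using pos by (simp add: cell_def) linarith
  show "real (cell n t) / real n < t" "t \<le> (real (cell n t) + 1) / real n"
    using assms unfolding c by (simp_all add: field_simps) linarith+
qed

lemma cell_unique:
  assumes "n \<ge> 1" "real i / real n < t" "t \<le> (real i + 1) / real n"
  shows "cell n t = i"
proof -
  have "real i < real n * t" "real n * t \<le> real i + 1" using assms by (simp_all add: field_simps)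
  then have "\<lceil>real n * t\<rceil> = int i + 1" by (intro ceiling_unique) auto
  then show ?thesis by (simp add: cell_def)
qed

text \<open>Cells are open on the left, so their left ends approach t strictly from below and path
  values taken there converge to the left limit at t.\<close>

lemma cell_left_tendsto:
  assumes "0 < t" "t \<le> 1"
  shows "filterlim (\<lambda>n. real (cell n t) / real n) (at_left t) sequentially"
    and "(\<lambda>n. (real (cell n t) + 1) / real n) \<longlonglongrightarrow> t"
proof -
  note b = cell_bounds[OF _ assms]
  have inv: "(\<lambda>n. 1 / real n) \<longlonglongrightarrow> 0" by (rule lim_1_over_n)
  have 1: "(\<lambda>n. real (cell n t) / real n) \<longlonglongrightarrow> t"
  proof (rule tendsto_sandwich[where f="\<lambda>n. t - 1 / real n" and h="\<lambda>n. t"])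
    show "(\<lambda>n. t - 1 / real n) \<longlonglongrightarrow> t" using tendsto_diff[OF tendsto_const[of t] inv] by simp
    show "\<forall>\<^sub>F n in sequentially. t - 1 / real n \<le> real (cell n t) / real n"
      using eventually_ge_at_top[of 1] by eventually_elim (use b(3) in \<open>simp add: add_divide_distrib algebra_simps\<close>)
    show "\<forall>\<^sub>F n in sequentially. real (cell n t) / real n \<le> t"
      using eventually_ge_at_top[of 1] by eventually_elim (use b(2) in \<open>simp add: less_imp_le\<close>)
  qed simp
  then show "filterlim (\<lambda>n. real (cell n t) / real n) (at_left t) sequentially"
  proof -
    have "\<forall>\<^sub>F n in sequentially. real (cell n t) / real n < t"
      using eventually_ge_at_top[of 1] by eventually_elim (rule b(2))
    then show ?thesis using 1 unfolding filterlim_at by (auto elim: eventually_mono)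
  qed
  show "(\<lambda>n. (real (cell n t) + 1) / real n) \<longlonglongrightarrow> t"
    using tendsto_add[OF 1 inv] by (simp add: add_divide_distrib)
qed

text \<open>The sums are integrals of step functions equal to \<open>p n i\<close> on the i-th cell,
  and bounded convergence on (0,1] applies because \<open>interval_measure H\<close> is finite
  there. With a free choice of \<open>p\<close> this covers left-end values of paths as well as
  ordinary Riemann sums with right-end values.\<close>

lemma stieltjes_sum_tendsto:
  fixes p :: "nat \<Rightarrow> nat \<Rightarrow> 'a::euclidean_space"
  assumes H: "mono H" "continuous_on UNIV H"
    and B: "\<And>n i. i < n \<Longrightarrow> norm (p n i) \<le> B"
    and lim: "\<And>t. 0 < t \<Longrightarrow> t \<le> 1 \<Longrightarrow> (\<lambda>n. p n (cell n t)) \<longlonglongrightarrow> g t"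
  shows "(\<lambda>n. \<Sum>i<n. (H (real (Suc i) / real n) - H (real i / real n)) *\<^sub>R p n i) \<longlonglongrightarrow> (LINT t:{0<..1}|interval_measure H. g t)"
    and "set_integrable (interval_measure H) {0<..1} g"
proof -
  let ?\<mu> = "interval_measure H"
  have mono: "x \<le> y \<Longrightarrow> H x \<le> H y" for x y using H(1) by (rule monoD)
  have cont: "continuous (at_right a) H" for a
    using H(2) by (simp add: continuous_on_eq_continuous_at continuous_at_imp_continuous_at_within)
  have em: "emeasure ?\<mu> {a<..b} = ennreal (H b - H a)" if "a \<le> b" for a b
    by (rule emeasure_interval_measure_Ioc[OF that mono cont])
  have ms: "measure ?\<mu> {a<..b} = H b - H a" if "a \<le> b" for a b
    using em[OF that] mono[OF that] by (simp add: measure_def)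
  have ind: "integrable ?\<mu> (\<lambda>t. indicator {a<..b} t *\<^sub>R (c::'c::euclidean_space))" if "a \<le> b" for a b c
    using em[OF that] by (intro integrable_scaleR_left integrable_real_indicator) auto
  define s where "s n t = (\<Sum>i<n. indicator {real i / real n<..real (Suc i) / real n} t *\<^sub>R p n i)" for n t
  have sint: "integrable ?\<mu> (s n)" for n
    unfolding s_def by (intro Bochner_Integration.integrable_sum ind) (auto intro: divide_right_mono)
  have sval: "(LINT t|?\<mu>. s n t) = (\<Sum>i<n. (H (real (Suc i) / real n) - H (real i / real n)) *\<^sub>R p n i)" for n
  proof -
    have le: "real i / real n \<le> real (Suc i) / real n" for i by (auto intro: divide_right_mono)
    have "(LINT t|?\<mu>. s n t) = (\<Sum>i<n. LINT t|?\<mu>. indicator {real i / real n<..real (Suc i) / real n} t *\<^sub>R p n i)"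
      unfolding s_def by (intro Bochner_Integration.integral_sum ind le)
    also have "\<dots> = (\<Sum>i<n. measure ?\<mu> {real i / real n<..real (Suc i) / real n} *\<^sub>R p n i)"
      using em[OF le] by (intro sum.cong refl) (subst integral_scaleR_left, auto)
    finally show ?thesis by (simp only: ms[OF le])
  qed
  have s_in: "s n t = p n (cell n t)" if "n \<ge> 1" "0 < t" "t \<le> 1" for n t
  proof -
    note b = cell_bounds[OF that]
    have "s n t = (\<Sum>i\<in>{cell n t}. indicator {real i / real n<..real (Suc i) / real n} t *\<^sub>R p n i)"
      unfolding s_def
    proof (rule sum.mono_neutral_right)
      show "\<forall>i\<in>{..<n} - {cell n t}. indicator {real i / real n<..real (Suc i) / real n} t *\<^sub>R p n i = 0"
      proof
        fix i assume "i \<in> {..<n} - {cell n t}"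
        then have "t \<notin> {real i / real n<..real (Suc i) / real n}"
          using cell_unique[OF that(1), of i t] by (auto simp: add.commute)
        then show "indicator {real i / real n<..real (Suc i) / real n} t *\<^sub>R p n i = 0" by simp
      qed
    qed (use b in auto)
    then have "s n t = indicator {real (cell n t) / real n<..real (Suc (cell n t)) / real n} t *\<^sub>R p n (cell n t)"
      by (simp only: sum.insert sum.empty finite.emptyI empty_iff add_0_right not_False_eq_True)
    then show ?thesis using b by (simp add: add.commute)
  qed
  have s_out: "s n t = 0" if "\<not> (0 < t \<and> t \<le> 1)" for n t
    unfolding s_def
  proof (intro sum.neutral ballI)
    fix i assume "i \<in> {..<n}"
    then have "real (Suc i) / real n \<le> 1" "0 \<le> real i / real n" by (auto simp: divide_simps)
    then have "t \<notin> {real i / real n<..real (Suc i) / real n}"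
      using that unfolding greaterThanAtMost_iff by linarith
    then show "indicator {real i / real n<..real (Suc i) / real n} t *\<^sub>R p n i = 0" by simp
  qed
  define G where "G t = indicator {0<..1} t *\<^sub>R g t" for t
  have sG: "(\<lambda>n. s n t) \<longlonglongrightarrow> G t" for t
  proof (cases "0 < t \<and> t \<le> 1")
    case True
    have "eventually (\<lambda>n. p n (cell n t) = s n t) sequentially"
      using eventually_ge_at_top[of 1] by eventually_elim (use True s_in in auto)
    then have "(\<lambda>n. s n t) \<longlonglongrightarrow> g t"
      using lim True by (blast intro: Lim_transform_eventually)
    then show ?thesis using True by (simp add: G_def)
  next
    case False
    then show ?thesis using s_out[OF False] by (auto simp: G_def indicator_def)
  qed
  have bound: "norm (s n t) \<le> indicator {0<..1} t * B" for n t
  proof (cases "0 < t \<and> t \<le> 1")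
    case True
    show ?thesis
    proof (cases "n \<ge> 1")
      case n: True
      then show ?thesis using True s_in[OF n] B[OF cell_bounds(1)[OF n]] by simp
    next
      case False
      then have "s n t = 0" by (simp add: s_def)
      moreover have "0 \<le> B" using order_trans[OF norm_ge_zero B[of 0 1]] by simp
      ultimately show ?thesis by simp
    qed
  next
    case False
    then show ?thesis using s_out[OF False] by (auto simp: indicator_def)
  qed
  have Gm: "G \<in> borel_measurable ?\<mu>"
    by (rule borel_measurable_LIMSEQ_metric[OF borel_measurable_integrable[OF sint] sG])
  have w: "integrable ?\<mu> (\<lambda>t. indicator {0<..1} t * B)"
    using ind[of 0 1 B] by simp
  have "(\<lambda>n. LINT t|?\<mu>. s n t) \<longlonglongrightarrow> (LINT t|?\<mu>. G t)"
    by (rule integral_dominated_convergence[OF Gm borel_measurable_integrable[OF sint] w AE_I2[OF sG] AE_I2[OF bound]])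
  then show "(\<lambda>n. \<Sum>i<n. (H (real (Suc i) / real n) - H (real i / real n)) *\<^sub>R p n i) \<longlonglongrightarrow> (LINT t:{0<..1}|?\<mu>. g t)"
    unfolding sval G_def set_lebesgue_integral_def .
  have "integrable ?\<mu> G"
    by (rule integrable_dominated_convergence[OF Gm borel_measurable_integrable[OF sint] w AE_I2[OF sG] AE_I2[OF bound]])
  then show "set_integrable ?\<mu> {0<..1} g" unfolding set_integrable_def G_def .
qed

lemma riemann_sum_tendsto:
  fixes F :: "real \<Rightarrow> 'a::euclidean_space"
  assumes F: "continuous_on {0..1} F"
  shows "(\<lambda>n. \<Sum>i<n. (1 / real n) *\<^sub>R F (real (Suc i) / real n)) \<longlonglongrightarrow> integral {0..1} F"
proof -
  have "bounded (F ` {0..1})" using F by (intro compact_imp_bounded compact_continuous_image) auto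
  then obtain B where "\<forall>x\<in>F ` {0..1}. norm x \<le> B" unfolding bounded_iff by blast
  then have B: "\<And>t. 0 \<le> t \<Longrightarrow> t \<le> 1 \<Longrightarrow> norm (F t) \<le> B" by auto
  have lim: "(\<lambda>n. F (real (Suc (cell n t)) / real n)) \<longlonglongrightarrow> F t" if "0 < t" "t \<le> 1" for t
  proof (rule continuous_on_tendsto_compose[OF F])
    show "(\<lambda>n. real (Suc (cell n t)) / real n) \<longlonglongrightarrow> t"
      using cell_left_tendsto(2)[OF that] by (simp add: add.commute)
    show "\<forall>\<^sub>F n in sequentially. real (Suc (cell n t)) / real n \<in> {0..1}"
      using eventually_ge_at_top[of 1]
    proof eventually_elim
      case (elim n)
      then show ?case using cell_bounds(1)[OF elim that] by (auto simp: divide_simps)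
    qed
  qed (use that in auto)
  have B': "norm (F (real (Suc i) / real n)) \<le> B" if "i < n" for n i
    using that by (intro B) (auto simp: divide_simps)
  note S = stieltjes_sum_tendsto[where H="\<lambda>t. t" and p="\<lambda>n i. F (real (Suc i) / real n)" and g=F, OF _ _ B' lim]
  have lb: "interval_measure (\<lambda>t. t) = lborel" by (rule lborel_eq_real[symmetric])
  have int: "set_integrable lborel {0<..1} F" using S(2) by (simp add: mono_def lb)
  have "(LINT t:{0<..1}|lborel. F t) = integral {0<..1} F"
    by (rule set_borel_integral_eq_integral(2)[OF int])
  also have "\<dots> = integral {0..1} F"
    by (rule integral_subset_negligible) (auto intro: negligible_subset[of "{0}"])
  finally have eq: "(LINT t:{0<..1}|lborel. F t) = integral {0..1} F" .
  have "(\<lambda>n. \<Sum>i<n. (real (Suc i) / real n - real i / real n) *\<^sub>R F (real (Suc i) / real n)) \<longlonglongrightarrow> integral {0..1} F"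
    using S(1) by (simp add: mono_def lb eq)
  then show ?thesis by (simp add: diff_divide_distrib[symmetric])
qed

text \<open>One-sided limits bound the function near each point, and compactness of [0,1] leaves
  finitely many of these local bounds.\<close>

lemma cadlag_bounded:
  fixes f :: "real \<Rightarrow> 'a::real_normed_vector"
  assumes R: "\<And>t. t \<ge> 0 \<Longrightarrow> (f \<longlongrightarrow> f t) (at_right t)"
    and L: "\<And>t. t > 0 \<Longrightarrow> \<exists>l. (f \<longlongrightarrow> l) (at_left t)"
  obtains B where "\<And>t. 0 \<le> t \<Longrightarrow> t \<le> 1 \<Longrightarrow> norm (f t) \<le> B"
proof -
  have loc: "\<exists>d>0. \<exists>B. \<forall>s. s \<ge> 0 \<longrightarrow> \<bar>s - t\<bar> < d \<longrightarrow> norm (f s) \<le> B" if t: "t \<ge> 0" for t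
  proof -
    have "eventually (\<lambda>s. dist (f s) (f t) < 1) (at_right t)" using R[OF t] by (rule tendstoD) simp
    then obtain b where b: "b > t" "\<And>s. t < s \<Longrightarrow> s < b \<Longrightarrow> dist (f s) (f t) < 1"
      unfolding eventually_at_right_field by auto
    have near: "norm (f s) \<le> norm z + 1" if "dist (f s) z < 1" for s z
      using that norm_triangle_ineq2[of "f s" z] by (simp add: dist_norm)
    have "\<exists>a<t. \<exists>B. \<forall>s. s \<ge> 0 \<longrightarrow> a < s \<longrightarrow> s < t \<longrightarrow> norm (f s) \<le> B"
    proof (cases "t = 0")
      case True
      \<comment> \<open>At t = 0 there is no left limit, but no s \<ge> 0 lies to the left either;
        any negative witness works.\<close>
      then show ?thesis by (intro exI[of _ "-1"]) auto
    next
      case False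
      then obtain l where "(f \<longlongrightarrow> l) (at_left t)" using L t by force
      then have "eventually (\<lambda>s. dist (f s) l < 1) (at_left t)" by (rule tendstoD) simp
      then obtain a where "a < t" "\<And>s. a < s \<Longrightarrow> s < t \<Longrightarrow> dist (f s) l < 1"
        unfolding eventually_at_left_field by auto
      then show ?thesis using near by blast
    qed
    then obtain a B where a: "a < t" "\<And>s. s \<ge> 0 \<Longrightarrow> a < s \<Longrightarrow> s < t \<Longrightarrow> norm (f s) \<le> B" by blast
    have "norm (f s) \<le> max B (norm (f t) + 1)" if "s \<ge> 0" "\<bar>s - t\<bar> < min (t - a) (b - t)" for s
    proof -
      consider "s < t" | "s = t" | "s > t" by linarith
      then show ?thesis
      proof cases
        case 1
        then show ?thesis using a(2)[of s] that by (auto simp: le_max_iff_disj)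
      next
        case 3
        then show ?thesis using near[OF b(2)[of s]] that by (auto simp: le_max_iff_disj)
      qed (auto simp: le_max_iff_disj)
    qed
    then show ?thesis using a(1) b(1) by (intro exI[of _ "min (t - a) (b - t)"]) auto
  qed
  then obtain d B where dB: "\<And>t. t \<ge> 0 \<Longrightarrow> d t > 0" "\<And>t s. t \<ge> 0 \<Longrightarrow> s \<ge> 0 \<Longrightarrow> \<bar>s - t\<bar> < d t \<Longrightarrow> norm (f s) \<le> B t"
    by metis
  have "compact {0..1::real}" by simp
  then obtain C where C: "C \<subseteq> {0..1}" "finite C" "{0..1} \<subseteq> (\<Union>t\<in>C. ball t (d t))"
    by (rule compactE_image[of _ "{0..1}" "\<lambda>t. ball t (d t)"]) (use dB(1) in force)+
  have "norm (f s) \<le> Max (B ` C)" if s: "0 \<le> s" "s \<le> 1" for s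
  proof -
    obtain t where t: "t \<in> C" "s \<in> ball t (d t)" using C(3) s by auto
    then have "norm (f s) \<le> B t" using C(1) s by (intro dB(2)) (auto simp: dist_real_def)
    also have "\<dots> \<le> Max (B ` C)" using t C(2) by (intro Max_ge) auto
    finally show ?thesis .
  qed
  then show ?thesis using that by blast
qed

lemma summation_by_parts:
  fixes a :: "nat \<Rightarrow> 'a::real_vector"
  shows "(\<Sum>i<n. b (Suc i) *\<^sub>R (a (Suc i) - a i)) = b n *\<^sub>R a n - b 0 *\<^sub>R a 0 - (\<Sum>i<n. (b (Suc i) - b i) *\<^sub>R a i)"
  by (induction n) (auto simp: algebra_simps)

text \<open>Summation by parts moves the differences from Y to h: weights h at right ends of cells
  become values of Y at left ends. In the limit these are the left limits in the definition of
  \<open>random_integral\<close>.\<close>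

lemma random_integral_tendsto:
  assumes L: "levy_process M Y" and \<omega>: "\<omega> \<in> space M"
    and h: "continuous_on {0..1} h" "mono_on {0..1} h"
  shows "(\<lambda>n. \<Sum>i<n. h (real (Suc i) / real n) *\<^sub>R (Y (real (Suc i) / real n) \<omega> - Y (real i / real n) \<omega>))
     \<longlonglongrightarrow> random_integral h (\<lambda>t. t) Y \<omega>"
proof -
  note L' = levy_processD[OF L]
  define f where "f = (\<lambda>s. Y s \<omega>)"
  define H where "H t = h (max 0 (min 1 t))" for t
  have H01: "H t = h t" if "0 \<le> t" "t \<le> 1" for t using that by (simp add: H_def)
  have H: "mono H" "continuous_on UNIV H"
  proof -
    show "mono H" unfolding mono_def H_def by (intro allI impI mono_onD[OF h(2)]) auto
    show "continuous_on UNIV H" unfolding H_def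
      by (rule continuous_on_compose2[OF h(1)]) (auto intro!: continuous_intros)
  qed
  have fl: "\<exists>l. (f \<longlongrightarrow> l) (at_left t)" if "t > 0" for t using L'(7)[OF \<omega> that] by (simp add: f_def)
  obtain B where B: "\<And>t. 0 \<le> t \<Longrightarrow> t \<le> 1 \<Longrightarrow> norm (f t) \<le> B"
    using cadlag_bounded[of f] L'(6)[OF \<omega>] fl by (auto simp: f_def)
  have "(\<lambda>n. \<Sum>i<n. (H (real (Suc i) / real n) - H (real i / real n)) *\<^sub>R f (real i / real n))
      \<longlonglongrightarrow> (LINT t:{0<..1}|interval_measure H. left_lim f t)"
  proof (rule stieltjes_sum_tendsto(1)[OF H])
    show "norm (f (real i / real n)) \<le> B" if "i < n" for i n
      using that by (intro B) (auto simp: divide_simps)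
    fix t :: real assume t: "0 < t" "t \<le> 1"
    obtain l where l: "(f \<longlongrightarrow> l) (at_left t)" using fl t by blast
    then have "left_lim f t = l"
      using t by (simp add: left_lim_def tendsto_Lim[OF trivial_limit_at_left_real])
    then show "(\<lambda>n. f (real (cell n t) / real n)) \<longlonglongrightarrow> left_lim f t"
      using filterlim_compose[OF l cell_left_tendsto(1)[OF t]] by simp
  qed
  then have lim: "(\<lambda>n. \<Sum>i<n. (H (real (Suc i) / real n) - H (real i / real n)) *\<^sub>R f (real i / real n))
      \<longlonglongrightarrow> stieltjes_integral (left_lim f) h"
    unfolding stieltjes_integral_def H_def .
  have ri: "random_integral h (\<lambda>t. t) Y \<omega> = h 1 *\<^sub>R f 1 - h 0 *\<^sub>R f 0 - stieltjes_integral (left_lim f) h"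
    unfolding random_integral_def f_def ..
  have "(\<lambda>n. h 1 *\<^sub>R f 1 - h 0 *\<^sub>R f 0 - (\<Sum>i<n. (H (real (Suc i) / real n) - H (real i / real n)) *\<^sub>R f (real i / real n)))
      \<longlonglongrightarrow> random_integral h (\<lambda>t. t) Y \<omega>"
    unfolding ri by (intro tendsto_diff tendsto_const lim)
  moreover have "eventually (\<lambda>n. h 1 *\<^sub>R f 1 - h 0 *\<^sub>R f 0 - (\<Sum>i<n. (H (real (Suc i) / real n) - H (real i / real n)) *\<^sub>R f (real i / real n))
      = (\<Sum>i<n. h (real (Suc i) / real n) *\<^sub>R (f (real (Suc i) / real n) - f (real i / real n)))) sequentially"
    using eventually_ge_at_top[of 1]
  proof eventually_elim
    case (elim n)
    have "(\<Sum>i<n. h (real (Suc i) / real n) *\<^sub>R (f (real (Suc i) / real n) - f (real i / real n)))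
      = (\<Sum>i<n. H (real (Suc i) / real n) *\<^sub>R (f (real (Suc i) / real n) - f (real i / real n)))"
      by (intro sum.cong refl arg_cong2[where f=scaleR] H01[symmetric]) (auto simp: divide_simps)
    also have "\<dots> = H (real n / real n) *\<^sub>R f (real n / real n) - H (real 0 / real n) *\<^sub>R f (real 0 / real n)
       - (\<Sum>i<n. (H (real (Suc i) / real n) - H (real i / real n)) *\<^sub>R f (real i / real n))"
      by (rule summation_by_parts)
    finally show ?case using elim by (simp add: H01)
  qed
  ultimately show ?thesis
    unfolding f_def by (rule Lim_transform_eventually)
qed

text \<open>An increment over time 1/n has exponent \<Phi>/n, and a factor h moves into the argument
  of the characteristic function. By independence the exponent of the n-th sum is a Riemann sum of
  \<Phi>(h(t) y).\<close>

lemma random_integral_charf: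
  fixes Y :: "real \<Rightarrow> 'w \<Rightarrow> 'a::euclidean_space"
  assumes L: "levy_process M Y" and \<Phi>: "has_exponent (distr M borel (Y 1)) \<Phi>"
    and h: "continuous_on {0..1} h" "mono_on {0..1} h"
  shows "random_integral h (\<lambda>t. t) Y \<in> borel_measurable M"
    and "charf (distr M borel (random_integral h (\<lambda>t. t) Y)) y = exp (integral {0..1} (\<lambda>t. \<Phi> (h t *\<^sub>R y)))"
proof -
  note L' = levy_processD[OF L]
  define S where "S n \<omega> = (\<Sum>i<n. h (real (Suc i) / real n) *\<^sub>R (Y (real (Suc i) / real n) \<omega> - Y (real i / real n) \<omega>))" for n \<omega>
  have lim: "\<omega> \<in> space M \<Longrightarrow> (\<lambda>n. S n \<omega>) \<longlonglongrightarrow> random_integral h (\<lambda>t. t) Y \<omega>" for \<omega>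
    unfolding S_def by (rule random_integral_tendsto[OF L _ h])
  have Sm: "S n \<in> borel_measurable M" for n
    unfolding S_def by (intro borel_measurable_sum borel_measurable_scaleR borel_measurable_const borel_measurable_diff L'(2)) auto
  show m: "random_integral h (\<lambda>t. t) Y \<in> borel_measurable M"
    by (rule borel_measurable_LIMSEQ_metric[OF Sm lim])
  have \<Phi>c: "continuous_on UNIV \<Phi>" using \<Phi> by (simp add: has_exponent_def)
  have S_charf: "charf (distr M borel (S n)) y = exp (\<Sum>i<n. (1 / real n) *\<^sub>R \<Phi> (h (real (Suc i) / real n) *\<^sub>R y))"
    for n
  proof -
    have le: "real i / real n \<le> real (Suc i) / real n" for i by (auto intro: divide_right_mono)
    let ?D = "\<lambda>i \<omega>. Y (real (Suc i) / real n) \<omega> - Y (real i / real n) \<omega>"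
    have Dm: "?D i \<in> borel_measurable M" for i by (intro borel_measurable_diff L'(2)) auto
    have "prob_space.indep_vars M (\<lambda>_. borel) ?D {..<n}"
      by (rule L'(4)[of "\<lambda>i. real i / real n"]) (use le in auto)
    then have "prob_space.indep_vars M (\<lambda>_. borel) (\<lambda>i \<omega>. h (real (Suc i) / real n) *\<^sub>R ?D i \<omega>) {..<n}"
      by (rule prob_space.indep_vars_compose2[OF L'(1)]) measurable
    then have "charf (distr M borel (S n)) y = (\<Prod>i<n. charf (distr M borel (\<lambda>\<omega>. h (real (Suc i) / real n) *\<^sub>R ?D i \<omega>)) y)"
      unfolding S_def by (intro charf_sum_indep L'(1)) auto
    also have "\<dots> = (\<Prod>i<n. exp ((1 / real n) *\<^sub>R \<Phi> (h (real (Suc i) / real n) *\<^sub>R y)))"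
    proof (rule prod.cong[OF refl])
      fix i assume "i \<in> {..<n}"
      let ?c = "h (real (Suc i) / real n)"
      have "charf (distr M borel (\<lambda>\<omega>. ?c *\<^sub>R ?D i \<omega>)) y = charf (distr M borel (?D i)) (?c *\<^sub>R y)"
        using Dm by (subst (1 2) charf_distr) auto
      also have "distr M borel (?D i) = distr M borel (Y (1 / real n))"
        using L'(5)[of "real i / real n" "1 / real n"] by (simp add: add_divide_distrib add.commute)
      also have "charf \<dots> (?c *\<^sub>R y) = exp ((1 / real n) *\<^sub>R \<Phi> (?c *\<^sub>R y))"
        using levy_process_charf[OF L \<Phi>, of "1 / real n"] by (simp add: scaleR_conv_of_real)
      finally show "charf (distr M borel (\<lambda>\<omega>. ?c *\<^sub>R ?D i \<omega>)) y = exp ((1 / real n) *\<^sub>R \<Phi> (?c *\<^sub>R y))" .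
    qed
    finally show ?thesis by (simp add: exp_sum)
  qed
  show "charf (distr M borel (random_integral h (\<lambda>t. t) Y)) y = exp (integral {0..1} (\<lambda>t. \<Phi> (h t *\<^sub>R y)))"
  proof (rule LIMSEQ_unique)
    show "(\<lambda>n. charf (distr M borel (S n)) y) \<longlonglongrightarrow> charf (distr M borel (random_integral h (\<lambda>t. t) Y)) y"
      by (intro charf_tendsto L'(1) Sm m AE_I2 lim)
    have "continuous_on {0..1} (\<lambda>t. \<Phi> (h t *\<^sub>R y))"
      by (rule continuous_on_compose2[OF \<Phi>c]) (auto intro!: continuous_intros h)
    then show "(\<lambda>n. charf (distr M borel (S n)) y) \<longlonglongrightarrow> exp (integral {0..1} (\<lambda>t. \<Phi> (h t *\<^sub>R y)))"
      unfolding S_charf by (intro tendsto_exp riemann_sum_tendsto)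
  qed
qed

section \<open>Exponents of the random integral mappings\<close>

lemma ID_roots:
  fixes \<nu> :: "'a::ordered_euclidean_space measure"
  assumes "\<nu> \<in> ID" "has_exponent \<nu> \<Phi>" "n \<ge> 1"
  shows "\<exists>\<rho>. has_exponent \<rho> (\<lambda>y. \<Phi> y / of_nat n)"
  using assms ID_has_exponent has_exponent_levy_exponent by metis

lemma ID_levy_process:
  fixes \<nu> :: "'a::ordered_euclidean_space measure"
  assumes \<nu>: "\<nu> \<in> ID" "has_exponent \<nu> \<Phi>"
  shows "\<exists>(M :: (real \<Rightarrow> 'a) measure) Y. levy_process M Y \<and> distr M borel (Y 1) = \<nu>"
proof -
  obtain M :: "(real \<Rightarrow> 'a) measure" and Y where MY: "levy_process M Y"
      "\<And>t y. t \<ge> 0 \<Longrightarrow> charf (distr M borel (Y t)) y = exp (of_real t * \<Phi> y)"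
    using levy_process_exponent_exists[OF \<nu>(2) ID_roots[OF \<nu>]] by metis
  have "distr M borel (Y 1) = \<nu>"
    using MY(2)[of 1] \<nu>(2) levy_processD(1,2)[OF MY(1)]
    by (intro charf_unique borel_prob_distr) (auto simp: has_exponent_def)
  with MY(1) show ?thesis by blast
qed

text \<open>The required measure is the law at time c of a process with law \<nu> at time 1; roots
  and integer powers alone reach only rational c.\<close>

lemma ID_exponent_scale:
  fixes \<nu> :: "'a::ordered_euclidean_space measure"
  assumes \<nu>: "\<nu> \<in> ID" "has_exponent \<nu> \<Phi>" and c: "c \<ge> 0"
  shows "\<exists>\<rho>. has_exponent \<rho> (\<lambda>y. of_real c * \<Phi> y)"
proof -
  obtain M :: "(real \<Rightarrow> 'a) measure" and Y where MY: "levy_process M Y" "distr M borel (Y 1) = \<nu>"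
    using ID_levy_process[OF \<nu>] by blast
  have "has_exponent (distr M borel (Y c)) (\<lambda>y. of_real c * \<Phi> y)"
    using \<nu>(2) levy_process_charf[OF MY(1), of \<Phi> c] c MY(2) levy_processD(1,2)[OF MY(1)]
    by (auto simp: has_exponent_def intro!: borel_prob_distr continuous_intros)
  then show ?thesis ..
qed

text \<open>The convolution roots needed for membership in \<open>ID\<close> are the powers of order
  c/n.\<close>

lemma conv_powr_exponent:
  fixes \<nu> :: "'a::ordered_euclidean_space measure"
  assumes \<nu>: "\<nu> \<in> ID" "has_exponent \<nu> \<Phi>" and c: "c \<ge> 0"
  shows "has_exponent (conv_powr \<nu> c) (\<lambda>y. of_real c * \<Phi> y)" "conv_powr \<nu> c \<in> ID"
proof -
  obtain \<rho> where \<rho>: "has_exponent \<rho> (\<lambda>y. of_real c * \<Phi> y)" using ID_exponent_scale[OF assms] by blast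
  have "conv_powr \<nu> c = \<rho>"
    unfolding conv_powr_def has_exponent_levy_exponent[OF \<nu>(2)]
  proof (rule the_equality)
    show "borel_prob \<rho> \<and> (\<forall>y. charf \<rho> y = exp (of_real c * \<Phi> y))" using \<rho> by (simp add: has_exponent_def)
    show "\<rho>' = \<rho>" if "borel_prob \<rho>' \<and> (\<forall>y. charf \<rho>' y = exp (of_real c * \<Phi> y))" for \<rho>'
      using that \<rho> by (intro charf_unique) (auto simp: has_exponent_def)
  qed
  then show *: "has_exponent (conv_powr \<nu> c) (\<lambda>y. of_real c * \<Phi> y)" using \<rho> by simp
  have "\<exists>\<rho>. has_exponent \<rho> (\<lambda>y. of_real c * \<Phi> y / of_nat n)" for n
    using ID_exponent_scale[OF \<nu>, of "c / real n"] c by simp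
  with * show "conv_powr \<nu> c \<in> ID" by (rule IDI_has_exponent)
qed

text \<open>With u = t^(1/\<beta>) this is the integral of \<Phi>(u y) against d(u^\<beta>) over
  [0,1].\<close>

definition J_exponent :: "real \<Rightarrow> ('a::real_vector \<Rightarrow> complex) \<Rightarrow> 'a \<Rightarrow> complex" where
  "J_exponent \<beta> \<Phi> y = integral {0..1} (\<lambda>t. \<Phi> (t powr (1 / \<beta>) *\<^sub>R y))"

lemma J_exponent_scale: "J_exponent \<beta> (\<lambda>y. c * \<Phi> y) y = c * J_exponent \<beta> \<Phi> y"
  by (simp add: J_exponent_def)

lemma powr_continuous_01: "0 < \<beta> \<Longrightarrow> continuous_on {0..1} (\<lambda>t::real. t powr (1 / \<beta>))"
  by (intro continuous_on_powr' continuous_intros) auto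

lemma J_exponent_continuous:
  fixes \<Phi> :: "'a::euclidean_space \<Rightarrow> complex"
  assumes "0 < \<beta>" "continuous_on UNIV \<Phi>"
  shows "continuous_on UNIV (J_exponent \<beta> \<Phi>)"
proof -
  have "continuous_on (UNIV \<times> cbox 0 1) (\<lambda>(y, t::real). \<Phi> (t powr (1 / \<beta>) *\<^sub>R y))"
    unfolding split_beta'
    by (intro continuous_on_compose2[OF assms(2)] continuous_on_scaleR continuous_on_powr' continuous_intros) (use assms in auto)
  then have "continuous_on UNIV (\<lambda>y. integral (cbox 0 1) (\<lambda>t. \<Phi> (t powr (1 / \<beta>) *\<^sub>R y)))"
    by (rule integral_continuous_on_param)
  then show ?thesis by (simp add: J_exponent_def[abs_def] box_real)
qed

text \<open>The fact \<open>law\<close> holds for every admissible process with one and the same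
  exponent, so the description in \<open>J_map\<close> has at most one solution;
  \<open>ID_levy_process\<close> supplies one.\<close>

lemma J_map_exponent:
  fixes \<nu> :: "'a::ordered_euclidean_space measure"
  assumes \<beta>: "0 < \<beta>" and \<nu>: "\<nu> \<in> ID" "has_exponent \<nu> \<Phi>"
  shows "has_exponent (J_map \<beta> \<nu>) (J_exponent \<beta> \<Phi>)"
proof -
  let ?h = "\<lambda>t::real. t powr (1 / \<beta>)"
  have h: "continuous_on {0..1} ?h" "mono_on {0..1} ?h"
    using \<beta> by (auto intro!: powr_continuous_01 mono_onI powr_mono2)
  have law: "has_exponent (distr M borel (random_integral ?h (\<lambda>t. t) Y)) (J_exponent \<beta> \<Phi>)"
    if "levy_process M Y" "distr M borel (Y 1) = \<nu>" for M :: "(real \<Rightarrow> 'a) measure" and Y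
  proof -
    have ex: "has_exponent (distr M borel (Y 1)) \<Phi>" using that \<nu> by simp
    show ?thesis
      unfolding has_exponent_def
    proof (intro conjI allI)
      show "borel_prob (distr M borel (random_integral ?h (\<lambda>t. t) Y))"
        by (intro borel_prob_distr levy_processD(1)[OF that(1)] random_integral_charf(1)[OF that(1) ex h])
      show "continuous_on UNIV (J_exponent \<beta> \<Phi>)"
        using \<beta> \<nu> by (intro J_exponent_continuous) (auto simp: has_exponent_def)
      show "J_exponent \<beta> \<Phi> 0 = 0" using \<nu> by (simp add: J_exponent_def has_exponent_def)
      show "charf (distr M borel (random_integral ?h (\<lambda>t. t) Y)) y = exp (J_exponent \<beta> \<Phi> y)" for y
        unfolding J_exponent_def by (rule random_integral_charf(2)[OF that(1) ex h])
    qed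
  qed
  obtain M :: "(real \<Rightarrow> 'a) measure" and Y where MY: "levy_process M Y" "distr M borel (Y 1) = \<nu>"
    using ID_levy_process[OF \<nu>] by blast
  have "J_map \<beta> \<nu> = distr M borel (random_integral ?h (\<lambda>t. t) Y)"
    unfolding J_map_def
    by (rule the_equality) (use MY law has_exponent_unique in blast)+
  then show ?thesis using law[OF MY] by simp
qed

text \<open>Permits a second mapping to be applied. By linearity of \<open>J_exponent\<close> the
  n-th root is the image of the convolution power of order 1/n.\<close>

lemma J_map_ID:
  fixes \<nu> :: "'a::ordered_euclidean_space measure"
  assumes \<beta>: "0 < \<beta>" and \<nu>: "\<nu> \<in> ID" "has_exponent \<nu> \<Phi>"
  shows "J_map \<beta> \<nu> \<in> ID"
proof (rule IDI_has_exponent[OF J_map_exponent[OF assms]])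
  fix n :: nat
  note p = conv_powr_exponent[OF \<nu>, of "1 / real n"]
  have "has_exponent (J_map \<beta> (conv_powr \<nu> (1 / real n))) (J_exponent \<beta> (\<lambda>y. of_real (1 / real n) * \<Phi> y))"
    by (rule J_map_exponent[OF \<beta>]) (use p in auto)
  then show "\<exists>\<rho>. has_exponent \<rho> (\<lambda>y. J_exponent \<beta> \<Phi> y / of_nat n)"
    unfolding J_exponent_scale[abs_def] by auto
qed

section \<open>The integral identity for iterated exponents\<close>

context
  fixes \<alpha> \<beta> :: real
  assumes \<alpha>\<beta>: "0 < \<alpha>" "\<alpha> < \<beta>"
begin

text \<open>Left side minus right side of the identity as a functional of f. It is additive,
  vanishes on monomials and is bounded in the supremum norm, so it vanishes on all continuous
  f.\<close>

definition defect :: "(real \<Rightarrow> complex) \<Rightarrow> complex" where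
  "defect f = of_real (\<beta> - \<alpha>) * integral {0..1} (\<lambda>s. integral {0..1} (\<lambda>t. f (t powr (1 / \<beta>) * s powr (1 / \<alpha>))))
     - of_real \<beta> * integral {0..1} (\<lambda>s. f (s powr (1 / \<alpha>)))
     + of_real \<alpha> * integral {0..1} (\<lambda>t. f (t powr (1 / \<beta>)))"

lemma powr_01:
  fixes t a :: real
  shows "t \<in> {0..1} \<Longrightarrow> 0 < a \<Longrightarrow> t powr (1 / a) \<in> {0..1}"
  using powr_mono2[of "1 / a" t 1] by auto

lemma powr_mult_01: "t \<in> {0..1} \<Longrightarrow> s \<in> {0..1} \<Longrightarrow> t powr (1 / \<beta>) * s powr (1 / \<alpha>) \<in> {0..1}"
  using powr_01[of t \<beta>] powr_01[of s \<alpha>] \<alpha>\<beta> by (auto intro: mult_le_one)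

lemma defect_continuous:
  assumes f: "continuous_on {0..1} (f :: real \<Rightarrow> complex)"
  shows "continuous_on {0..1} (\<lambda>s. f (s powr (1 / \<alpha>)))" "continuous_on {0..1} (\<lambda>t. f (t powr (1 / \<beta>)))"
    "s \<in> {0..1} \<Longrightarrow> continuous_on {0..1} (\<lambda>t. f (t powr (1 / \<beta>) * s powr (1 / \<alpha>)))"
    "continuous_on {0..1} (\<lambda>s. integral {0..1} (\<lambda>t. f (t powr (1 / \<beta>) * s powr (1 / \<alpha>))))"
proof -
  show "continuous_on {0..1} (\<lambda>s. f (s powr (1 / \<alpha>)))" "continuous_on {0..1} (\<lambda>t. f (t powr (1 / \<beta>)))"
    using \<alpha>\<beta> by (auto intro!: continuous_on_compose2[OF f] powr_continuous_01 powr_01)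
  show "continuous_on {0..1} (\<lambda>t. f (t powr (1 / \<beta>) * s powr (1 / \<alpha>)))" if "s \<in> {0..1}"
    using \<alpha>\<beta> by (intro continuous_on_compose2[OF f] continuous_on_mult powr_continuous_01 continuous_on_const)
      (use powr_mult_01 that in auto)
  have "continuous_on ({0..1} \<times> cbox 0 1) (\<lambda>(s, t::real). f (t powr (1 / \<beta>) * s powr (1 / \<alpha>)))"
    unfolding split_beta'
    by (intro continuous_on_compose2[OF f] continuous_on_mult continuous_on_powr' continuous_intros)
      (use \<alpha>\<beta> powr_mult_01 in auto)
  then have "continuous_on {0..1} (\<lambda>s. integral (cbox 0 1) (\<lambda>t. f (t powr (1 / \<beta>) * s powr (1 / \<alpha>))))"
    by (rule integral_continuous_on_param)
  then show "continuous_on {0..1} (\<lambda>s. integral {0..1} (\<lambda>t. f (t powr (1 / \<beta>) * s powr (1 / \<alpha>))))"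
    by (simp add: box_real)
qed

lemma defect_add:
  assumes "continuous_on {0..1} f" "continuous_on {0..1} g"
  shows "defect (\<lambda>x. f x + g x) = defect f + defect g"
proof -
  note c = defect_continuous[OF assms(1)] defect_continuous[OF assms(2)]
  have i: "h integrable_on {0..1}" if "continuous_on {0..1} h" for h :: "real \<Rightarrow> complex"
    using that by (rule integrable_continuous_real)
  have "integral {0..1} (\<lambda>s. integral {0..1} (\<lambda>t. f (t powr (1 / \<beta>) * s powr (1 / \<alpha>)) + g (t powr (1 / \<beta>) * s powr (1 / \<alpha>))))
     = integral {0..1} (\<lambda>s. integral {0..1} (\<lambda>t. f (t powr (1 / \<beta>) * s powr (1 / \<alpha>))) + integral {0..1} (\<lambda>t. g (t powr (1 / \<beta>) * s powr (1 / \<alpha>))))"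
    by (intro integral_cong integral_add i c)
  also have "\<dots> = integral {0..1} (\<lambda>s. integral {0..1} (\<lambda>t. f (t powr (1 / \<beta>) * s powr (1 / \<alpha>))))
      + integral {0..1} (\<lambda>s. integral {0..1} (\<lambda>t. g (t powr (1 / \<beta>) * s powr (1 / \<alpha>))))"
    by (intro integral_add i c)
  finally show ?thesis
    unfolding defect_def using c by (simp add: integral_add i algebra_simps)
qed

lemma has_integral_powr_power:
  assumes "0 < a"
  shows "((\<lambda>t::real. complex_of_real ((t powr (1 / a)) ^ k)) has_integral of_real (a / (real k + a))) {0..1}"
proof -
  have "((\<lambda>t::real. (t powr (1 / a)) ^ k) has_integral (a / (real k + a))) {0..1}"
  proof (cases "k = 0")
    \<comment> \<open>The power rule below fails for k = 0 at t = 0, where the power of exponent 0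
      is 1 but \<open>0 powr 0\<close> is 0.\<close>
    case True
    then show ?thesis using assms has_integral_const_real[of "1::real" 0 1] by simp
  next
    case False
    have "((\<lambda>t. t powr (real k / a)) has_integral (1 powr (real k / a + 1) / (real k / a + 1))) {0..1}"
      by (rule has_integral_powr_from_0) (use assms in \<open>auto intro: less_le_trans[of _ 0]\<close>)
    moreover have "1 powr (real k / a + 1) / (real k / a + 1) = a / (real k + a)"
      using assms by (simp add: field_simps)
    moreover have "(t powr (1 / a)) ^ k = t powr (real k / a)" if "t \<in> {0..1}" for t
    proof (cases "t = 0")
      case True
      then show ?thesis using False by simp
    next
      case F: False
      then have "t powr (1 / a) > 0" using that by simp
      then have "(t powr (1 / a)) ^ k = (t powr (1 / a)) powr real k" by (simp add: powr_realpow)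
      then show ?thesis by (simp add: powr_powr)
    qed
    ultimately show ?thesis by (metis (no_types, lifting) has_integral_cong)
  qed
  then show ?thesis by (rule has_integral_of_real)
qed

text \<open>The integrals factor. With A = \<alpha>/(k+\<alpha>) and B = \<beta>/(k+\<beta>) the
  claim is (\<beta> - \<alpha>) A B = \<beta> A - \<alpha> B, which after division by A B reads
  \<beta> - \<alpha> = (k+\<beta>) - (k+\<alpha>) when k+\<alpha> and k+\<beta> are inserted for
  \<alpha>/A and \<beta>/B.\<close>

lemma defect_monom: "defect (\<lambda>x. c * of_real (x ^ k)) = 0"
proof -
  have i: "integral {0..1} (\<lambda>t::real. complex_of_real ((t powr (1 / a)) ^ k)) = of_real (a / (real k + a))" if "0 < a" for a
    using has_integral_powr_power[OF that] by (rule integral_unique)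
  have \<beta>: "0 < \<beta>" using \<alpha>\<beta> by simp
  have inner: "integral {0..1} (\<lambda>t. c * complex_of_real ((t powr (1 / \<beta>) * s powr (1 / \<alpha>)) ^ k))
     = (c * of_real (\<beta> / (real k + \<beta>))) * complex_of_real ((s powr (1 / \<alpha>)) ^ k)" for s
  proof -
    have "(\<lambda>t. c * complex_of_real ((t powr (1 / \<beta>) * s powr (1 / \<alpha>)) ^ k))
      = (\<lambda>t. (c * complex_of_real ((s powr (1 / \<alpha>)) ^ k)) * complex_of_real ((t powr (1 / \<beta>)) ^ k))"
      by (simp add: power_mult_distrib mult_ac)
    then show ?thesis by (simp only: Henstock_Kurzweil_Integration.integral_mult_right i[OF \<beta>]) (simp add: mult_ac)
  qed
  have "defect (\<lambda>x. c * of_real (x ^ k)) = c * of_real ((\<beta> - \<alpha>) * ((\<beta> / (real k + \<beta>)) * (\<alpha> / (real k + \<alpha>)))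
      - \<beta> * (\<alpha> / (real k + \<alpha>)) + \<alpha> * (\<beta> / (real k + \<beta>)))"
    unfolding defect_def inner
    unfolding Henstock_Kurzweil_Integration.integral_mult_right i[OF \<beta>] i[OF \<alpha>\<beta>(1)] by (simp add: algebra_simps)
  also have "(\<beta> - \<alpha>) * ((\<beta> / (real k + \<beta>)) * (\<alpha> / (real k + \<alpha>))) - \<beta> * (\<alpha> / (real k + \<alpha>)) + \<alpha> * (\<beta> / (real k + \<beta>)) = 0"
  proof -
    have "real k + \<alpha> \<noteq> 0" "real k + \<beta> \<noteq> 0" using \<alpha>\<beta> by (auto simp: add_nonneg_eq_0_iff)
    then show ?thesis by (simp add: divide_simps) (simp add: algebra_simps)
  qed
  finally show ?thesis by simp
qed

lemma defect_polynomial: "defect (\<lambda>x. \<Sum>k\<le>n. c k * of_real (x ^ k)) = 0"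
proof (induction n)
  case 0
  show ?case using defect_monom[of "c 0" 0] by simp
next
  case (Suc n)
  have "defect (\<lambda>x. (\<Sum>k\<le>n. c k * of_real (x ^ k)) + c (Suc n) * of_real (x ^ Suc n)) =
      defect (\<lambda>x. \<Sum>k\<le>n. c k * of_real (x ^ k)) + defect (\<lambda>x. c (Suc n) * of_real (x ^ Suc n))"
    by (rule defect_add) (auto intro!: continuous_intros)
  then show ?case using Suc defect_monom by (simp del: power_Suc)
qed

lemma defect_bound:
  assumes f: "continuous_on {0..1} f" and B: "\<And>x. x \<in> {0..1} \<Longrightarrow> norm (f x) \<le> B"
  shows "norm (defect f) \<le> 2 * \<beta> * B"
proof -
  note c = defect_continuous[OF f]
  have bd: "norm (integral {0..1} h) \<le> B" if "continuous_on {0..1} h" "\<And>t. t \<in> {0..1} \<Longrightarrow> norm (h t) \<le> B" for h :: "real \<Rightarrow> complex"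
    using integral_bound[of 0 1 h B] that by simp
  have 1: "norm (integral {0..1} (\<lambda>s. integral {0..1} (\<lambda>t. f (t powr (1 / \<beta>) * s powr (1 / \<alpha>))))) \<le> B"
    by (intro bd c B powr_mult_01)
  have 2: "norm (integral {0..1} (\<lambda>s. f (s powr (1 / \<alpha>)))) \<le> B" using \<alpha>\<beta> by (intro bd c B powr_01) auto
  have 3: "norm (integral {0..1} (\<lambda>s. f (s powr (1 / \<beta>)))) \<le> B" using \<alpha>\<beta> by (intro bd c B powr_01) auto
  \<comment> \<open>The three coefficients have absolute sum (\<beta> - \<alpha>) + \<beta> +
    \<alpha> = 2 \<beta>.\<close>
  have "norm (defect f) \<le> (\<beta> - \<alpha>) * B + \<beta> * B + \<alpha> * B"
    unfolding defect_def
    using \<alpha>\<beta> by (intro norm_triangle_le norm_triangle_le_diff add_mono)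
      (auto simp: norm_mult simp del: of_real_diff intro!: mult_left_mono 1 2 3)
  then show ?thesis by (simp add: algebra_simps)
qed

lemma defect_zero:
  assumes f: "continuous_on {0..1} f"
  shows "defect f = 0"
proof -
  have "norm (defect f) \<le> 0 + e" if "e > 0" for e
  proof -
    \<comment> \<open>Real and imaginary part are approximated within d each, so the remainder is at
      most 2d in norm and its defect at most 2 \<beta> 2d = e.\<close>
    define d where "d = e / (4 * \<beta>)"
    have d: "d > 0" using \<alpha>\<beta> that by (simp add: d_def)
    obtain p where p: "real_polynomial_function p" "\<And>x. x \<in> {0..1} \<Longrightarrow> \<bar>Re (f x) - p x\<bar> < d"
      using Stone_Weierstrass_real_polynomial_function[of "{0..1}" "\<lambda>x. Re (f x)" d] f d by (auto intro!: continuous_intros)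
    obtain q where q: "real_polynomial_function q" "\<And>x. x \<in> {0..1} \<Longrightarrow> \<bar>Im (f x) - q x\<bar> < d"
      using Stone_Weierstrass_real_polynomial_function[of "{0..1}" "\<lambda>x. Im (f x)" d] f d by (auto intro!: continuous_intros)
    obtain a n where a: "p = (\<lambda>x. \<Sum>i\<le>n. a i * x ^ i)" using p(1) unfolding real_polynomial_function_iff_sum by blast
    obtain b m where b: "q = (\<lambda>x. \<Sum>i\<le>m. b i * x ^ i)" using q(1) unfolding real_polynomial_function_iff_sum by blast
    define P where "P x = (\<Sum>i\<le>n. of_real (a i) * complex_of_real (x ^ i))" for x
    define Q where "Q x = (\<Sum>i\<le>m. (\<i> * of_real (b i)) * complex_of_real (x ^ i))" for x
    have P: "P x = of_real (p x)" for x by (simp add: P_def a)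
    have Q: "Q x = \<i> * of_real (q x)" for x by (simp add: Q_def b sum_distrib_left mult.assoc)
    have PQc: "continuous_on {0..1} P" "continuous_on {0..1} Q"
      unfolding P_def Q_def by (auto intro!: continuous_intros)
    have PQ0: "defect (\<lambda>x. P x + Q x) = 0"
      unfolding defect_add[OF PQc] unfolding P_def Q_def defect_polynomial by simp
    define r where "r x = f x - (P x + Q x)" for x
    have rc: "continuous_on {0..1} r" unfolding r_def by (intro continuous_intros f PQc)
    have "norm (r x) \<le> 2 * d" if "x \<in> {0..1}" for x
    proof -
      have "norm (r x) \<le> \<bar>Re (r x)\<bar> + \<bar>Im (r x)\<bar>" by (rule cmod_le)
      also have "\<dots> \<le> d + d" using p(2)[OF that] q(2)[OF that] by (intro add_mono) (simp_all add: r_def P Q)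
      finally show ?thesis by simp
    qed
    then have "norm (defect r) \<le> 2 * \<beta> * (2 * d)" by (rule defect_bound[OF rc])
    also have "\<dots> = e" using \<alpha>\<beta> by (simp add: d_def)
    finally have "norm (defect r) \<le> e" .
    moreover have "defect f = defect r"
      using defect_add[OF rc continuous_on_add[OF PQc]] PQ0 by (simp add: r_def)
    ultimately show ?thesis by simp
  qed
  then have "norm (defect f) \<le> 0" by (rule field_le_epsilon)
  then show ?thesis by simp
qed

text \<open>For fixed y the iterated exponent evaluates \<Phi> at t^(1/\<beta>) s^(1/\<alpha>) y, so
  this is the scalar identity for f(u) = \<Phi>(u y).\<close>

lemma J_exponent_J_exponent:
  fixes \<Phi> :: "'a::euclidean_space \<Rightarrow> complex"
  assumes \<Phi>: "continuous_on UNIV \<Phi>"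
  shows "of_real (\<beta> - \<alpha>) * J_exponent \<alpha> (J_exponent \<beta> \<Phi>) y =
    of_real \<beta> * J_exponent \<alpha> \<Phi> y - of_real \<alpha> * J_exponent \<beta> \<Phi> y"
proof -
  have "continuous_on {0..1} (\<lambda>u::real. \<Phi> (u *\<^sub>R y))"
    by (rule continuous_on_compose2[OF \<Phi>]) (auto intro!: continuous_intros)
  then have "defect (\<lambda>u. \<Phi> (u *\<^sub>R y)) = 0" by (rule defect_zero)
  then show ?thesis unfolding defect_def J_exponent_def by (simp add: algebra_simps)
qed

end

theorem corollary1:
  fixes \<alpha> \<beta> :: real and \<nu> :: "(real ^ 'd) measure"
  assumes "0 < \<alpha>" and "\<alpha> < \<beta>" and "\<nu> \<in> ID"
  shows "(J_map \<alpha> (J_map \<beta> (conv_powr \<nu> (\<beta> - \<alpha>))) \<star> J_map \<beta> (conv_powr \<nu> \<alpha>))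
           = J_map \<alpha> (conv_powr \<nu> \<beta>)
       \<and> (\<forall>y. of_real (\<beta> - \<alpha>) * levy_exponent (J_map \<alpha> (J_map \<beta> \<nu>)) y
             = of_real \<beta> * levy_exponent (J_map \<alpha> \<nu>) y
               - of_real \<alpha> * levy_exponent (J_map \<beta> \<nu>) y)"
proof -
  have \<beta>: "0 < \<beta>" using assms by simp
  obtain \<Phi> where \<Phi>: "has_exponent \<nu> \<Phi>" using ID_has_exponent[OF assms(3)] by blast
  have J: "has_exponent (J_map a \<mu>) (J_exponent a \<Psi>) \<and> J_map a \<mu> \<in> ID"
    if "0 < a" "\<mu> \<in> ID" "has_exponent \<mu> \<Psi>" for a \<Psi> and \<mu> :: "(real ^ 'd) measure"
    using that J_map_exponent J_map_ID by blast
  have \<Phi>c: "continuous_on UNIV \<Phi>" using \<Phi> by (simp add: has_exponent_def)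
  note id = J_exponent_J_exponent[OF assms(1,2) \<Phi>c]
  \<comment> \<open>Each \<open>J_exponent\<close> is continuous and vanishes at 0, so it is the
    Levy exponent itself; the identity therefore holds exactly and not only modulo 2 pi i.\<close>
  have "levy_exponent (J_map \<alpha> (J_map \<beta> \<nu>)) = J_exponent \<alpha> (J_exponent \<beta> \<Phi>)"
    "levy_exponent (J_map \<alpha> \<nu>) = J_exponent \<alpha> \<Phi>" "levy_exponent (J_map \<beta> \<nu>) = J_exponent \<beta> \<Phi>"
    using J[OF \<beta> assms(3) \<Phi>] J[OF assms(1)] assms(3) \<Phi> has_exponent_levy_exponent by blast+
  then have 2: "\<forall>y. of_real (\<beta> - \<alpha>) * levy_exponent (J_map \<alpha> (J_map \<beta> \<nu>)) y
             = of_real \<beta> * levy_exponent (J_map \<alpha> \<nu>) y - of_real \<alpha> * levy_exponent (J_map \<beta> \<nu>) y"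
    using id by simp
  have cp: "has_exponent (conv_powr \<nu> c) (\<lambda>y. of_real c * \<Phi> y)" "conv_powr \<nu> c \<in> ID" if "c \<ge> 0" for c
    using conv_powr_exponent[OF assms(3) \<Phi> that] .
  \<comment> \<open>\<open>J_exponent\<close> is linear in the exponent, so the factor from the
    convolution power passes through both mappings.\<close>
  have e1: "has_exponent (J_map \<alpha> (J_map \<beta> (conv_powr \<nu> (\<beta> - \<alpha>)))) (\<lambda>y. of_real (\<beta> - \<alpha>) * J_exponent \<alpha> (J_exponent \<beta> \<Phi>) y)"
  proof -
    have "0 \<le> \<beta> - \<alpha>" using assms by simp
    then have "has_exponent (J_map \<beta> (conv_powr \<nu> (\<beta> - \<alpha>))) (\<lambda>y. of_real (\<beta> - \<alpha>) * J_exponent \<beta> \<Phi> y)"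
      "J_map \<beta> (conv_powr \<nu> (\<beta> - \<alpha>)) \<in> ID"
      using J[OF \<beta> cp(2,1)] unfolding J_exponent_scale[abs_def] by blast+
    then show ?thesis using J[OF assms(1)] unfolding J_exponent_scale[abs_def, symmetric] by blast
  qed
  have e2: "has_exponent (J_map \<beta> (conv_powr \<nu> \<alpha>)) (\<lambda>y. of_real \<alpha> * J_exponent \<beta> \<Phi> y)"
    using J[OF \<beta> cp(2,1), of \<alpha>] assms by (simp add: J_exponent_scale[abs_def])
  have e3: "has_exponent (J_map \<alpha> (conv_powr \<nu> \<beta>)) (\<lambda>y. of_real \<beta> * J_exponent \<alpha> \<Phi> y)"
    using J[OF assms(1) cp(2,1), of \<beta>] \<beta> by (simp add: J_exponent_scale[abs_def])
  have "(J_map \<alpha> (J_map \<beta> (conv_powr \<nu> (\<beta> - \<alpha>))) \<star> J_map \<beta> (conv_powr \<nu> \<alpha>)) = J_map \<alpha> (conv_powr \<nu> \<beta>)"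
  proof (rule charf_unique)
    show "borel_prob (J_map \<alpha> (J_map \<beta> (conv_powr \<nu> (\<beta> - \<alpha>))) \<star> J_map \<beta> (conv_powr \<nu> \<alpha>))"
      using e1 e2 by (intro borel_prob_convolution) (auto simp: has_exponent_def)
    show "borel_prob (J_map \<alpha> (conv_powr \<nu> \<beta>))" using e3 by (simp add: has_exponent_def)
    fix y
    \<comment> \<open>Convolution adds exponents, and by \<open>id\<close> the sum is \<beta> times
      \<open>J_exponent \<alpha> \<Phi>\<close>, the exponent of the right side.\<close>
    have "charf (J_map \<alpha> (J_map \<beta> (conv_powr \<nu> (\<beta> - \<alpha>))) \<star> J_map \<beta> (conv_powr \<nu> \<alpha>)) y =
        exp (of_real (\<beta> - \<alpha>) * J_exponent \<alpha> (J_exponent \<beta> \<Phi>) y + of_real \<alpha> * J_exponent \<beta> \<Phi> y)"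
      using e1 e2 by (subst charf_convolution) (auto simp: has_exponent_def exp_add simp del: of_real_diff)
    also have "\<dots> = charf (J_map \<alpha> (conv_powr \<nu> \<beta>)) y"
      using e3 unfolding id by (simp add: has_exponent_def)
    finally show "charf (J_map \<alpha> (J_map \<beta> (conv_powr \<nu> (\<beta> - \<alpha>))) \<star> J_map \<beta> (conv_powr \<nu> \<alpha>)) y = charf (J_map \<alpha> (conv_powr \<nu> \<beta>)) y" .
  qed
  with 2 show ?thesis by blast
qed

end
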